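(* Let $d\ge 1$ and let $u:\mathbb{R}^d\times\mathbb{R}\to\mathbb{C}$ be a solution of the Schr\"odinger equation $i\partial_t u+\Delta u=0$ with initial data $u(\cdot,0)=u_0\in L^2(\mathbb{R}^d)$ satisfying the frequency localization $\operatorname{supp}\widehat{u_0}\subset B_1$ (the unit ball centred at the origin); write $u_t(x)=u(x,t)$. Then there exist a radius $r>0$, a speed limit $V>0$ and a constant $C>0$ with the following property: for every $R>0$ there exist a countable collection of paths $\gamma_i:\mathbb{R}\to\mathbb{R}^d$ of speed at most $V$ (i.e. $|\gamma_i'|\le V$) and nonnegative weights $w_i$ such that \[ |u_t(x)|^2\le \sum_i w_i\,T_{\gamma_i,r}(x,t)\quad\text{for all }(x,t)\in\mathbb{R}^d\times[-R,R], \] and \[ \sum_i r^d w_i\le C\int_{\mathbb{R}^d}|u_t|^2\,dx. \]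
   Context: For a path $\gamma:\mathbb{R}\to\mathbb{R}^d$ and $r>0$, the tube of width $r$ centred at $\gamma$ is $T_{\gamma,r}=\{(x,t)\in\mathbb{R}^d\times\mathbb{R}: |x-\gamma(t)|\le r\}$; the same symbol denotes its indicator function. Note $\int|u_t|^2dx$ is independent of $t$ (conservation of mass). *)

theory Defs
  imports "HOL-Analysis.Analysis"
begin

definition tube :: "(real \<Rightarrow> 'a::euclidean_space) \<Rightarrow> real \<Rightarrow> ('a \<times> real) set" where
  "tube \<gamma> r = {(x, t). norm (x - \<gamma> t) \<le> r}"

text \<open>The solution of i u_t + Delta u = 0 whose initial datum has Fourier transform g
  (Fourier convention: f^(xi) = int f(x) e^{-i x.xi} dx), given by
  u(x,t) = (2 pi)^{-d} int g(xi) e^{i(x.xi - t |xi|^2)} dxi.\<close>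
definition schrod_sol :: "('a::euclidean_space \<Rightarrow> complex) \<Rightarrow> 'a \<Rightarrow> real \<Rightarrow> complex" where
  "schrod_sol g x t = complex_of_real (1 / (2 * pi) ^ DIM('a)) *
     integral\<^sup>L lebesgue (\<lambda>\<xi>. g \<xi> * cis (\<xi> \<bullet> x - t * (norm \<xi>)\<^sup>2))"

definition schrod_freq_loc :: "('a::euclidean_space \<Rightarrow> real \<Rightarrow> complex) \<Rightarrow> bool" where
  "schrod_freq_loc u \<longleftrightarrow> (\<exists>g :: 'a \<Rightarrow> complex.
      g \<in> borel_measurable lebesgue \<and>
      integrable lebesgue (\<lambda>\<xi>. (cmod (g \<xi>))\<^sup>2) \<and>
      (\<forall>\<xi>. 1 < norm \<xi> \<longrightarrow> g \<xi> = 0) \<and>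
      u = schrod_sol g)"

end

theory Submission
  imports Defs "HOL-Probability.Probability"
begin

text \<open>Since the frequencies lie in the unit ball, the values of a solution on the integer lattice
  determine it, and the solution at one time is a convolution, over the lattice, of the solution at
  an earlier time with a rapidly decaying kernel. This gives an explicit signed transport of the
  lattice masses \<open>|u|\<^sup>2\<close> from one time to the next. Averaging the masses against a slowly decaying
  weight makes the density vary by a bounded factor between neighbouring points and, by rerouting
  long displacements through intermediate points, turns the transport over a short time step into a
  nearest-neighbour flux that is at most half of the density. Such a flux is realised by a positive
  coupling moving mass a bounded distance. Chaining the couplings gives a countable family of
  weighted lattice paths whose marginal at each time is the averaged density, and smooth
  interpolations of these paths are the centres of the tubes. The time variable is split into one
  time per coordinate, so that each step is one-dimensional. Nothing degrades with the number of
  steps, because the couplings preserve the marginals exactly.\<close>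

section \<open>Bessel's inequality on the cube\<close>

text \<open>The obstacle is the zeros of \<open>u\<close>: mass may have to flow across a point
  where \<open>|u|^2\<close> vanishes, and a positive coupling can take nothing from there. The
  averaged density \<open>rho\<close> escapes through a Harnack inequality,
  \<open>rho_shift_le\<close>, whose constant depends neither on place nor on time. On the flux side
  averaging is free, since it commutes with lattice translations and so preserves the flux identity.

  The weight \<open>phi y = 1 / (1 + y^2)\<close> is a compromise: summable, yet bounded by a
  multiple of itself after self-convolution, so that \<open>rho\<close> dominates its own line
  averages. The kernel of the evolution must then decay like \<open>phi^2\<close>. One factor pays
  for the sum over displacements \<open>k\<close>, the other for the rerouting through the points
  between 0 and \<open>k\<close>. This asks for four bounded derivatives and explains the splines of
  degree 5. Frequencies fill only \<open>[-1, 1]\<close> in each coordinate while the dual period is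
  \<open>[-pi, pi]\<close>, which leaves room for a cutoff.

  The total weight is defined at the initial time but estimated at time 0; all laws share one
  normalisation, which carries the estimate over.\<close>

definition lattice :: "'a::euclidean_space set" where
  "lattice = {z. \<forall>b\<in>Basis. z \<bullet> b \<in> \<int>}"

definition pi_cube :: "'a::euclidean_space set" where
  "pi_cube = cbox (- (pi *\<^sub>R One)) (pi *\<^sub>R One)"

lemma mem_pi_cube: "x \<in> pi_cube \<longleftrightarrow> (\<forall>b\<in>Basis. x \<bullet> b \<in> {-pi..pi})"
  by (auto simp: pi_cube_def mem_box)

lemma integral_cis_period:
  assumes "k \<in> \<int>"
  shows "integral\<^sup>L lborel (\<lambda>x::real. indicator {-pi..pi} x *\<^sub>R cis (k * x)) =
    (if k = 0 then complex_of_real (2 * pi) else 0)"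
proof (cases "k = 0")
  case True
  then show ?thesis by (simp add: measure_lborel_Icc scaleR_conv_of_real)
next
  case False
  have "integral\<^sup>L lborel (\<lambda>x::real. indicator {-pi..pi} x *\<^sub>R cis (k * x)) =
     (cis (k * pi) / (\<i> * k)) - (cis (k * (-pi)) / (\<i> * k))"
  proof (rule integral_FTC_Icc)
    fix x :: real
    have "((\<lambda>z. exp (\<i> * k * z) / (\<i> * k)) has_field_derivative exp (\<i> * k * of_real x)) (at (of_real x))"
      using False by (auto intro!: derivative_eq_intros)
    from has_vector_derivative_real_field[OF this]
    show "((\<lambda>x. cis (k * x) / (\<i> * complex_of_real k)) has_vector_derivative cis (k * x))
      (at x within {-pi..pi})"
      by (simp add: cis_conv_exp mult.assoc)
  qed (auto intro!: continuous_intros)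
  also have "cis (k * (-pi)) = cis (k * pi)"
  proof -
    obtain m where "k = of_int m" using assms by (auto elim: Ints_cases)
    then show ?thesis by (simp add: cis.code complex_eq_iff sin_int_times_real mult.commute)
  qed
  finally show ?thesis using False by simp
qed

lemma integrable_indicator_cis:
  "integrable lborel (\<lambda>x::real. indicator {a..b} x *\<^sub>R cis (k * x))"
proof -
  have "continuous_on {a..b} (\<lambda>x. cis (k * x))" by (intro continuous_intros)
  from borel_integrable_compact[OF compact_Icc this] show ?thesis
    by (auto simp: set_integrable_def indicator_def if_distrib cong: if_cong)
qed

lemma
  fixes f :: "'a::euclidean_space \<Rightarrow> real \<Rightarrow> complex"
  assumes f: "\<And>b. b \<in> Basis \<Longrightarrow> integrable lborel (f b)"
  shows integral_lborel_prod:
      "integral\<^sup>L lborel (\<lambda>x. \<Prod>b\<in>Basis. f b (x \<bullet> b)) = (\<Prod>b\<in>Basis. integral\<^sup>L lborel (f b))"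
    and integrable_lborel_prod: "integrable lborel (\<lambda>x. \<Prod>b\<in>Basis. f b (x \<bullet> b))"
proof -
  interpret product_sigma_finite "\<lambda>_::'a. lborel::real measure" ..
  have [measurable]: "f b \<in> borel_measurable borel" if "b \<in> Basis" for b
    using f[OF that] by (simp add: integrable_iff_bounded)
  have meas: "(\<lambda>x. \<Prod>b\<in>Basis. f b (x \<bullet> b)) \<in> borel_measurable borel"
    by measurable
  have emb: "(\<lambda>f. \<Sum>b\<in>Basis. f b *\<^sub>R b) \<in> measurable (\<Pi>\<^sub>M b\<in>Basis. lborel) borel"
    by measurable
  have eq: "(\<Prod>b\<in>Basis. f b ((\<Sum>b\<in>Basis. x b *\<^sub>R b) \<bullet> b)) = (\<Prod>b\<in>Basis. f b (x b))" for x :: "'a \<Rightarrow> real"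
    by (intro prod.cong) auto
  show "integral\<^sup>L lborel (\<lambda>x. \<Prod>b\<in>Basis. f b (x \<bullet> b)) = (\<Prod>b\<in>Basis. integral\<^sup>L lborel (f b))"
    apply (subst lborel_eq)
    apply (subst integral_distr[OF emb meas])
    using product_integral_prod[OF finite_Basis, of f] f by (simp add: eq)
  show "integrable lborel (\<lambda>x. \<Prod>b\<in>Basis. f b (x \<bullet> b))"
    apply (subst lborel_eq)
    apply (subst integrable_distr_eq[OF emb meas])
    using product_integrable_prod[OF finite_Basis, of f] f by (simp add: eq)
qed

lemma prod_indicator_cis:
  fixes x n :: "'a::euclidean_space"
  shows "(\<Prod>b\<in>Basis. indicator {-pi..pi} (x \<bullet> b) *\<^sub>R cis ((n \<bullet> b) * (x \<bullet> b))) =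
    indicator pi_cube x *\<^sub>R cis (x \<bullet> n)"
proof -
  have "(\<Prod>b\<in>Basis. cis ((n \<bullet> b) * (x \<bullet> b))) = cis (\<Sum>b\<in>Basis. (n \<bullet> b) * (x \<bullet> b))"
    by (simp add: cis_conv_exp exp_sum sum_distrib_left)
  also have "(\<Sum>b\<in>Basis. (n \<bullet> b) * (x \<bullet> b)) = x \<bullet> n"
    by (subst (3) euclidean_inner) (simp add: mult.commute)
  finally show ?thesis
    by (cases "x \<in> pi_cube")
       (auto simp: mem_pi_cube indicator_def intro!: prod_zero bexI)
qed

lemma
  fixes n :: "'a::euclidean_space"
  assumes "n \<in> lattice"
  shows integral_pi_cube_cis: "integral\<^sup>L lebesgue (\<lambda>x. indicator pi_cube x *\<^sub>R cis (x \<bullet> n)) =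
      (if n = 0 then (2 * pi) ^ DIM('a) else 0)"
    and integrable_pi_cube_cis: "integrable lebesgue (\<lambda>x. indicator pi_cube x *\<^sub>R cis (x \<bullet> n))"
proof -
  have meas: "(\<lambda>x. indicator pi_cube x *\<^sub>R cis (x \<bullet> n)) \<in> borel_measurable lborel"
    unfolding measurable_lborel2
    by (intro borel_measurable_scaleR borel_measurable_indicator
        borel_measurable_continuous_onI[of "\<lambda>x. cis (x \<bullet> n)"] continuous_intros) (simp add: pi_cube_def)
  have int: "integrable lborel (\<lambda>x. indicator {-pi..pi} x *\<^sub>R cis ((n \<bullet> b) * x))" for b
    by (rule integrable_indicator_cis)
  have "integral\<^sup>L lborel (\<lambda>x. indicator pi_cube x *\<^sub>R cis (x \<bullet> n)) =
      (\<Prod>b\<in>Basis. if n \<bullet> b = 0 then complex_of_real (2 * pi) else 0)"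
    unfolding prod_indicator_cis[symmetric]
    using assms
    by (subst integral_lborel_prod[OF int])
       (intro prod.cong, auto simp: lattice_def integral_cis_period)
  also have "\<dots> = (if n = 0 then (2 * pi) ^ DIM('a) else 0)"
  proof (cases "n = 0")
    case False
    then obtain b where "b \<in> Basis" "n \<bullet> b \<noteq> 0" using euclidean_all_zero_iff[of n] by blast
    with False show ?thesis by (auto intro!: bexI)
  qed simp
  finally show "integral\<^sup>L lebesgue (\<lambda>x. indicator pi_cube x *\<^sub>R cis (x \<bullet> n)) =
      (if n = 0 then (2 * pi) ^ DIM('a) else 0)"
    using meas by (simp add: integral_completion)
  have "integrable lborel (\<lambda>x. indicator pi_cube x *\<^sub>R cis (x \<bullet> n))"
    unfolding prod_indicator_cis[symmetric] by (rule integrable_lborel_prod[OF int])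
  then show "integrable lebesgue (\<lambda>x. indicator pi_cube x *\<^sub>R cis (x \<bullet> n))"
    using meas by (simp add: integrable_completion)
qed

lemma lattice_diff: "x \<in> lattice \<Longrightarrow> y \<in> lattice \<Longrightarrow> x - y \<in> lattice"
  by (simp add: lattice_def inner_diff_left)

text \<open>On \<open>S\<close> the modulus is at most \<open>1 + |g|^2\<close>, and the constant is
  integrable there because \<open>S\<close> has finite measure.\<close>

lemma integrable_of_square_integrable:
  fixes g :: "'a::euclidean_space \<Rightarrow> complex"
  assumes g: "g \<in> borel_measurable lebesgue" "integrable lebesgue (\<lambda>x. (cmod (g x))\<^sup>2)"
    and S: "S \<in> lmeasurable" "\<And>x. x \<notin> S \<Longrightarrow> g x = 0"
  shows "integrable lebesgue g"
proof (rule Bochner_Integration.integrable_bound)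
  show "integrable lebesgue (\<lambda>x. indicator S x + (cmod (g x))\<^sup>2)"
    using g S by (auto simp: fmeasurable_def)
  have "cmod (g x) \<le> indicator S x + (cmod (g x))\<^sup>2" for x
  proof (cases "x \<in> S")
    case True
    have "cmod (g x) * 2 \<le> 1 + (cmod (g x))\<^sup>2" 
      using sum_squares_bound[of 1 "cmod (g x)"] by simp
    then show ?thesis using True norm_ge_zero[of "g x"] zero_le_power2[of "cmod (g x)"] by (simp del: zero_le_power2 norm_ge_zero)
  qed (simp add: S)
  then show "AE x in lebesgue. norm (g x) \<le> norm (indicator S x + (cmod (g x))\<^sup>2)"
    by (auto intro!: AE_I2 order_trans[OF _ abs_ge_self])
qed (fact g)

text \<open>Dual form of Bessel's inequality: test \<open>g\<close> against the trigonometric polynomial formed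
  from its own coefficients.\<close>

theorem bessel_inequality:
  fixes g :: "'a::euclidean_space \<Rightarrow> complex"
  assumes g: "g \<in> borel_measurable lebesgue" "integrable lebesgue (\<lambda>x. (cmod (g x))\<^sup>2)"
    and supp: "\<And>x. x \<notin> pi_cube \<Longrightarrow> g x = 0"
    and F: "finite F" "F \<subseteq> lattice"
  shows "(\<Sum>n\<in>F. (cmod (integral\<^sup>L lebesgue (\<lambda>x. g x * cis (x \<bullet> n))))\<^sup>2) \<le>
    (2 * pi) ^ DIM('a) * integral\<^sup>L lebesgue (\<lambda>x. (cmod (g x))\<^sup>2)"
proof -
  define c where "c n = integral\<^sup>L lebesgue (\<lambda>x. g x * cis (x \<bullet> n))" for n
  define P where "P x = (\<Sum>n\<in>F. cnj (c n) * (indicator pi_cube x *\<^sub>R cis (x \<bullet> n)))" for x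
  define S where "S = (\<Sum>n\<in>F. (cmod (c n))\<^sup>2)"
  define L :: real where "L = (2 * pi) ^ DIM('a)"
  have L: "L > 0" by (simp add: L_def)
  have gi: "integrable lebesgue g"
    by (rule integrable_of_square_integrable[OF g, of pi_cube]) (auto simp: supp pi_cube_def)
  have meas[measurable]: "(\<lambda>x. cis (x \<bullet> n)) \<in> borel_measurable lebesgue" for n :: 'a
    by (intro measurable_completion)
      (auto intro!: borel_measurable_continuous_onI continuous_intros)
  have gci: "integrable lebesgue (\<lambda>x. g x * cis (x \<bullet> n))" for n
    by (rule Bochner_Integration.integrable_bound[OF gi]) (use g in \<open>auto simp: norm_mult\<close>)
  have gP: "integrable lebesgue (\<lambda>x. g x * P x)" "integral\<^sup>L lebesgue (\<lambda>x. g x * P x) = S"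
  proof -
    have eq: "g x * P x = (\<Sum>n\<in>F. cnj (c n) * (g x * cis (x \<bullet> n)))" for x
      by (cases "x \<in> pi_cube") (auto simp: P_def supp sum_distrib_left mult_ac)
    show "integrable lebesgue (\<lambda>x. g x * P x)"
      unfolding eq by (intro Bochner_Integration.integrable_sum integrable_mult_right gci)
    have "integral\<^sup>L lebesgue (\<lambda>x. g x * P x) = (\<Sum>n\<in>F. cnj (c n) * c n)"
      unfolding eq
      by (subst Bochner_Integration.integral_sum) (auto intro!: integrable_mult_right gci simp: c_def)
    also have "\<dots> = S"
      by (simp add: S_def complex_norm_square mult.commute del: of_real_power)
    finally show "integral\<^sup>L lebesgue (\<lambda>x. g x * P x) = S" .
  qed
  have PP: "integrable lebesgue (\<lambda>x. (cmod (P x))\<^sup>2)" "integral\<^sup>L lebesgue (\<lambda>x. (cmod (P x))\<^sup>2) = L * S"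
  proof -
    have eq: "complex_of_real ((cmod (P x))\<^sup>2) =
       (\<Sum>n\<in>F. \<Sum>m\<in>F. cnj (c n) * c m * (indicator pi_cube x *\<^sub>R cis (x \<bullet> (n - m))))" for x
    proof (cases "x \<in> pi_cube")
      case True
      have "complex_of_real ((cmod (P x))\<^sup>2) = P x * cnj (P x)"
        by (rule complex_norm_square)
      also have "\<dots> = (\<Sum>n\<in>F. \<Sum>m\<in>F. (cnj (c n) * cis (x \<bullet> n)) * (c m * cnj (cis (x \<bullet> m))))"
        using True by (simp add: P_def sum_product)
      also have "\<dots> = (\<Sum>n\<in>F. \<Sum>m\<in>F. cnj (c n) * c m * cis (x \<bullet> (n - m)))"
        by (intro sum.cong refl) (simp add: inner_diff_right cis_divide[symmetric] cis_cnj divide_inverse mult_ac)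
      finally show ?thesis using True by simp
    qed (simp add: P_def)
    have int: "integrable lebesgue (\<lambda>x. cnj (c n) * c m * (indicator pi_cube x *\<^sub>R cis (x \<bullet> (n - m))))"
      if "n \<in> F" "m \<in> F" for n m
      using integrable_pi_cube_cis[of "n - m"] F that
      by (intro integrable_mult_right) (auto intro: lattice_diff)
    have "integrable lebesgue (\<lambda>x. complex_of_real ((cmod (P x))\<^sup>2))"
      unfolding eq by (intro Bochner_Integration.integrable_sum int)
    then show i: "integrable lebesgue (\<lambda>x. (cmod (P x))\<^sup>2)"
      by (simp only: complex_of_real_integrable_eq)
    have "complex_of_real (integral\<^sup>L lebesgue (\<lambda>x. (cmod (P x))\<^sup>2)) =
      integral\<^sup>L lebesgue (\<lambda>x. complex_of_real ((cmod (P x))\<^sup>2))"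
      by (rule integral_complex_of_real[symmetric])
    also have "\<dots> = (\<Sum>n\<in>F. \<Sum>m\<in>F. cnj (c n) * c m * (if n - m = 0 then L else 0))"
      unfolding eq
      apply (subst Bochner_Integration.integral_sum)
       apply (intro Bochner_Integration.integrable_sum int; assumption)
      apply (intro sum.cong refl)
      apply (subst Bochner_Integration.integral_sum)
       apply (intro int; assumption)
      apply (intro sum.cong refl)
      subgoal for n m
        using F integral_pi_cube_cis[of "n - m"]
        by (auto simp: lattice_diff subset_eq L_def simp del: mult_scaleR_right)
      done
    also have "\<dots> = (\<Sum>n\<in>F. \<Sum>m\<in>F. if n = m then L * (cnj (c n) * c n) else 0)"
      by (intro sum.cong) auto
    also have "\<dots> = L * S"
      using F by (simp add: S_def complex_norm_square sum_distrib_left mult.commute del: of_real_power)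
    finally show "integral\<^sup>L lebesgue (\<lambda>x. (cmod (P x))\<^sup>2) = L * S"
      by (simp only: of_real_eq_iff)
  qed
  \<comment> \<open>Young's inequality with weight \<open>L\<close>: the polynomial then contributes
    \<open>L * S / L = S\<close>, which half of the left side absorbs.\<close>
  have "2 * S = Re (integral\<^sup>L lebesgue (\<lambda>x. 2 * (g x * P x)))"
    using gP by simp
  also have "\<dots> = integral\<^sup>L lebesgue (\<lambda>x. Re (2 * (g x * P x)))"
    using gP by (intro integral_Re[symmetric] integrable_mult_right)
  also have "\<dots> \<le> integral\<^sup>L lebesgue (\<lambda>x. L * (cmod (g x))\<^sup>2 + (cmod (P x))\<^sup>2 / L)"
  proof (rule integral_mono)
    show "integrable lebesgue (\<lambda>x. Re (2 * (g x * P x)))"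
      using gP by (intro integrable_Re integrable_mult_right)
    show "integrable lebesgue (\<lambda>x. L * (cmod (g x))\<^sup>2 + (cmod (P x))\<^sup>2 / L)"
      using g PP by auto
    show "Re (2 * (g x * P x)) \<le> L * (cmod (g x))\<^sup>2 + (cmod (P x))\<^sup>2 / L" for x
    proof -
      have "Re (2 * (g x * P x)) \<le> 2 * (cmod (g x) * cmod (P x))"
        using complex_Re_le_cmod[of "2 * (g x * P x)"] by (simp add: norm_mult)
      also have "\<dots> \<le> L * (cmod (g x))\<^sup>2 + (cmod (P x))\<^sup>2 / L"
      proof -
        have "0 \<le> (L * cmod (g x) - cmod (P x))\<^sup>2 / L" using L by simp
        also have "\<dots> = L * (cmod (g x))\<^sup>2 + (cmod (P x))\<^sup>2 / L - 2 * (cmod (g x) * cmod (P x))"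
          using L by (simp add: field_simps power2_eq_square)
        finally show ?thesis by simp
      qed
      finally show ?thesis .
    qed
  qed
  also have "\<dots> = L * integral\<^sup>L lebesgue (\<lambda>x. (cmod (g x))\<^sup>2) + S"
    using g PP L by simp
  finally show ?thesis by (simp add: S_def c_def L_def)
qed
section \<open>The lattice weight\<close>

text \<open>Three properties drive the choice: summability over the integers, monotonicity in
  \<open>\<bar>y\<bar>\<close>, and stability under convolution up to a constant. The last fails for
  exponential decay, whose self-convolution gains a linearly growing factor.\<close>

definition phi :: "real \<Rightarrow> real" where "phi y = 1 / (1 + y\<^sup>2)"

lemma phi_pos: "0 < phi y" and phi_le_1: "phi y \<le> 1" and phi_0 [simp]: "phi 0 = 1"
  and phi_minus [simp]: "phi (- y) = phi y"
  by (auto simp: phi_def add_nonneg_pos add_pos_nonneg divide_simps)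

lemma phi_nonneg: "0 \<le> phi y"
  using phi_pos[of y] by simp

lemma phi_square_le: "(phi y)\<^sup>2 \<le> phi y"
  using phi_le_1[of y] phi_nonneg[of y] by (simp add: power2_eq_square mult_left_le)

lemma phi_mono: "\<bar>x\<bar> \<le> \<bar>y\<bar> \<Longrightarrow> phi y \<le> phi x"
  unfolding phi_def by (intro divide_left_mono) (auto simp: abs_le_square_iff add_pos_nonneg)

lemma phi_summable: "(\<lambda>k::int. phi (of_int k)) summable_on UNIV"
proof -
  have s: "summable (\<lambda>n::nat. phi (real n))"
  proof (rule summable_comparison_test')
    show "summable (\<lambda>n::nat. 1 / real n ^ 2)"
      using inverse_power_summable[of 2, where 'a=real] by (simp add: divide_inverse)
    show "norm (phi (real n)) \<le> 1 / real n ^ 2" if "n \<ge> 1" for n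
      using that phi_nonneg[of n] by (auto simp: phi_def add_pos_nonneg intro!: divide_left_mono mult_pos_pos)
  qed
  then have n: "(\<lambda>n::nat. phi (real n)) summable_on UNIV"
    by (simp add: summable_on_UNIV_nonneg_real_iff phi_nonneg)
  have "(\<lambda>k::int. phi (of_int k)) summable_on (range int)"
    by (subst summable_on_reindex) (use n in \<open>auto simp: o_def\<close>)
  moreover have "(\<lambda>k::int. phi (of_int k)) summable_on (range (\<lambda>n. - int n))"
    by (subst summable_on_reindex) (use n in \<open>auto simp: o_def inj_on_def\<close>)
  ultimately have "(\<lambda>k::int. phi (of_int k)) summable_on (range int \<union> range (\<lambda>n. - int n))"
    by (rule summable_on_union)
  also have "range int \<union> range (\<lambda>n. - int n) = UNIV"
    using int_cases2 by (auto simp: set_eq_iff image_iff) blast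
  finally show ?thesis .
qed

definition phi_mass :: real where "phi_mass = (\<Sum>\<^sub>\<infinity>k::int. phi (of_int k))"

lemma phi_mass_ge_1: "1 \<le> phi_mass"
  using finite_sum_le_infsum[OF phi_summable, of "{0}"] by (simp add: phi_mass_def phi_nonneg)

text \<open>From \<open>(x + y)^2 \<le> 2 * (x^2 + y^2)\<close>, divided by the product of the three
  denominators. The gain is that \<open>phi (x + y)\<close> comes out as a factor while one summable
  factor remains, which is what a convolution estimate needs.\<close>

lemma phi_mult_le: "phi x * phi y \<le> 2 * phi (x + y) * (phi x + phi y)"
proof -
  have "0 \<le> (x - y)\<^sup>2" by simp
  then have "1 + (x + y)\<^sup>2 \<le> 2 * ((1 + x\<^sup>2) + (1 + y\<^sup>2))"
    by (simp add: power2_eq_square algebra_simps)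
  moreover have pos: "1 + x\<^sup>2 > 0" "1 + y\<^sup>2 > 0" "1 + (x + y)\<^sup>2 > 0"
    by (auto simp: add_pos_nonneg)
  moreover have "1 / (a * b) \<le> 2 * (1 / c) * (1 / a + 1 / b)"
    if "a > 0" "b > 0" "c > 0" "c \<le> 2 * (a + b)" for a b c :: real
    using that by (simp add: field_simps)
  ultimately show ?thesis unfolding phi_def by simp
qed

lemma phi_conv_le:
  assumes "y \<in> \<int>"
  shows "(\<Sum>\<^sub>\<infinity>k::int. phi (of_int k) * phi (y - of_int k)) \<le> 4 * phi_mass * phi y"
proof -
  obtain m where m: "y = of_int m" using assms by (auto elim: Ints_cases)
  have bij: "bij_betw (\<lambda>k. m - k) (UNIV::int set) UNIV"
    by (rule bij_betw_byWitness[where f' = "\<lambda>k. m - k"]) auto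
  have s: "(\<lambda>k::int. phi (y - of_int k)) summable_on UNIV"
    using summable_on_reindex_bij_betw[OF bij, of "\<lambda>k. phi (of_int k)"] phi_summable
    by (simp add: m)
  have i: "(\<Sum>\<^sub>\<infinity>k::int. phi (y - of_int k)) = phi_mass"
    using infsum_reindex_bij_betw[OF bij, of "\<lambda>k. phi (of_int k)"]
    by (simp add: m phi_mass_def)
  have b: "phi (of_int k) * phi (y - of_int k) \<le> 2 * phi y * (phi (of_int k) + phi (y - of_int k))" for k
    using phi_mult_le[of "of_int k" "y - of_int k"] by simp
  have s2: "(\<lambda>k::int. 2 * phi y * (phi (of_int k) + phi (y - of_int k))) summable_on UNIV"
    by (intro summable_on_cmult_right summable_on_add phi_summable s)
  have s3: "(\<lambda>k::int. phi (of_int k) * phi (y - of_int k)) summable_on UNIV"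
    by (rule summable_on_comparison_test[OF s2]) (auto simp: b phi_nonneg)
  have "(\<Sum>\<^sub>\<infinity>k::int. phi (of_int k) * phi (y - of_int k))
      \<le> (\<Sum>\<^sub>\<infinity>k::int. 2 * phi y * (phi (of_int k) + phi (y - of_int k)))"
    by (intro infsum_mono s2 s3 b)
  also have "\<dots> = 4 * phi_mass * phi y"
    by (subst infsum_cmult_right')
       (simp add: infsum_add[OF phi_summable s] i phi_mass_def[symmetric])
  finally show "(\<Sum>\<^sub>\<infinity>k::int. phi (of_int k) * phi (y - of_int k)) \<le> 4 * phi_mass * phi y" .
qed

section \<open>Fourier inversion on the circle\<close>

definition fourier_coeff :: "(real \<Rightarrow> complex) \<Rightarrow> int \<Rightarrow> complex" where
  "fourier_coeff f k = integral {-pi..pi} (\<lambda>x. f x * cis (- (of_int k * x))) / (2 * pi)"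

text \<open>Bessel's inequality in dimension one makes the squared coefficients summable, so they
  tend to 0. The sign \<open>s\<close> selects an end of the index range, because the telescoped
  partial sums below leave one coefficient at each end.\<close>

lemma riemann_lebesgue:
  fixes g :: "real \<Rightarrow> complex"
  assumes g: "continuous_on {-pi..pi} g" and s: "s \<in> {1, -1::int}"
  shows "(\<lambda>n. fourier_coeff g (s * int n)) \<longlonglongrightarrow> 0"
proof -
  define h where "h x = indicator {-pi..pi} x *\<^sub>R g x" for x
  have cube: "(pi_cube :: real set) = {-pi..pi}"
    by (auto simp: pi_cube_def cbox_interval)
  have hm: "h \<in> borel_measurable borel"
    unfolding h_def[abs_def] using g by (intro borel_measurable_continuous_on_indicator) auto
  have hi: "integrable lborel (\<lambda>x. (cmod (h x))\<^sup>2)"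
  proof -
    have "continuous_on {-pi..pi} (\<lambda>x. (cmod (g x))\<^sup>2)" using g by (intro continuous_intros)
    from borel_integrable_compact[OF compact_Icc this] show ?thesis
      by (rule Bochner_Integration.integrable_cong[THEN iffD1, rotated 2])
        (auto simp: h_def indicator_def)
  qed
  have coeff: "fourier_coeff g k = integral\<^sup>L lebesgue (\<lambda>x. h x * cis (x \<bullet> (- of_int k))) / (2 * pi)" for k
  proof -
    have "continuous_on {-pi..pi} (\<lambda>x. g x * cis (- (of_int k * x)))"
      using g by (intro continuous_intros)
    then have "set_integrable lborel {-pi..pi} (\<lambda>x. g x * cis (- (of_int k * x)))"
      using borel_integrable_compact[OF compact_Icc]
      by (auto simp: set_integrable_def indicator_def if_distrib cong: if_cong)
    from set_borel_integral_eq_integral(2)[OF this]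
    have "fourier_coeff g k = integral\<^sup>L lborel (\<lambda>x. h x * cis (x \<bullet> (- of_int k))) / (2 * pi)"
      by (simp add: fourier_coeff_def set_lebesgue_integral_def h_def mult.commute)
    also have "integral\<^sup>L lborel (\<lambda>x. h x * cis (x \<bullet> (- of_int k))) =
       integral\<^sup>L lebesgue (\<lambda>x. h x * cis (x \<bullet> (- of_int k)))"
    proof -
      have "(\<lambda>x. cis (x \<bullet> (- of_int k))) \<in> borel_measurable borel"
        by (intro borel_measurable_continuous_onI continuous_intros)
      then show ?thesis
        using hm by (intro integral_completion[symmetric]) (simp only: measurable_lborel2, intro borel_measurable_times)
    qed
    finally show ?thesis .
  qed
  define B where "B = (2 * pi) * integral\<^sup>L lebesgue (\<lambda>x. (cmod (h x))\<^sup>2) / (2 * pi)\<^sup>2"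
  have "(\<Sum>n<N. (cmod (fourier_coeff g (s * int n)))\<^sup>2) \<le> B" for N
  proof -
    define F where "F = (\<lambda>n. - real_of_int (s * int n)) ` {..<N}"
    have "(\<Sum>n<N. (cmod (fourier_coeff g (s * int n)))\<^sup>2) =
       (\<Sum>n<N. (cmod (integral\<^sup>L lebesgue (\<lambda>x. h x * cis (x \<bullet> (- real_of_int (s * int n))))))\<^sup>2) / (2 * pi)\<^sup>2"
      by (simp only: coeff norm_divide power_divide sum_divide_distrib)
         (simp add: norm_mult)
    also have "\<dots> = (\<Sum>n\<in>F. (cmod (integral\<^sup>L lebesgue (\<lambda>x. h x * cis (x \<bullet> n))))\<^sup>2) / (2 * pi)\<^sup>2"
      unfolding F_def by (subst sum.reindex) (use s in \<open>auto simp: inj_on_def\<close>)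
    also have "\<dots> \<le> B"
      unfolding B_def
    proof (intro divide_right_mono)
      have "F \<subseteq> lattice" by (auto simp: F_def lattice_def)
      moreover have "h \<in> borel_measurable lebesgue" "integrable lebesgue (\<lambda>x. (cmod (h x))\<^sup>2)"
        using hm hi by (auto simp: integrable_completion measurable_completion)
      moreover have "h x = 0" if "x \<notin> pi_cube" for x using that by (simp add: cube h_def)
      ultimately show "(\<Sum>n\<in>F. (cmod (integral\<^sup>L lebesgue (\<lambda>x. h x * cis (x \<bullet> n))))\<^sup>2)
         \<le> 2 * pi * integral\<^sup>L lebesgue (\<lambda>x. (cmod (h x))\<^sup>2)"
        using bessel_inequality[of h F] by (simp add: F_def)
    qed simp
    finally show ?thesis .
  qed
  then have "summable (\<lambda>n. (cmod (fourier_coeff g (s * int n)))\<^sup>2)"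
    by (intro summableI_nonneg_bounded) auto
  from summable_LIMSEQ_zero[OF this] have "(\<lambda>n. cmod (fourier_coeff g (s * int n))) \<longlonglongrightarrow> 0"
    using tendsto_real_sqrt by fastforce
  then show ?thesis by (rule tendsto_norm_zero_cancel)
qed

lemma has_vector_derivative_imp_quotient:
  fixes f :: "real \<Rightarrow> complex"
  assumes "(f has_vector_derivative D) (at a)"
  shows "((\<lambda>x. (f x - f a) / of_real (x - a)) \<longlongrightarrow> D) (at a)"
proof -
  have *: "((\<lambda>x. norm (f x - f a - (x - a) *\<^sub>R D) / norm (x - a)) \<longlongrightarrow> 0) (at a)"
    using assms unfolding has_vector_derivative_def has_derivative_iff_norm by blast
  have "\<forall>\<^sub>F x in at a. norm (f x - f a - (x - a) *\<^sub>R D) / norm (x - a) =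
     norm ((f x - f a) / of_real (x - a) - D)"
  proof (rule eventually_mono[of "\<lambda>x. x \<noteq> a"])
    fix x assume "x \<noteq> a"
    then have "(f x - f a) / of_real (x - a) - D = (f x - f a - (x - a) *\<^sub>R D) / of_real (x - a)"
      by (simp add: diff_divide_distrib scaleR_conv_of_real del: of_real_diff)
    then show "norm (f x - f a - (x - a) *\<^sub>R D) / norm (x - a) =
       norm ((f x - f a) / of_real (x - a) - D)"
      by (simp add: norm_divide del: of_real_diff)
  qed (simp add: eventually_at_filter)
  from Lim_transform_eventually[OF * this] show ?thesis
    by (rule LIM_zero_cancel[OF tendsto_norm_zero_cancel])
qed

lemma cis_minus_1_neq_0:
  assumes "x \<in> {-pi..pi}" "a \<in> {-pi<..<pi}" "x \<noteq> a"
  shows "cis (x - a) - 1 \<noteq> 0"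
proof
  assume "cis (x - a) - 1 = 0"
  then have "cos (x - a) = 1" by (simp add: complex_eq_iff)
  then obtain m :: int where m: "x - a = of_int m * 2 * pi"
    using cos_one_2pi_int by blast
  have "\<bar>x - a\<bar> < 2 * pi"
    using assms(1,2) unfolding abs_less_iff atLeastAtMost_iff greaterThanLessThan_iff by linarith
  then have "\<bar>real_of_int m\<bar> * (2 * pi) < 1 * (2 * pi)"
    unfolding m by (simp only: abs_mult mult.assoc) simp
  then have "\<bar>real_of_int m\<bar> < 1"
    by (rule mult_right_less_imp_less) simp
  then have "m = 0" by linarith
  with m have "x - a = 0" by simp
  with assms(3) show False by simp
qed

text \<open>The singularity at \<open>a\<close> is removable: near \<open>a\<close> the numerator
  behaves like \<open>D * (x - a)\<close> and the denominator like \<open>\<i> * (x - a)\<close>.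
  Since \<open>a\<close> is interior, the denominator has no other zero on the period.\<close>

lemma continuous_on_cis_quotient:
  fixes f :: "real \<Rightarrow> complex"
  assumes f: "continuous_on UNIV f" and a: "a \<in> {-pi<..<pi}"
    and D: "(f has_vector_derivative D) (at a)"
  shows "continuous_on {-pi..pi} (\<lambda>x. if x = a then D / \<i> else (f x - f a) / (cis (x - a) - 1))"
    (is "continuous_on _ ?g")
proof (rule continuous_at_imp_continuous_on, rule ballI)
  fix x assume x: "x \<in> {-pi..pi}"
  show "isCont ?g x"
  proof (cases "x = a")
    case True
    have c: "((\<lambda>x. cis (x - a)) has_vector_derivative \<i>) (at a)"
    proof -
      have "((\<lambda>z. exp (\<i> * (z - of_real a))) has_field_derivative \<i>) (at (of_real a))"
        by (auto intro!: derivative_eq_intros)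
      from has_vector_derivative_real_field[OF this] show ?thesis
        by (simp add: cis_conv_exp)
    qed
    have "((\<lambda>x. ((f x - f a) / of_real (x - a)) / ((cis (x - a) - 1) / of_real (x - a))) \<longlongrightarrow> D / \<i>) (at a)"
      using has_vector_derivative_imp_quotient[OF c]
      by (intro tendsto_divide has_vector_derivative_imp_quotient D) auto
    moreover have "\<forall>\<^sub>F x in at a. ((f x - f a) / of_real (x - a)) / ((cis (x - a) - 1) / of_real (x - a)) = ?g x"
      by (simp add: eventually_at_filter del: of_real_diff)
    ultimately have "(?g \<longlongrightarrow> D / \<i>) (at a)"
      by (rule Lim_transform_eventually)
    moreover have "?g a = D / \<i>" by simp
    ultimately show ?thesis unfolding True isCont_def by (simp only:)
  next
    case False
    have "isCont f x" "isCont (\<lambda>x. cis (x - a)) x"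
      using f continuous_on_cis[of UNIV "\<lambda>x. x - a"]
      by (simp_all add: continuous_on_eq_continuous_at continuous_on_diff)
    then have "isCont (\<lambda>x. (f x - f a) / (cis (x - a) - 1)) x"
      using cis_minus_1_neq_0[OF x a False] by (intro continuous_intros) simp_all
    moreover have "\<forall>\<^sub>F y in nhds x. ?g y = (f y - f a) / (cis (y - a) - 1)"
      using t1_space_nhds[OF False] by (rule eventually_mono) auto
    ultimately show ?thesis by (rule isCont_cong[THEN iffD2, rotated])
  qed
qed

lemma fourier_coeff_const: "fourier_coeff (\<lambda>_. c) k = (if k = 0 then c else 0)"
proof -
  have "continuous_on {-pi..pi} (\<lambda>x. cis (- (of_int k * x)))"
    by (intro continuous_intros)
  then have i: "set_integrable lborel {-pi..pi} (\<lambda>x. cis (- (of_int k * x)))"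
    using borel_integrable_compact[OF compact_Icc]
    by (auto simp: set_integrable_def indicator_def if_distrib cong: if_cong)
  have "integral {-pi..pi} (\<lambda>x. cis (- (of_int k * x))) = (if k = 0 then 2 * pi else 0)"
    using set_borel_integral_eq_integral(2)[OF i] integral_cis_period[of "- of_int k"]
    unfolding set_lebesgue_integral_def by (simp del: scaleR_complex.code)
  then show ?thesis
    unfolding fourier_coeff_def integral_mult_right by simp
qed

lemma fourier_coeff_add:
  assumes "continuous_on {-pi..pi} f" "continuous_on {-pi..pi} g"
  shows "fourier_coeff (\<lambda>x. f x + g x) k = fourier_coeff f k + fourier_coeff g k"
proof -
  have "(\<lambda>x. f x * cis (- (of_int k * x))) integrable_on {-pi..pi}"
    "(\<lambda>x. g x * cis (- (of_int k * x))) integrable_on {-pi..pi}"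
    by (rule integrable_continuous_real, intro continuous_intros assms)+
  from Henstock_Kurzweil_Integration.integral_add[OF this] show ?thesis
    by (simp add: fourier_coeff_def distrib_right add_divide_distrib)
qed

text \<open>Chernoff's argument: dividing \<open>f - f a\<close> by \<open>cis (x - a) - 1\<close> makes the partial
  Fourier sums of \<open>f\<close> at \<open>a\<close> telescope.\<close>

lemma fourier_partial_sums_tendsto:
  fixes f :: "real \<Rightarrow> complex"
  assumes f: "continuous_on UNIV f" and a: "a \<in> {-pi<..<pi}"
    and D: "(f has_vector_derivative D) (at a)"
  shows "(\<lambda>N. \<Sum>k\<in>{-int N..int N}. fourier_coeff f k * cis (of_int k * a)) \<longlonglongrightarrow> f a"
proof -
  define g where "g x = (if x = a then D / \<i> else (f x - f a) / (cis (x - a) - 1))" for x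
  have g: "continuous_on {-pi..pi} g"
    unfolding g_def by (rule continuous_on_cis_quotient[OF f a D])
  have fg: "f x = f a + (cis (x - a) - 1) * g x" if "x \<in> {-pi..pi}" for x
    using cis_minus_1_neq_0[OF that a] by (simp add: g_def)
  define G where "G k = fourier_coeff g k * cis (of_int k * a)" for k
  \<comment> \<open>Multiplication by \<open>cis (x - a)\<close> lowers the Fourier index by one,
    and its phase \<open>cis (- a)\<close> is absorbed by \<open>cis (k * a)\<close>. Hence the
    difference of consecutive terms of \<open>G\<close>.\<close>
  have shift: "fourier_coeff (\<lambda>x. (cis (x - a) - 1) * g x) k * cis (of_int k * a) = G (k - 1) - G k" for k
  proof -
    have "fourier_coeff (\<lambda>x. (cis (x - a) - 1) * g x) k =
      (integral {-pi..pi} (\<lambda>x. cis (- a) * (g x * cis (- (of_int (k - 1) * x))) - g x * cis (- (of_int k * x)))) / (2 * pi)"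
      unfolding fourier_coeff_def
    proof (intro arg_cong2[where f="(/)"] refl integral_cong)
      fix x
      have "cis (x - a) * cis (- (of_int k * x)) = cis (- a) * cis (- (of_int (k - 1) * x))"
        unfolding cis_mult by (intro arg_cong[where f=cis]) (simp add: left_diff_distrib)
      then show "(cis (x - a) - 1) * g x * cis (- (of_int k * x)) =
          cis (- a) * (g x * cis (- (of_int (k - 1) * x))) - g x * cis (- (of_int k * x))"
        by (simp only: left_diff_distrib mult.assoc[symmetric] mult_1)
           (simp only: mult.assoc mult.left_commute mult.commute)
    qed
    also have "integral {-pi..pi} (\<lambda>x. cis (- a) * (g x * cis (- (of_int (k - 1) * x))) - g x * cis (- (of_int k * x)))
      = cis (- a) * integral {-pi..pi} (\<lambda>x. g x * cis (- (of_int (k - 1) * x)))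
          - integral {-pi..pi} (\<lambda>x. g x * cis (- (of_int k * x)))"
    proof -
      have "(\<lambda>x. cis (- a) * (g x * cis (- (of_int (k - 1) * x)))) integrable_on {-pi..pi}"
        "(\<lambda>x. g x * cis (- (of_int k * x))) integrable_on {-pi..pi}"
        by (rule integrable_continuous_real, intro continuous_intros g)+
      then show ?thesis
        by (simp only: Henstock_Kurzweil_Integration.integral_diff integral_mult_right)
    qed
    also have "\<dots> / (2 * pi) = cis (- a) * fourier_coeff g (k - 1) - fourier_coeff g k"
      by (simp add: fourier_coeff_def diff_divide_distrib)
    also have "\<dots> * cis (of_int k * a) = G (k - 1) - G k"
    proof -
      have "cis (- a) * cis (of_int k * a) = cis (of_int (k - 1) * a)"
        unfolding cis_mult by (intro arg_cong[where f=cis]) (simp add: left_diff_distrib)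
      moreover have "(u * A - B) * v = A * (u * v) - B * v" for A B u v :: complex
        by (simp add: algebra_simps)
      ultimately show ?thesis by (simp only: G_def)
    qed
    finally show ?thesis .
  qed
  have coeff: "fourier_coeff f k * cis (of_int k * a) = (if k = 0 then f a else 0) + (G (k - 1) - G k)" for k
  proof -
    have "fourier_coeff f k = fourier_coeff (\<lambda>x. f a + (cis (x - a) - 1) * g x) k"
      unfolding fourier_coeff_def
      by (intro arg_cong2[where f="(/)"] refl integral_cong) (simp only: fg[symmetric])
    also have "\<dots> = (if k = 0 then f a else 0) + fourier_coeff (\<lambda>x. (cis (x - a) - 1) * g x) k"
      by (subst fourier_coeff_add, intro continuous_intros, intro continuous_intros g)
        (simp only: fourier_coeff_const)
    finally show ?thesis by (simp add: distrib_right shift)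
  qed
  have sum: "(\<Sum>k\<in>{-int N..int N}. fourier_coeff f k * cis (of_int k * a)) =
      f a + (G (- int (Suc N)) - G (int N))" for N
  proof (induction N)
    case 0
    show ?case using coeff[of 0] by simp
  next
    case (Suc N)
    have "{-int (Suc N)..int (Suc N)} = insert (- int (Suc N)) (insert (int (Suc N)) {-int N..int N})"
      by auto
    then show ?case using Suc by (simp add: coeff)
  qed
  have norm_G: "norm (G k) = norm (fourier_coeff g k)" for k
    by (simp add: G_def norm_mult)
  have "(\<lambda>N. G (int N)) \<longlonglongrightarrow> 0"
    using riemann_lebesgue[OF g, of 1]
    by (intro tendsto_norm_zero_cancel[where f="\<lambda>N. G (int N)"]) (simp add: norm_G tendsto_norm_zero)
  moreover have "(\<lambda>N. G (- int N)) \<longlonglongrightarrow> 0"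
    using riemann_lebesgue[OF g, of "-1"]
    by (intro tendsto_norm_zero_cancel[where f="\<lambda>N. G (- int N)"]) (simp add: norm_G tendsto_norm_zero)
  then have "(\<lambda>N. G (- int (Suc N))) \<longlonglongrightarrow> 0"
    by (rule LIMSEQ_Suc)
  ultimately have "(\<lambda>N. f a + (G (- int (Suc N)) - G (int N))) \<longlonglongrightarrow> f a + (0 - 0)"
    by (intro tendsto_intros)
  then show ?thesis by (simp only: sum) simp
qed

text \<open>Absolute summability gives an unordered sum, and the symmetric intervals are cofinal
  among the finite index sets, so this sum must equal the limit of the symmetric partial
  sums.\<close>

lemma fourier_inversion:
  fixes f :: "real \<Rightarrow> complex"
  assumes f: "continuous_on UNIV f" and a: "a \<in> {-pi<..<pi}"
    and D: "(f has_vector_derivative D) (at a)"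
    and abs: "(\<lambda>k. cmod (fourier_coeff f k)) summable_on UNIV"
  shows "((\<lambda>k. fourier_coeff f k * cis (of_int k * a)) has_sum f a) UNIV"
proof -
  have "(\<lambda>k. fourier_coeff f k * cis (of_int k * a)) summable_on UNIV"
    by (rule abs_summable_summable) (simp add: norm_mult abs)
  then obtain S where S: "((\<lambda>k. fourier_coeff f k * cis (of_int k * a)) has_sum S) UNIV"
    by (auto simp: summable_on_def)
  have "filterlim (\<lambda>N. {-int N..int N}) (finite_subsets_at_top UNIV) sequentially"
    unfolding filterlim_finite_subsets_at_top
  proof (intro allI impI)
    fix X :: "int set" assume X: "finite X \<and> X \<subseteq> UNIV"
    define M where "M = (\<Sum>k\<in>X. nat \<bar>k\<bar>)"
    have "nat \<bar>k\<bar> \<le> M" if "k \<in> X" for k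
      using X that unfolding M_def by (intro member_le_sum) auto
    then have "X \<subseteq> {-int N..int N}" if "N \<ge> M" for N
      using that by force
    then show "\<forall>\<^sub>F N in sequentially. finite {-int N..int N} \<and> X \<subseteq> {-int N..int N} \<and> {-int N..int N} \<subseteq> UNIV"
      by (auto simp: eventually_sequentially)
  qed
  from filterlim_compose[OF S[unfolded has_sum_def] this]
  have "S = f a"
    using fourier_partial_sums_tendsto[OF f a D] by (rule LIMSEQ_unique)
  with S show ?thesis by simp
qed

lemma fourier_coeff_deriv:
  assumes d: "\<And>x. (f has_vector_derivative f' x) (at x)" and c: "continuous_on UNIV f'"
    and z: "f pi = 0" "f (-pi) = 0"
  shows "fourier_coeff f' k = \<i> * of_int k * fourier_coeff f k"
proof -
  have cf: "continuous_on {-pi..pi} f"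
    using d by (intro continuous_at_imp_continuous_on ballI) (auto intro: has_vector_derivative_continuous)
  have cf': "continuous_on {-pi..pi} f'" using c by (rule continuous_on_subset) auto
  have e: "((\<lambda>x. cis (- (of_int k * x))) has_vector_derivative - (\<i> * of_int k) * cis (- (of_int k * x))) (at x)" for x
  proof -
    have "((\<lambda>z. exp (- (\<i> * of_int k * z))) has_field_derivative
        - (\<i> * of_int k) * exp (- (\<i> * of_int k * of_real x))) (at (of_real x))"
      by (auto intro!: derivative_eq_intros)
    from has_vector_derivative_real_field[OF this] show ?thesis
      by (simp add: cis_conv_exp mult.assoc)
  qed
  have "((\<lambda>x. f x * (- (\<i> * of_int k) * cis (- (of_int k * x))) + f' x * cis (- (of_int k * x)))
     has_integral (f pi * cis (- (of_int k * pi)) - f (-pi) * cis (- (of_int k * (-pi))))) {-pi..pi}"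
    by (rule fundamental_theorem_of_calculus)
      (simp, rule has_vector_derivative_at_within, rule has_vector_derivative_mult, rule d, rule e)
  then have "integral {-pi..pi} (\<lambda>x. (- (\<i> * of_int k)) * (f x * cis (- (of_int k * x))) + f' x * cis (- (of_int k * x))) = 0"
    using z by (auto simp: mult_ac dest!: integral_unique)
  moreover have "(\<lambda>x. (- (\<i> * of_int k)) * (f x * cis (- (of_int k * x)))) integrable_on {-pi..pi}"
    "(\<lambda>x. f' x * cis (- (of_int k * x))) integrable_on {-pi..pi}"
    by (rule integrable_continuous_real, intro continuous_intros cf cf')+
  ultimately have "- (\<i> * of_int k) * integral {-pi..pi} (\<lambda>x. f x * cis (- (of_int k * x)))
      + integral {-pi..pi} (\<lambda>x. f' x * cis (- (of_int k * x))) = 0"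
    by (simp only: Henstock_Kurzweil_Integration.integral_add integral_mult_right)
  then show ?thesis
    by (simp add: fourier_coeff_def)
qed

lemma norm_fourier_coeff_le:
  assumes c: "continuous_on UNIV f" and A: "\<And>x. x \<in> {-pi..pi} \<Longrightarrow> cmod (f x) \<le> A"
  shows "cmod (fourier_coeff f k) \<le> A"
proof -
  have "norm (integral {-pi..pi} (\<lambda>x. f x * cis (- (of_int k * x)))) \<le> A * (pi - (-pi))"
    by (rule integral_bound)
      (auto intro!: continuous_intros continuous_on_subset[OF c] simp: norm_mult A)
  then show ?thesis by (simp add: fourier_coeff_def norm_divide field_simps)
qed

text \<open>Four integrations by parts bound \<open>k^4\<close> times the coefficient; together with
  the trivial bound and \<open>(1 + k^2)^2 \<le> 2 * (1 + k^4)\<close> this gives the decay. The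
  vanishing at both ends of the period kills the boundary terms.\<close>

lemma fourier_coeff_decay:
  assumes d: "\<And>j x. j < 4 \<Longrightarrow> (f j has_vector_derivative f (Suc j) x) (at x)"
    and c: "continuous_on UNIV (f 4)"
    and z: "\<And>j. j < 4 \<Longrightarrow> f j pi = 0" "\<And>j. j < 4 \<Longrightarrow> f j (-pi) = 0"
    and A: "\<And>j x. x \<in> {-pi..pi} \<Longrightarrow> j \<le> 4 \<Longrightarrow> cmod (f j x) \<le> A"
  shows "cmod (fourier_coeff (f 0) k) \<le> 4 * A * (phi (of_int k))\<^sup>2"
proof -
  have cj: "continuous_on UNIV (f j)" if "j \<le> 4" for j
  proof (cases "j = 4")
    case False
    then show ?thesis using d[of j] that
      by (intro continuous_at_imp_continuous_on ballI) (auto intro: has_vector_derivative_continuous)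
  qed (use c in simp)
  have "fourier_coeff (f j) k = (\<i> * of_int k) ^ j * fourier_coeff (f 0) k" if "j \<le> 4" for j
    using that
  proof (induction j)
    case (Suc j)
    then show ?case
      using fourier_coeff_deriv[of "f j" "f (Suc j)" k] d[of j] cj[of "Suc j"] z[of j] by simp
  qed simp
  from this[of 4] have "cmod (fourier_coeff (f 4) k) = (of_int k)^4 * cmod (fourier_coeff (f 0) k)"
    by (simp add: norm_mult norm_power)
  then have 4: "(of_int k)^4 * cmod (fourier_coeff (f 0) k) \<le> A"
    using norm_fourier_coeff_le[of "f 4" A k] c A[of _ 4] by simp
  have 0: "cmod (fourier_coeff (f 0) k) \<le> A"
    using norm_fourier_coeff_le[of "f 0" A k] cj[of 0] A[of _ 0] by simp
  define m where "m = cmod (fourier_coeff (f 0) k)"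
  define y where "y = (of_int k :: real)\<^sup>2"
  have y: "1 + y > 0" by (simp add: y_def add_pos_nonneg)
  have m: "m \<ge> 0" "m \<le> A" "y\<^sup>2 * m \<le> A" using 0 4 by (auto simp: m_def y_def)
  have "(1 + y)\<^sup>2 * m \<le> 2 * (1 + y\<^sup>2) * m"
    using sum_squares_bound[of 1 y] m by (intro mult_right_mono) (auto simp: power2_eq_square algebra_simps)
  also have "\<dots> = 2 * m + 2 * (y\<^sup>2 * m)" by (simp add: algebra_simps)
  also have "\<dots> \<le> 4 * A" using m by simp
  finally have "m \<le> 4 * A / (1 + y)\<^sup>2"
    using y by (subst pos_le_divide_eq) (auto simp: mult.commute intro: zero_less_power)
  then show ?thesis by (simp add: m_def[symmetric] y_def phi_def power_divide)
qed
section \<open>Expansions of the one-dimensional propagator\<close>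

definition tpow :: "nat \<Rightarrow> real \<Rightarrow> real" where
  "tpow m x = max 0 x ^ m"

text \<open>Away from 0 the function is locally a polynomial. At 0 the exponent is at least 2, so
  the difference quotient tends to 0; the first power would have a kink there.\<close>

lemma tpow_has_derivative:
  "((tpow (Suc (Suc m))) has_real_derivative real (Suc (Suc m)) * tpow (Suc m) x) (at x)"
proof -
  consider "x < 0" | "x > 0" | "x = 0" by linarith
  then show ?thesis
  proof cases
    case 1
    have "((\<lambda>_. 0) has_real_derivative 0) (at x)" by simp
    then have "(tpow (Suc (Suc m)) has_real_derivative 0) (at x)"
      by (rule has_field_derivative_transform_within_open[where S="{..<0}"])
        (use 1 in \<open>auto simp: tpow_def\<close>)
    with 1 show ?thesis by (simp add: tpow_def)
  next
    case 2
    have "((\<lambda>x. x ^ Suc (Suc m)) has_real_derivative real (Suc (Suc m)) * x ^ Suc m) (at x)"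
      by (rule derivative_eq_intros refl | simp)+
    then have "(tpow (Suc (Suc m)) has_real_derivative real (Suc (Suc m)) * x ^ Suc m) (at x)"
      by (rule has_field_derivative_transform_within_open[where S="{0<..}"])
        (use 2 in \<open>auto simp: tpow_def\<close>)
    with 2 show ?thesis by (simp add: tpow_def)
  next
    case 3
    have "((\<lambda>h. tpow (Suc (Suc m)) h / h) \<longlongrightarrow> 0) (at 0)"
    proof (rule Lim_null_comparison)
      show "\<forall>\<^sub>F h in at 0. norm (tpow (Suc (Suc m)) h / h) \<le> \<bar>h\<bar> ^ Suc m"
        by (auto simp: eventually_at_filter tpow_def max_def abs_mult power_abs mult_nonpos_nonneg)
      show "((\<lambda>h::real. \<bar>h\<bar> ^ Suc m) \<longlongrightarrow> 0) (at 0)"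
        by (auto intro!: tendsto_eq_intros)
    qed
    then show ?thesis by (simp add: 3 DERIV_def tpow_def)
  qed
qed

text \<open>\<open>smoothstep 0\<close> is the normalised fifth difference of \<open>tpow 5\<close> with step \<open>2/5\<close>,
  and \<open>smoothstep j\<close> is its \<open>j\<close>-th derivative.\<close>

definition smoothstep :: "nat \<Rightarrow> real \<Rightarrow> real" where
  "smoothstep j x = 3125 / 32 / fact (5 - j) *
     (tpow (5 - j) (x + 3) - 5 * tpow (5 - j) (x + 13/5) + 10 * tpow (5 - j) (x + 11/5)
      - 10 * tpow (5 - j) (x + 9/5) + 5 * tpow (5 - j) (x + 7/5) - tpow (5 - j) (x + 1))"

text \<open>Shifting by 4 turns the transition of \<open>smoothstep\<close> on
  \<open>[-3, -1]\<close> into a descent on \<open>[1, 3]\<close>. The frequency range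
  \<open>[-1, 1]\<close> is left alone, and since \<open>3 < pi\<close> the cutoff vanishes near the
  ends of the period.\<close>

definition cutoff :: "nat \<Rightarrow> real \<Rightarrow> real" where
  "cutoff j x = smoothstep j x - smoothstep j (x - 4)"

lemma smoothstep_has_derivative:
  assumes "j < 4"
  shows "(smoothstep j has_real_derivative smoothstep (Suc j) x) (at x)"
proof -
  define m where "m = 3 - j"
  have m: "5 - j = Suc (Suc m)" "5 - Suc j = Suc m" using assms by (auto simp: m_def)
  have t: "((\<lambda>x. tpow (Suc (Suc m)) (x + c)) has_real_derivative real (Suc (Suc m)) * tpow (Suc m) (x + c)) (at x)" for c
    using tpow_has_derivative by (rule DERIV_shift[THEN iffD1])
  define K :: real where "K = 3125 / 32 / fact (Suc (Suc m))"
  define S where "S = real (Suc (Suc m))"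
  have K: "3125 / 32 / fact (Suc m) = K * S"
    by (simp add: K_def S_def divide_simps)
  have "(smoothstep j has_real_derivative K * ((S * tpow (Suc m) (x + 3)) - 5 * (S * tpow (Suc m) (x + 13/5)) + 10 * (S * tpow (Suc m) (x + 11/5)) - 10 * (S * tpow (Suc m) (x + 9/5)) + 5 * (S * tpow (Suc m) (x + 7/5)) - (S * tpow (Suc m) (x + 1)))) (at x)"
    unfolding smoothstep_def[abs_def] m K_def[symmetric] S_def
    by (intro DERIV_cmult DERIV_diff DERIV_add t)
  moreover have "smoothstep (Suc j) x = K * ((S * tpow (Suc m) (x + 3)) - 5 * (S * tpow (Suc m) (x + 13/5)) + 10 * (S * tpow (Suc m) (x + 11/5)) - 10 * (S * tpow (Suc m) (x + 9/5)) + 5 * (S * tpow (Suc m) (x + 7/5)) - (S * tpow (Suc m) (x + 1)))"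
    unfolding smoothstep_def m K by (simp only: algebra_simps)
  ultimately show ?thesis by simp
qed

lemma smoothstep_left: "j < 5 \<Longrightarrow> x \<le> -3 \<Longrightarrow> smoothstep j x = 0"
  by (simp add: smoothstep_def tpow_def)

text \<open>To the right of all knots the truncations disappear, and what is left is a fifth
  difference with step \<open>2/5\<close> of a polynomial of degree \<open>5 - j\<close>. It equals
  \<open>5! * (2/5)^5\<close> for degree 5 and vanishes for lower degrees.\<close>

lemma smoothstep_right:
  assumes "x \<ge> -1" "j < 5"
  shows "smoothstep j x = (if j = 0 then 1 else 0)"
proof -
  have t: "tpow m (x + c) = (x + c) ^ m" if "c \<ge> 1" for m c
    using that assms by (simp add: tpow_def)
  have p5: "(x + 3)^5 - 5 * (x + 13/5)^5 + 10 * (x + 11/5)^5 - 10 * (x + 9/5)^5 + 5 * (x + 7/5)^5 - (x + 1)^5 = 120 * (32 / 3125)"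
    by algebra
  have p4: "(x + 3)^4 - 5 * (x + 13/5)^4 + 10 * (x + 11/5)^4 - 10 * (x + 9/5)^4 + 5 * (x + 7/5)^4 - (x + 1)^4 = 0"
    by algebra
  have p3: "(x + 3)^3 - 5 * (x + 13/5)^3 + 10 * (x + 11/5)^3 - 10 * (x + 9/5)^3 + 5 * (x + 7/5)^3 - (x + 1)^3 = 0"
    by algebra
  have p2: "(x + 3)^2 - 5 * (x + 13/5)^2 + 10 * (x + 11/5)^2 - 10 * (x + 9/5)^2 + 5 * (x + 7/5)^2 - (x + 1)^2 = 0"
    by algebra
  have p1: "(x + 3)^1 - 5 * (x + 13/5)^1 + 10 * (x + 11/5)^1 - 10 * (x + 9/5)^1 + 5 * (x + 7/5)^1 - (x + 1)^1 = 0"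
    by algebra
  consider "j = 0" | "j = 1" | "j = 2" | "j = 3" | "j = 4" using assms by linarith
  then show ?thesis
  proof cases
    case 1
    have "smoothstep j x = 3125 / 32 / fact 5 * (120 * (32 / 3125))"
      unfolding p5[symmetric] by (simp add: 1 smoothstep_def t)
    then show ?thesis by (simp add: 1 fact_numeral)
  next
    case 2
    have "smoothstep j x = 3125 / 32 / fact 4 * 0"
      unfolding p4[symmetric] by (simp add: 2 smoothstep_def t)
    then show ?thesis by (simp add: 2)
  next
    case 3
    have "smoothstep j x = 3125 / 32 / fact 3 * 0"
      unfolding p3[symmetric] by (simp add: 3 smoothstep_def t)
    then show ?thesis by (simp add: 3)
  next
    case 4
    have "smoothstep j x = 3125 / 32 / fact 2 * 0"
      unfolding p2[symmetric] by (simp add: 4 smoothstep_def t)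
    then show ?thesis by (simp add: 4)
  next
    case 5
    have "smoothstep j x = 3125 / 32 / fact 1 * 0"
      unfolding p1[symmetric] by (simp add: 5 smoothstep_def t)
    then show ?thesis by (simp add: 5)
  qed
qed

lemma cutoff_has_derivative:
  assumes "j < 4"
  shows "(cutoff j has_real_derivative cutoff (Suc j) x) (at x)"
proof -
  have "((\<lambda>x. smoothstep j (x - 4)) has_real_derivative smoothstep (Suc j) (x - 4)) (at x)"
    using smoothstep_has_derivative[OF assms, of "x - 4"] DERIV_shift[of "smoothstep j" _ x "-4"] by simp
  then show ?thesis unfolding cutoff_def[abs_def]
    by (intro DERIV_diff smoothstep_has_derivative assms)
qed

lemma cutoff_eq_1: "\<bar>x\<bar> \<le> 1 \<Longrightarrow> cutoff 0 x = 1"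
  by (simp add: cutoff_def smoothstep_left smoothstep_right)

lemma cutoff_eq_0: "j < 5 \<Longrightarrow> \<bar>x\<bar> \<ge> 3 \<Longrightarrow> cutoff j x = 0"
  by (cases "x \<ge> 0") (simp_all add: cutoff_def smoothstep_left smoothstep_right)

lemma continuous_cutoff: "continuous_on S (cutoff j)"
  unfolding cutoff_def[abs_def] smoothstep_def tpow_def by (intro continuous_intros)

lemma cutoff_bounded: "\<exists>B>0. \<forall>j\<le>4. \<forall>x\<in>{-pi..pi}. \<bar>cutoff j x\<bar> \<le> B"
proof -
  have "bounded (\<Union>j\<in>{..4::nat}. cutoff j ` {-pi..pi})"
    by (intro bounded_UN finite_atMost ballI compact_imp_bounded compact_continuous_image
        continuous_cutoff compact_Icc)
  then obtain B where "B > 0" "\<And>y. y \<in> (\<Union>j\<in>{..4::nat}. cutoff j ` {-pi..pi}) \<Longrightarrow> norm y \<le> B"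
    unfolding bounded_pos by blast
  then show ?thesis by (intro exI[of _ B]) auto
qed

section \<open>Fourier expansions valid on the frequency range\<close>

definition leibniz :: "(nat \<Rightarrow> real \<Rightarrow> complex) \<Rightarrow> (nat \<Rightarrow> real \<Rightarrow> complex) \<Rightarrow> nat \<Rightarrow> real \<Rightarrow> complex" where
  "leibniz X F j x = (\<Sum>i\<le>j. of_nat (j choose i) * (X i x * F (j - i) x))"

text \<open>Induction step of the Leibniz rule: one of the two sums from the product rule is
  reindexed and Pascal's rule joins the binomial coefficients.\<close>

lemma leibniz_has_derivative:
  assumes "\<And>i. i \<le> j \<Longrightarrow> (X i has_vector_derivative X (Suc i) x) (at x)"
    and "\<And>i. i \<le> j \<Longrightarrow> (F i has_vector_derivative F (Suc i) x) (at x)"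
  shows "(leibniz X F j has_vector_derivative leibniz X F (Suc j) x) (at x)"
proof -
  have "(leibniz X F j has_vector_derivative
     (\<Sum>i\<le>j. of_nat (j choose i) * (X i x * F (Suc (j - i)) x + X (Suc i) x * F (j - i) x))) (at x)"
    unfolding leibniz_def[abs_def]
    by (intro has_vector_derivative_sum has_vector_derivative_mult_right has_vector_derivative_mult assms) auto
  also have "(\<Sum>i\<le>j. of_nat (j choose i) * (X i x * F (Suc (j - i)) x + X (Suc i) x * F (j - i) x))
     = (\<Sum>i\<le>j. of_nat (j choose i) * (X i x * F (Suc j - i) x))
       + (\<Sum>i\<le>j. of_nat (j choose i) * (X (Suc i) x * F (j - i) x))"
    by (simp add: sum.distrib distrib_left Suc_diff_le)
  also have "(\<Sum>i\<le>j. of_nat (j choose i) * (X i x * F (Suc j - i) x)) =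
     X 0 x * F (Suc j) x + (\<Sum>i\<le>j. of_nat (j choose Suc i) * (X (Suc i) x * F (j - i) x))"
    by (subst sum.atMost_shift) (simp add: lessThan_Suc_atMost[symmetric])
  finally have "(leibniz X F j has_vector_derivative X 0 x * F (Suc j) x +
     ((\<Sum>i\<le>j. of_nat (j choose Suc i) * (X (Suc i) x * F (j - i) x))
      + (\<Sum>i\<le>j. of_nat (j choose i) * (X (Suc i) x * F (j - i) x)))) (at x)"
    by (simp add: add.assoc)
  moreover have "leibniz X F (Suc j) x = X 0 x * F (Suc j) x +
     ((\<Sum>i\<le>j. of_nat (j choose Suc i) * (X (Suc i) x * F (j - i) x))
      + (\<Sum>i\<le>j. of_nat (j choose i) * (X (Suc i) x * F (j - i) x)))"
    unfolding leibniz_def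
    by (subst sum.atMost_Suc_shift) (simp add: sum.distrib[symmetric] distrib_right add.commute)
  ultimately show ?thesis by simp
qed

text \<open>Since \<open>cutoff 0\<close> is 1 on \<open>[-1, 1]\<close> and supported in \<open>[-3, 3]\<close>, cutting off turns a function
  that is merely smooth near \<open>[-1, 1]\<close> into a periodic one.\<close>

lemma local_fourier_expansion:
  "\<exists>C>0. \<forall>F A. (\<forall>j<4. \<forall>x. (F j has_vector_derivative F (Suc j) x) (at x)) \<longrightarrow>
      continuous_on UNIV (F 4) \<longrightarrow> (\<forall>j\<le>4. \<forall>x\<in>{-pi..pi}. cmod (F j x) \<le> A) \<longrightarrow>
      (\<exists>\<beta>. (\<forall>k. cmod (\<beta> k) \<le> C * A * (phi (of_int k))\<^sup>2) \<and>
         (\<forall>\<theta>. \<bar>\<theta>\<bar> \<le> 1 \<longrightarrow> ((\<lambda>k. \<beta> k * cis (of_int k * \<theta>)) has_sum F 0 \<theta>) UNIV))"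
proof -
  obtain B where B: "B > 0" "\<And>j x. j \<le> 4 \<Longrightarrow> x \<in> {-pi..pi} \<Longrightarrow> \<bar>cutoff j x\<bar> \<le> B"
    using cutoff_bounded by blast
  define X where "X j x = complex_of_real (cutoff j x)" for j x
  have X: "(X j has_vector_derivative X (Suc j) x) (at x)" if "j < 4" for j x
    using bounded_linear.has_vector_derivative[OF bounded_linear_of_real
        cutoff_has_derivative[OF that, unfolded has_real_derivative_iff_has_vector_derivative]]
    by (simp add: X_def[abs_def])
  have cX: "continuous_on UNIV (X j)" for j
    unfolding X_def[abs_def] by (intro continuous_intros continuous_cutoff)
  show ?thesis
  \<comment> \<open>\<open>64 = 4 * 2^4\<close>: the constant of \<open>fourier_coeff_decay\<close>
    times the largest row sum of binomial coefficients in the product rule up to order 4.\<close>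
  proof (intro exI[of _ "64 * B"] conjI allI impI)
    fix F :: "nat \<Rightarrow> real \<Rightarrow> complex" and A
    assume F: "\<forall>j<4. \<forall>x. (F j has_vector_derivative F (Suc j) x) (at x)"
      and c4: "continuous_on UNIV (F 4)" and A: "\<forall>j\<le>4. \<forall>x\<in>{-pi..pi}. cmod (F j x) \<le> A"
    have cF: "continuous_on UNIV (F j)" if "j \<le> 4" for j
    proof (cases "j = 4")
      case False
      then have "(F j has_vector_derivative F (Suc j) x) (at x)" for x using F that by simp
      then show ?thesis
        by (intro continuous_at_imp_continuous_on ballI) (rule has_vector_derivative_continuous)
    qed (use c4 in simp)
    define f where "f = leibniz X F"
    have d: "(f j has_vector_derivative f (Suc j) x) (at x)" if "j < 4" for j x
      unfolding f_def using F X that by (intro leibniz_has_derivative) auto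
    have c: "continuous_on UNIV (f 4)"
      unfolding f_def leibniz_def[abs_def] by (intro continuous_intros cX cF) auto
    have X0: "X j x = 0" if "j \<le> 4" "\<bar>x\<bar> \<ge> 3" for j x
      using cutoff_eq_0[of j x] that by (simp add: X_def)
    have z: "f j x = 0" if "j < 4" "\<bar>x\<bar> = pi" for j x
      using that pi_gt3 X0 by (auto simp: f_def leibniz_def intro!: sum.neutral)
    have A0: "A \<ge> 0" using A[rule_format, of 0 0] norm_ge_zero[of "F 0 0"] by (simp del: norm_ge_zero)
    have bound: "cmod (f j x) \<le> 16 * B * A" if "x \<in> {-pi..pi}" "j \<le> 4" for j x
    proof -
      have "cmod (f j x) \<le> (\<Sum>i\<le>j. real (j choose i) * (B * A))"
        unfolding f_def leibniz_def
      proof (rule sum_norm_le)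
        fix i assume "i \<in> {..j}"
        then have "cmod (X i x) \<le> B" "cmod (F (j - i) x) \<le> A"
          using B A that by (auto simp: X_def)
        then show "cmod (of_nat (j choose i) * (X i x * F (j - i) x)) \<le> real (j choose i) * (B * A)"
          using B by (simp only: norm_mult norm_of_nat) (intro mult_left_mono mult_mono, auto)
      qed
      also have "\<dots> = 2 ^ j * (B * A)"
        by (simp add: sum_distrib_right[symmetric] choose_row_sum flip: of_nat_sum)
      also have "\<dots> \<le> 2 ^ 4 * (B * A)"
        using that A0 B by (intro mult_right_mono power_increasing) auto
      finally show ?thesis by simp
    qed
    have decay: "cmod (fourier_coeff (f 0) k) \<le> 64 * B * A * (phi (of_int k))\<^sup>2" for k
      using fourier_coeff_decay[of f "16 * B * A" k] d c z bound by auto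
    have f0: "f 0 = (\<lambda>x. X 0 x * F 0 x)" by (simp add: f_def leibniz_def fun_eq_iff)
    show "\<exists>\<beta>. (\<forall>k. cmod (\<beta> k) \<le> 64 * B * A * (phi (of_int k))\<^sup>2) \<and>
         (\<forall>\<theta>. \<bar>\<theta>\<bar> \<le> 1 \<longrightarrow> ((\<lambda>k. \<beta> k * cis (of_int k * \<theta>)) has_sum F 0 \<theta>) UNIV)"
    proof (intro exI[of _ "fourier_coeff (f 0)"] conjI allI impI decay)
      fix \<theta> :: real assume \<theta>: "\<bar>\<theta>\<bar> \<le> 1"
      have "cmod (fourier_coeff (f 0) k) \<le> 64 * B * A * phi (of_int k)" for k
        using A0 B by (intro order_trans[OF decay mult_left_mono[OF phi_square_le]]) simp
      then have "(\<lambda>k. cmod (fourier_coeff (f 0) k)) summable_on UNIV"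
        by (intro summable_on_comparison_test[OF summable_on_cmult_right[OF phi_summable]]) auto
      moreover have "continuous_on UNIV (f 0)" unfolding f0 by (intro continuous_intros cX cF) auto
      moreover have "\<theta> \<in> {-pi<..<pi}" using \<theta> pi_gt3 by auto
      moreover have "f 0 \<theta> = F 0 \<theta>" using \<theta> by (simp add: f0 X_def cutoff_eq_1)
      ultimately show "((\<lambda>k. fourier_coeff (f 0) k * cis (of_int k * \<theta>)) has_sum F 0 \<theta>) UNIV"
        using fourier_inversion[of "f 0" \<theta>] d[of 0 \<theta>] by auto
    qed
  qed (use B in simp)
qed

section \<open>Derivatives and expansions of the quadratic phase\<close>

lemma cmod_cis_minus_1_le: "cmod (cis a - 1) \<le> \<bar>a\<bar>"
  using iexp_approx1[of a 0] by (simp add: cis_conv_exp)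

text \<open>The \<open>j\<close>-th derivative of \<open>exp (\<i> (y z - s z\<^sup>2))\<close>.\<close>

definition phase_deriv :: "real \<Rightarrow> real \<Rightarrow> nat \<Rightarrow> complex \<Rightarrow> complex" where
  "phase_deriv y s j z =
    (let q = \<i> * (y - 2 * s * z); p = - 2 * \<i> * s in
      [1, q, q\<^sup>2 + p, q^3 + 3 * q * p, q^4 + 6 * q\<^sup>2 * p + 3 * p\<^sup>2] ! j) * exp (\<i> * (y * z - s * z\<^sup>2))"

text \<open>With \<open>q' = p\<close> and \<open>E' = q * E\<close>, a factor \<open>P\<close> in
  front of \<open>E\<close> is followed by \<open>P' + q * P\<close>, which generates the list in
  \<open>phase_deriv\<close>. The argument is complex so that the rules for field derivatives apply;
  it is restricted to the real line afterwards.\<close>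

lemma phase_deriv_has_derivative:
  assumes "j < 4"
  shows "(phase_deriv y s j has_field_derivative phase_deriv y s (Suc j) z) (at z)"
proof -
  define q where "q z = \<i> * (complex_of_real y - 2 * complex_of_real s * z)" for z :: complex
  define p where "p = - 2 * \<i> * complex_of_real s"
  define E where "E z = exp (\<i> * (y * z - s * z\<^sup>2))" for z :: complex
  have q: "(q has_field_derivative p) (at z)" for z
    unfolding q_def[abs_def] p_def by (auto intro!: derivative_eq_intros)
  have E: "(E has_field_derivative q z * E z) (at z)" for z
    unfolding q_def E_def[abs_def] by (auto intro!: derivative_eq_intros simp: algebra_simps)
  have P: "phase_deriv y s j = (\<lambda>z. [1, q z, (q z)\<^sup>2 + p, (q z)^3 + 3 * q z * p,
      (q z)^4 + 6 * (q z)\<^sup>2 * p + 3 * p\<^sup>2] ! j * E z)" for j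
    unfolding phase_deriv_def Let_def q_def p_def E_def ..
  consider "j = 0" | "j = 1" | "j = 2" | "j = 3" using assms by linarith
  then show ?thesis
  proof cases
    case 1
    show ?thesis unfolding P 1 by (auto intro!: derivative_eq_intros q E)
  next
    case 2
    show ?thesis unfolding P 2
      by (auto intro!: derivative_eq_intros q E simp: algebra_simps power2_eq_square)
  next
    case 3
    show ?thesis unfolding P 3
      by (auto intro!: derivative_eq_intros q E simp: algebra_simps power2_eq_square power3_eq_cube)
  next
    case 4
    show ?thesis unfolding P 4
      by (auto intro!: derivative_eq_intros q E simp: algebra_simps power2_eq_square power3_eq_cube power4_eq_xxxx)
  qed
qed

text \<open>Adding the bounds of the four orders covers each of them. Order 0 is treated apart: its
  modulus is 1 and does not shrink with \<open>s\<close>, whereas the bound here does when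
  \<open>Q\<close> and \<open>p\<close> are proportional to \<open>s\<close>.\<close>

lemma phase_deriv_bound:
  assumes "cmod (\<i> * (complex_of_real y - 2 * complex_of_real s * z)) \<le> Q" "\<bar>2 * s\<bar> \<le> p" "cmod (exp (\<i> * (y * z - s * z\<^sup>2))) = 1"
    "1 \<le> j" "j \<le> 4"
  shows "cmod (phase_deriv y s j z) \<le> Q + (Q\<^sup>2 + p) + (Q^3 + 3 * Q * p) + (Q^4 + 6 * Q\<^sup>2 * p + 3 * p\<^sup>2)"
proof -
  define q' where "q' = \<i> * (complex_of_real y - 2 * complex_of_real s * z)"
  define p' where "p' = - 2 * \<i> * complex_of_real s"
  have q: "cmod q' \<le> Q" and p: "cmod p' \<le> p"
    using assms by (auto simp: q'_def p'_def norm_mult)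
  have Q0: "0 \<le> Q" "0 \<le> p" using q p norm_ge_zero order_trans by blast+
  have q2: "cmod (q'\<^sup>2) \<le> Q\<^sup>2" "cmod (q'^3) \<le> Q^3" "cmod (q'^4) \<le> Q^4"
    using q by (simp_all only: norm_power) (intro power_mono; simp)+
  have p2: "cmod (p'\<^sup>2) \<le> p\<^sup>2"
    using p by (simp only: norm_power) (intro power_mono; simp)
  have b2: "cmod (q'\<^sup>2 + p') \<le> Q\<^sup>2 + p"
    by (rule norm_triangle_mono[OF q2(1) p])
  have b3: "cmod (q'^3 + 3 * q' * p') \<le> Q^3 + 3 * Q * p"
    using q p Q0 by (intro norm_triangle_mono q2) (simp add: norm_mult mult_mono)
  have b4: "cmod (q'^4 + 6 * q'\<^sup>2 * p' + 3 * p'\<^sup>2) \<le> Q^4 + 6 * Q\<^sup>2 * p + 3 * p\<^sup>2"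
    using p p2 q2(1) Q0
    by (intro norm_triangle_mono q2) (simp_all add: norm_mult mult_mono)
  define B2 B3 B4 where "B2 = Q\<^sup>2 + p" "B3 = Q^3 + 3 * Q * p" "B4 = Q^4 + 6 * Q\<^sup>2 * p + 3 * p\<^sup>2"
  have nn: "0 \<le> B2" "0 \<le> B3" "0 \<le> B4"
    using Q0 by (simp_all add: B2_B3_B4_def)
  have eq: "cmod (phase_deriv y s j z) = cmod ([1, q', q'\<^sup>2 + p', q'^3 + 3 * q' * p', q'^4 + 6 * q'\<^sup>2 * p' + 3 * p'\<^sup>2] ! j)"
    by (simp only: phase_deriv_def norm_mult q'_def p'_def Let_def assms(3) mult_1_right)
  consider "j = 1" | "j = 2" | "j = 3" | "j = 4" using assms by linarith
  then have "cmod (phase_deriv y s j z) \<le> Q + B2 + B3 + B4"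
    using b2 b3 b4 unfolding B2_B3_B4_def[symmetric] eq
    by cases (use q Q0 nn in \<open>simp_all\<close>)
  then show ?thesis by (simp only: B2_B3_B4_def)
qed

lemma phase_deriv_real_has_derivative:
  assumes "j < 4"
  shows "((\<lambda>x. phase_deriv y s j (of_real x)) has_vector_derivative phase_deriv y s (Suc j) (of_real x)) (at x)"
  by (rule has_vector_derivative_real_field[OF phase_deriv_has_derivative[OF assms]])

lemma phase_deriv_0: "phase_deriv y s 0 (of_real x) = cis (y * x - s * x\<^sup>2)"
  by (simp add: phase_deriv_def cis_conv_exp)

lemma continuous_phase_deriv: "continuous_on UNIV (\<lambda>x. phase_deriv y s 4 (of_real x))"
  unfolding phase_deriv_def Let_def by (simp, intro continuous_intros)

text \<open>This expresses the solution after a short shift in space and time, of either sign,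
  through its lattice translates before the shift. The constant is uniform in both shifts.\<close>

lemma phase_expansion:
  "\<exists>C>0. \<forall>y s. \<bar>y\<bar> \<le> 1 \<longrightarrow> \<bar>s\<bar> \<le> 1 \<longrightarrow>
     (\<exists>\<beta>. (\<forall>k. cmod (\<beta> k) \<le> C * (phi (of_int k))\<^sup>2) \<and>
       (\<forall>\<theta>. \<bar>\<theta>\<bar> \<le> 1 \<longrightarrow> ((\<lambda>k. \<beta> k * cis (of_int k * \<theta>)) has_sum cis (y * \<theta> - s * \<theta>\<^sup>2)) UNIV))"
proof -
  obtain C where C: "C > 0" and exp: "\<And>F A. (\<forall>j<4. \<forall>x. (F j has_vector_derivative F (Suc j) x) (at x)) \<Longrightarrow>
      continuous_on UNIV (F 4) \<Longrightarrow> (\<forall>j\<le>4. \<forall>x\<in>{-pi..pi}. cmod (F j x) \<le> A) \<Longrightarrow>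
      (\<exists>\<beta>. (\<forall>k. cmod (\<beta> k) \<le> C * A * (phi (of_int k))\<^sup>2) \<and>
         (\<forall>\<theta>. \<bar>\<theta>\<bar> \<le> 1 \<longrightarrow> ((\<lambda>k. \<beta> k * cis (of_int k * \<theta>)) has_sum F 0 \<theta>) UNIV))"
    using local_fourier_expansion by blast
  show ?thesis
  \<comment> \<open>On \<open>[-pi, pi]\<close> the phase has slope at most
    \<open>1 + 2 * 4 = 9\<close> and second derivative at most 2; \<open>phase_deriv_bound\<close>
    then yields 8420, rounded up to 10000.\<close>
  proof (intro exI[of _ "C * 10000"] conjI allI impI)
    fix y s :: real assume y: "\<bar>y\<bar> \<le> 1" and s: "\<bar>s\<bar> \<le> 1"
    have bound: "cmod (phase_deriv y s j (of_real x)) \<le> 10000" if "j \<le> 4" "x \<in> {-pi..pi}" for j x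
    proof (cases "j = 0")
      case False
      have x: "\<bar>x\<bar> \<le> 4" using that pi_less_4 by auto
      have "\<bar>s\<bar> * \<bar>x\<bar> \<le> 1 * 4" by (intro mult_mono s x) auto
      then have "\<bar>y - 2 * s * x\<bar> \<le> 9" using y by (simp add: abs_mult[symmetric])
      moreover have "\<i> * (complex_of_real y - 2 * s * x) = \<i> * of_real (y - 2 * s * x)" by simp
      ultimately have "cmod (\<i> * (complex_of_real y - 2 * s * x)) \<le> 9"
        by (simp only: norm_mult norm_of_real) simp
      moreover have "\<bar>2 * s\<bar> \<le> 2" using s by simp
      moreover have "\<i> * (complex_of_real y * x - s * (of_real x)\<^sup>2) = \<i> * of_real (y * x - s * x\<^sup>2)" by simp
      then have "cmod (exp (\<i> * (complex_of_real y * x - s * (of_real x)\<^sup>2))) = 1"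
        by (simp only: norm_exp_i_times)
      ultimately show ?thesis
        using phase_deriv_bound[of y s "of_real x" 9 2 j] False that by simp
    qed (simp add: phase_deriv_0)
    show "\<exists>\<beta>. (\<forall>k. cmod (\<beta> k) \<le> C * 10000 * (phi (of_int k))\<^sup>2) \<and>
       (\<forall>\<theta>. \<bar>\<theta>\<bar> \<le> 1 \<longrightarrow> ((\<lambda>k. \<beta> k * cis (of_int k * \<theta>)) has_sum cis (y * \<theta> - s * \<theta>\<^sup>2)) UNIV)"
      using exp[of "\<lambda>j x. phase_deriv y s j (of_real x)" 10000] bound phase_deriv_real_has_derivative
        continuous_phase_deriv by (simp only: phase_deriv_0) blast
  qed (use C in simp)
qed

text \<open>Subtracting 1 makes the symbol and its derivatives of size \<open>O(s)\<close>. The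
  resulting factor \<open>\<bar>s\<bar>\<close> in the coefficients is what later makes the flux
  over a short time step small against the density.\<close>

lemma phase_increment_expansion:
  "\<exists>C>0. \<forall>s. \<bar>s\<bar> \<le> 1 \<longrightarrow>
     (\<exists>\<beta>. (\<forall>k. cmod (\<beta> k) \<le> C * \<bar>s\<bar> * (phi (of_int k))\<^sup>2) \<and>
       (\<forall>\<theta>. \<bar>\<theta>\<bar> \<le> 1 \<longrightarrow> ((\<lambda>k. \<beta> k * cis (of_int k * \<theta>)) has_sum cis (- s * \<theta>\<^sup>2) - 1) UNIV))"
proof -
  obtain C where C: "C > 0" and exp: "\<And>F A. (\<forall>j<4. \<forall>x. (F j has_vector_derivative F (Suc j) x) (at x)) \<Longrightarrow>
      continuous_on UNIV (F 4) \<Longrightarrow> (\<forall>j\<le>4. \<forall>x\<in>{-pi..pi}. cmod (F j x) \<le> A) \<Longrightarrow>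
      (\<exists>\<beta>. (\<forall>k. cmod (\<beta> k) \<le> C * A * (phi (of_int k))\<^sup>2) \<and>
         (\<forall>\<theta>. \<bar>\<theta>\<bar> \<le> 1 \<longrightarrow> ((\<lambda>k. \<beta> k * cis (of_int k * \<theta>)) has_sum F 0 \<theta>) UNIV))"
    using local_fourier_expansion by blast
  show ?thesis
  proof (intro exI[of _ "C * 10000"] conjI allI impI)
    fix s :: real assume s: "\<bar>s\<bar> \<le> 1"
    define F where "F j x = phase_deriv 0 s j (of_real x) - (if j = 0 then 1 else 0)" for j x
    have F0: "F 0 x = cis (- s * x\<^sup>2) - 1" for x
      using phase_deriv_0[of 0 s x] by (simp add: F_def)
    have bound: "cmod (F j x) \<le> 10000 * \<bar>s\<bar>" if "j \<le> 4" "x \<in> {-pi..pi}" for j x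
    proof -
      have x: "\<bar>x\<bar> \<le> 4" using that pi_less_4 by auto
      show ?thesis
      proof (cases "j = 0")
        case True
        have "cmod (F j x) \<le> \<bar>s\<bar> * \<bar>x\<bar>\<^sup>2"
          unfolding True F0 by (rule order_trans[OF cmod_cis_minus_1_le]) (simp add: abs_mult)
        also have "\<dots> \<le> \<bar>s\<bar> * 4\<^sup>2" by (intro mult_left_mono power_mono x) auto
        finally show ?thesis by simp
      next
        case False
        define t where "t = \<bar>s\<bar>"
        have t: "0 \<le> t" "t \<le> 1" using s by (auto simp: t_def)
        have "\<bar>s\<bar> * \<bar>x\<bar> \<le> \<bar>s\<bar> * 4" by (intro mult_left_mono x) auto
        then have "cmod (\<i> * (complex_of_real 0 - 2 * s * x)) \<le> 8 * t" by (simp add: norm_mult t_def)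
        moreover have "\<bar>2 * s\<bar> \<le> 2 * t" by (simp add: t_def abs_mult)
        moreover have "\<i> * (complex_of_real 0 * x - s * (of_real x)\<^sup>2) = \<i> * of_real (- s * x\<^sup>2)" by simp
        then have "cmod (exp (\<i> * (complex_of_real 0 * x - s * (of_real x)\<^sup>2))) = 1"
          by (simp only: norm_exp_i_times)
        ultimately have "cmod (F j x) \<le> 8 * t + ((8 * t)\<^sup>2 + 2 * t) + ((8 * t)^3 + 3 * (8 * t) * (2 * t))
           + ((8 * t)^4 + 6 * (8 * t)\<^sup>2 * (2 * t) + 3 * (2 * t)\<^sup>2)"
          using phase_deriv_bound[of 0 s "of_real x" "8 * t" "2 * t" j] False that by (simp add: F_def)
        also have "\<dots> = 10 * t + 124 * t^2 + 1280 * t^3 + 4096 * t^4"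
          by (simp add: power_mult_distrib power2_eq_square power3_eq_cube)
        also have "\<dots> \<le> 10 * t + 124 * t + 1280 * t + 4096 * t"
          using power_decreasing[of 1 2 t] power_decreasing[of 1 3 t] power_decreasing[of 1 4 t] t
          by simp
        also have "\<dots> \<le> 10000 * t" using t by simp
        finally show ?thesis by (simp add: t_def)
      qed
    qed
    have d: "(F j has_vector_derivative F (Suc j) x) (at x)" if "j < 4" for j x
      unfolding F_def[abs_def]
      using has_vector_derivative_diff[OF phase_deriv_real_has_derivative[OF that, of 0 s x] has_vector_derivative_const]
      by simp
    have c: "continuous_on UNIV (F 4)"
      using continuous_phase_deriv[of 0 s] by (simp add: F_def[abs_def])
    have "\<exists>\<beta>. (\<forall>k. cmod (\<beta> k) \<le> C * (10000 * \<bar>s\<bar>) * (phi (of_int k))\<^sup>2) \<and>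
       (\<forall>\<theta>. \<bar>\<theta>\<bar> \<le> 1 \<longrightarrow> ((\<lambda>k. \<beta> k * cis (of_int k * \<theta>)) has_sum cis (- s * \<theta>\<^sup>2) - 1) UNIV)"
      using exp[of F "10000 * \<bar>s\<bar>"] bound d c unfolding F0 by blast
    then show "\<exists>\<beta>. (\<forall>k. cmod (\<beta> k) \<le> C * 10000 * \<bar>s\<bar> * (phi (of_int k))\<^sup>2) \<and>
       (\<forall>\<theta>. \<bar>\<theta>\<bar> \<le> 1 \<longrightarrow> ((\<lambda>k. \<beta> k * cis (of_int k * \<theta>)) has_sum cis (- s * \<theta>\<^sup>2) - 1) UNIV)"
      by (simp only: mult.assoc)
  qed (use C in simp)
qed
section \<open>Averaged densities and nearest-neighbour flux\<close>

definition Phi :: "'a::euclidean_space \<Rightarrow> real" where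
  "Phi z = (\<Prod>b\<in>Basis. phi (z \<bullet> b))"

lemma Phi_nonneg: "0 \<le> Phi z"
  by (simp add: Phi_def prod_nonneg phi_nonneg)

lemma Phi_0 [simp]: "Phi 0 = 1"
  by (simp add: Phi_def)

lemma lattice_0 [simp]: "0 \<in> lattice"
  by (simp add: lattice_def)

lemma lattice_add: "x \<in> lattice \<Longrightarrow> y \<in> lattice \<Longrightarrow> x + y \<in> lattice"
  by (simp add: lattice_def inner_add_left)

lemma lattice_scaleR_Basis: "b \<in> Basis \<Longrightarrow> of_int k *\<^sub>R b \<in> lattice"
  by (auto simp: lattice_def inner_Basis)

lemma lattice_Basis: "b \<in> Basis \<Longrightarrow> b \<in> lattice"
  using lattice_scaleR_Basis[of b 1] by simp

text \<open>A finite set of lattice points embeds, through its integer coordinates, in a product of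
  finite integer sets. Over such a product the sum of products factors into one-dimensional sums,
  each at most \<open>phi_mass\<close>.\<close>

lemma Phi_summable: "Phi summable_on (lattice :: 'a::euclidean_space set)"
proof (rule nonneg_bdd_above_summable_on)
  show "bdd_above (sum (Phi :: 'a \<Rightarrow> real) ` {F. F \<subseteq> lattice \<and> finite F})"
  proof (rule bdd_aboveI2)
    fix F :: "'a set" assume "F \<in> {F. F \<subseteq> lattice \<and> finite F}"
    then have F: "F \<subseteq> lattice" "finite F" by auto
    define e where "e z = restrict (\<lambda>b. \<lfloor>z \<bullet> b\<rfloor>) Basis" for z :: 'a
    define A where "A = (\<Union>z\<in>F. \<Union>b\<in>Basis. {\<lfloor>z \<bullet> b\<rfloor>})"
    have A: "finite A" using F by (auto simp: A_def)
    have fl: "of_int \<lfloor>z \<bullet> b\<rfloor> = z \<bullet> b" if "z \<in> F" "b \<in> Basis" for z b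
      using F that by (auto simp: lattice_def elim!: Ints_cases)
    have inj: "inj_on e F"
    proof (rule inj_onI)
      fix z w assume zw: "z \<in> F" "w \<in> F" "e z = e w"
      have "z \<bullet> b = w \<bullet> b" if "b \<in> Basis" for b
      proof -
        have "\<lfloor>z \<bullet> b\<rfloor> = \<lfloor>w \<bullet> b\<rfloor>" using fun_cong[OF zw(3), of b] that by (simp add: e_def)
        then show ?thesis using fl[OF zw(1) that] fl[OF zw(2) that] by metis
      qed
      then show "z = w" by (rule euclidean_eqI)
    qed
    have "sum Phi F = (\<Sum>z\<in>F. \<Prod>b\<in>Basis. phi (of_int (e z b)))"
      unfolding Phi_def by (intro sum.cong prod.cong refl) (simp add: e_def fl)
    also have "\<dots> = (\<Sum>h\<in>e ` F. \<Prod>b\<in>Basis. phi (of_int (h b)))"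
      by (simp add: sum.reindex[OF inj])
    also have "\<dots> \<le> (\<Sum>h\<in>PiE (Basis :: 'a set) (\<lambda>_. A). \<Prod>b\<in>Basis. phi (of_int (h b)))"
    proof (rule sum_mono2)
      show "finite (PiE (Basis :: 'a set) (\<lambda>_. A))" by (intro finite_PiE finite_Basis A)
      show "e ` F \<subseteq> PiE Basis (\<lambda>_. A)" by (rule image_subsetI, rule PiE_I) (auto simp: e_def A_def)
    qed (intro prod_nonneg ballI phi_nonneg)
    also have "\<dots> = (\<Prod>b\<in>(Basis :: 'a set). (\<Sum>k\<in>A. phi (of_int k)))"
      by (rule prod_sum_PiE[symmetric]) (simp_all add: A)
    also have "\<dots> \<le> (\<Prod>b\<in>(Basis :: 'a set). phi_mass)"
      unfolding phi_mass_def
      by (intro prod_mono conjI sum_nonneg finite_sum_le_infsum phi_summable A) (auto simp: phi_nonneg)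
    finally show "sum Phi F \<le> phi_mass ^ DIM('a)" by simp
  qed
qed (rule Phi_nonneg)

definition Phi_mass :: "'a::euclidean_space itself \<Rightarrow> real" where
  "Phi_mass _ = (\<Sum>\<^sub>\<infinity>z\<in>(lattice :: 'a set). Phi z)"

lemma Phi_mass_nonneg: "0 \<le> Phi_mass TYPE('a::euclidean_space)"
  by (simp add: Phi_mass_def infsum_nonneg Phi_nonneg)

lemma Phi_conv_le:
  fixes z :: "'a::euclidean_space"
  assumes "z \<in> lattice" "b \<in> Basis"
  shows "(\<Sum>\<^sub>\<infinity>k::int. phi (of_int k) * Phi (z - of_int k *\<^sub>R b)) \<le> 4 * phi_mass * Phi z"
proof -
  define P where "P = (\<Prod>c\<in>Basis - {b}. phi (z \<bullet> c))"
  have P0: "P \<ge> 0" by (simp add: P_def prod_nonneg phi_nonneg)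
  have eq: "Phi (z - of_int k *\<^sub>R b) = phi (z \<bullet> b - of_int k) * P" for k :: int
  proof -
    have "(z - of_int k *\<^sub>R b) \<bullet> c = (if c = b then z \<bullet> b - of_int k else z \<bullet> c)" if "c \<in> Basis" for c
      using that assms(2) by (simp add: inner_diff_left inner_Basis)
    then have "Phi (z - of_int k *\<^sub>R b) = (\<Prod>c\<in>Basis. phi (if c = b then z \<bullet> b - of_int k else z \<bullet> c))"
      unfolding Phi_def by (intro prod.cong) simp_all
    also have "\<dots> = phi (z \<bullet> b - of_int k) * P"
      unfolding P_def prod.remove[OF finite_Basis assms(2)] by (auto intro!: prod.cong arg_cong2[where f="(*)"])
    finally show ?thesis .
  qed
  have z: "z \<bullet> b \<in> \<int>" using assms by (simp add: lattice_def)
  have eq2: "phi (of_int k) * Phi (z - of_int k *\<^sub>R b) = phi (of_int k) * phi (z \<bullet> b - of_int k) * P" for k :: int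
    by (simp add: eq)
  have "(\<Sum>\<^sub>\<infinity>k::int. phi (of_int k) * Phi (z - of_int k *\<^sub>R b)) =
     (\<Sum>\<^sub>\<infinity>k::int. phi (of_int k) * phi (z \<bullet> b - of_int k)) * P"
    unfolding eq2 by (rule infsum_cmult_left')
  also have "\<dots> \<le> 4 * phi_mass * phi (z \<bullet> b) * P"
    by (intro mult_right_mono phi_conv_le z P0)
  also have "\<dots> = 4 * phi_mass * Phi z" using eq[of 0] by simp
  finally show "(\<Sum>\<^sub>\<infinity>k::int. phi (of_int k) * Phi (z - of_int k *\<^sub>R b)) \<le> 4 * phi_mass * Phi z" .
qed

text \<open>The base point \<open>x\<close> ranges over the whole space and only the displacements
  are lattice points. Each coset of the lattice is averaged on its own, and fractional shifts
  commute with the averaging.\<close>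

definition smooth :: "('a::euclidean_space \<Rightarrow> real) \<Rightarrow> 'a \<Rightarrow> real" where
  "smooth f x = (\<Sum>\<^sub>\<infinity>z\<in>lattice. Phi z * f (x + z))"

definition line_avg :: "'a::euclidean_space \<Rightarrow> ('a \<Rightarrow> real) \<Rightarrow> 'a \<Rightarrow> real" where
  "line_avg b f x = (\<Sum>\<^sub>\<infinity>k::int. phi (of_int k) * f (x + of_int k *\<^sub>R b))"

lemma smooth_summable:
  assumes "\<And>x. \<bar>f x\<bar> \<le> B"
  shows "(\<lambda>z. Phi z * f (x + z)) summable_on lattice"
proof (rule abs_summable_summable, rule summable_on_comparison_test)
  show "(\<lambda>z. Phi z * B) summable_on lattice"
    by (intro summable_on_cmult_left Phi_summable)
  show "norm (Phi z * f (x + z)) \<le> Phi z * B" for z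
    using assms by (auto simp: abs_mult Phi_nonneg intro!: mult_left_mono)
qed simp

lemma line_avg_summable:
  assumes "\<And>x. \<bar>f x\<bar> \<le> B"
  shows "(\<lambda>k::int. phi (of_int k) * f (x + of_int k *\<^sub>R b)) summable_on UNIV"
proof (rule abs_summable_summable, rule summable_on_comparison_test)
  show "(\<lambda>k::int. phi (of_int k) * B) summable_on UNIV"
    by (intro summable_on_cmult_left phi_summable)
  show "norm (phi (of_int k) * f (x + of_int k *\<^sub>R b)) \<le> phi (of_int k) * B" for k
    using assms by (auto simp: abs_mult phi_nonneg intro!: mult_left_mono)
qed simp

lemma line_avg_nonneg: "(\<And>x. 0 \<le> f x) \<Longrightarrow> 0 \<le> line_avg b f x"
  unfolding line_avg_def by (intro infsum_nonneg mult_nonneg_nonneg phi_nonneg)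

lemma line_avg_le:
  assumes "\<And>x. \<bar>f x\<bar> \<le> B"
  shows "line_avg b f x \<le> phi_mass * B"
proof -
  have "line_avg b f x \<le> (\<Sum>\<^sub>\<infinity>k::int. phi (of_int k) * B)"
    unfolding line_avg_def
  proof (intro infsum_mono line_avg_summable[of f B] assms summable_on_cmult_left phi_summable mult_left_mono phi_nonneg)
    show "f y \<le> B" for y using assms[of y] by simp
  qed
  then show ?thesis by (simp add: infsum_cmult_left' phi_mass_def)
qed

lemma smooth_nonneg: "(\<And>x. 0 \<le> f x) \<Longrightarrow> 0 \<le> smooth f x"
  unfolding smooth_def by (intro infsum_nonneg mult_nonneg_nonneg Phi_nonneg)

lemma le_smooth:
  assumes "\<And>x. 0 \<le> f x" "\<And>x. \<bar>f x\<bar> \<le> B"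
  shows "f x \<le> smooth f x"
  using finite_sum_le_infsum[OF smooth_summable[of f B x], of "{0}"] assms
  by (simp add: smooth_def Phi_nonneg)

lemma smooth_mono:
  assumes "\<And>x. f x \<le> g x" "\<And>x. \<bar>f x\<bar> \<le> B" "\<And>x. \<bar>g x\<bar> \<le> B'"
  shows "smooth f x \<le> smooth g x"
  unfolding smooth_def
  by (intro infsum_mono smooth_summable[of f B] smooth_summable[of g B'] assms mult_left_mono Phi_nonneg)

lemma smooth_cmult: "smooth (\<lambda>x. c * f x) x = c * smooth f x"
  unfolding smooth_def by (simp add: mult.left_commute infsum_cmult_right')

lemma smooth_add:
  assumes "\<And>x. \<bar>f x\<bar> \<le> B" "\<And>x. \<bar>g x\<bar> \<le> B'"
  shows "smooth (\<lambda>x. f x + g x) x = smooth f x + smooth g x"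
  unfolding smooth_def distrib_left
  by (intro infsum_add smooth_summable[of f B] smooth_summable[of g B'] assms)

lemma smooth_diff:
  assumes "\<And>x. \<bar>f x\<bar> \<le> B" "\<And>x. \<bar>g x\<bar> \<le> B'"
  shows "smooth (\<lambda>x. f x - g x) x = smooth f x - smooth g x"
  using smooth_add[of f B "\<lambda>x. - g x" B' x] smooth_cmult[of "-1" g x] assms by simp

lemma smooth_shift: "smooth (\<lambda>x. f (x + c)) x = smooth f (x + c)"
  by (simp add: smooth_def add.assoc add.commute[of _ c])

lemma abs_smooth_le:
  assumes "\<And>x. \<bar>f x\<bar> \<le> g x" "\<And>x. \<bar>g x\<bar> \<le> B"
  shows "\<bar>smooth f x\<bar> \<le> smooth g x"
proof -
  have f: "\<bar>f x\<bar> \<le> B" for x using assms(1)[of x] assms(2)[of x] by linarith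
  have 1: "f x \<le> g x" "- 1 * f x \<le> g x" for x using assms(1)[of x] by linarith+
  have "smooth f x \<le> smooth g x" by (rule smooth_mono[OF 1(1) f assms(2)])
  moreover have "smooth (\<lambda>x. - 1 * f x) x \<le> smooth g x"
    by (rule smooth_mono[OF 1(2) _ assms(2), where B = B]) (use f in simp)
  ultimately show ?thesis unfolding smooth_cmult by linarith
qed

lemma phi_Phi_summable:
  "(\<lambda>(k::int, z). phi (of_int k) * Phi z) summable_on (UNIV \<times> (lattice :: 'a::euclidean_space set))"
proof (rule summable_on_SigmaI)
  show "((\<lambda>z. (\<lambda>(k::int, z). phi (of_int k) * Phi z) (k, z)) has_sum phi (of_int k) * Phi_mass TYPE('a)) (lattice :: 'a set)" for k
    using has_sum_cmult_right[OF has_sum_infsum[OF Phi_summable[where 'a='a]], of "phi (of_int k)"]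
    by (simp add: Phi_mass_def)
  show "(\<lambda>k::int. phi (of_int k) * Phi_mass TYPE('a)) summable_on UNIV"
    by (intro summable_on_cmult_left phi_summable)
qed (simp add: phi_nonneg Phi_nonneg)

text \<open>Exchanging the sums shows that the composite is an average against the convolution of
  \<open>phi\<close> in direction \<open>b\<close> with \<open>Phi\<close>, and
  \<open>Phi_conv_le\<close> returns this weight to \<open>Phi\<close>. Thus \<open>smooth\<close>
  absorbs a line average at the cost of a constant.\<close>

lemma smooth_line_avg_le:
  fixes f :: "'a::euclidean_space \<Rightarrow> real"
  assumes f: "\<And>x. 0 \<le> f x" "\<And>x. \<bar>f x\<bar> \<le> B" and b: "b \<in> Basis"
  shows "smooth (line_avg b f) x \<le> 4 * phi_mass * smooth f x"
proof -
  have s: "(\<lambda>(k::int, z). phi (of_int k) * Phi z * f (x + z + of_int k *\<^sub>R b)) summable_on (UNIV \<times> lattice)"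
  proof (rule summable_on_comparison_test)
    show "(\<lambda>p. (\<lambda>(k::int, z). phi (of_int k) * Phi z) p * B) summable_on (UNIV \<times> (lattice :: 'a set))"
      by (intro summable_on_cmult_left phi_Phi_summable)
  next
    have fB: "f y \<le> B" for y using f(2)[of y] by simp
    show "(case p of (k :: int, z) \<Rightarrow> phi (of_int k) * Phi z * f (x + z + of_int k *\<^sub>R b)) \<le>
        (case p of (k, z) \<Rightarrow> phi (of_int k) * Phi z) * B" for p
      by (cases p) (simp add: mult_left_mono fB phi_nonneg Phi_nonneg)
    show "0 \<le> (case p of (k :: int, z) \<Rightarrow> phi (of_int k) * Phi z * f (x + z + of_int k *\<^sub>R b))" for p
      by (cases p) (simp add: f phi_nonneg Phi_nonneg)
  qed
  have bij2: "bij_betw (\<lambda>(k::int, w). (k, w - of_int k *\<^sub>R b)) (UNIV \<times> lattice) (UNIV \<times> lattice)"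
    by (rule bij_betw_byWitness[where f' = "\<lambda>(k, w). (k, w + of_int k *\<^sub>R b)"])
       (auto intro!: lattice_diff lattice_add lattice_scaleR_Basis b)
  have s2: "(\<lambda>(k::int, w). phi (of_int k) * Phi (w - of_int k *\<^sub>R b) * f (x + w)) summable_on (UNIV \<times> lattice)"
    using summable_on_reindex_bij_betw[OF bij2, of "\<lambda>(k, z). phi (of_int k) * Phi z * f (x + z + of_int k *\<^sub>R b)"] s
    by (simp add: case_prod_unfold algebra_simps)
  have bij: "bij_betw (\<lambda>w. w - of_int k *\<^sub>R b) lattice lattice" for k :: int
    by (rule bij_betw_byWitness[where f' = "\<lambda>w. w + of_int k *\<^sub>R b"])
       (auto intro!: lattice_diff lattice_add lattice_scaleR_Basis b)
  have "smooth (line_avg b f) x = (\<Sum>\<^sub>\<infinity>z\<in>lattice. \<Sum>\<^sub>\<infinity>k::int. phi (of_int k) * Phi z * f (x + z + of_int k *\<^sub>R b))"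
    unfolding smooth_def line_avg_def
    by (simp add: infsum_cmult_right'[symmetric] mult_ac)
  also have "\<dots> = (\<Sum>\<^sub>\<infinity>k::int. \<Sum>\<^sub>\<infinity>z\<in>lattice. phi (of_int k) * Phi z * f (x + z + of_int k *\<^sub>R b))"
    by (rule infsum_swap_banach[symmetric, OF s])
  also have "\<dots> = (\<Sum>\<^sub>\<infinity>k::int. \<Sum>\<^sub>\<infinity>w\<in>lattice. phi (of_int k) * Phi (w - of_int k *\<^sub>R b) * f (x + w))"
  proof (rule infsum_cong)
    fix k :: int
    show "(\<Sum>\<^sub>\<infinity>z\<in>lattice. phi (of_int k) * Phi z * f (x + z + of_int k *\<^sub>R b)) =
        (\<Sum>\<^sub>\<infinity>w\<in>lattice. phi (of_int k) * Phi (w - of_int k *\<^sub>R b) * f (x + w))"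
      using infsum_reindex_bij_betw[OF bij[of k], of "\<lambda>z. phi (of_int k) * Phi z * f (x + z + of_int k *\<^sub>R b)"]
      by (simp add: algebra_simps)
  qed
  also have "\<dots> = (\<Sum>\<^sub>\<infinity>w\<in>lattice. \<Sum>\<^sub>\<infinity>k::int. phi (of_int k) * Phi (w - of_int k *\<^sub>R b) * f (x + w))"
    by (rule infsum_swap_banach[OF s2])
  also have "\<dots> = (\<Sum>\<^sub>\<infinity>w\<in>lattice. (\<Sum>\<^sub>\<infinity>k::int. phi (of_int k) * Phi (w - of_int k *\<^sub>R b)) * f (x + w))"
    by (simp add: infsum_cmult_left')
  also have "\<dots> \<le> (\<Sum>\<^sub>\<infinity>w\<in>lattice. 4 * phi_mass * (Phi w * f (x + w)))"
  proof (rule infsum_mono)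
    have le: "(\<Sum>\<^sub>\<infinity>k::int. phi (of_int k) * Phi (w - of_int k *\<^sub>R b)) * f (x + w)
        \<le> 4 * phi_mass * (Phi w * f (x + w))" if "w \<in> lattice" for w
      using mult_right_mono[OF Phi_conv_le[OF that b] f(1)[of "x + w"]] by (simp add: mult.assoc)
    then show "w \<in> lattice \<Longrightarrow> (\<Sum>\<^sub>\<infinity>k::int. phi (of_int k) * Phi (w - of_int k *\<^sub>R b)) * f (x + w)
        \<le> 4 * phi_mass * (Phi w * f (x + w))" for w .
    show s4: "(\<lambda>w. 4 * phi_mass * (Phi w * f (x + w))) summable_on lattice"
      by (intro summable_on_cmult_right smooth_summable[of f B] f)
    show "(\<lambda>w. (\<Sum>\<^sub>\<infinity>k::int. phi (of_int k) * Phi (w - of_int k *\<^sub>R b)) * f (x + w)) summable_on lattice"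
      by (rule summable_on_comparison_test[OF s4])
         (auto intro!: le mult_nonneg_nonneg infsum_nonneg f phi_nonneg Phi_nonneg)
  qed
  also have "\<dots> = 4 * phi_mass * smooth f x"
    by (simp add: infsum_cmult_right' smooth_def)
  finally show ?thesis .
qed

text \<open>The integral of a function over the oriented interval from 0 to \<open>k\<close>.\<close>

definition int_sum :: "int \<Rightarrow> (int \<Rightarrow> real) \<Rightarrow> real" where
  "int_sum k f = sum f {0..<k} - sum f {k..<0}"

lemma int_sum_telescope: "int_sum k f - int_sum k (\<lambda>l. f (l + 1)) = f 0 - f k"
proof (cases k rule: int_cases2)
  case (nonneg n)
  have "(\<Sum>l\<in>{0..<int n}. f l) - (\<Sum>l\<in>{0..<int n}. f (l + 1)) = f 0 - f (int n)" for n
  proof (induction n)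
    case (Suc n)
    have "{0..<int (Suc n)} = insert (int n) {0..<int n}" by auto
    with Suc show ?case by (simp add: add.commute)
  qed simp
  then show ?thesis by (simp add: nonneg int_sum_def)
next
  case (nonpos n)
  have "(\<Sum>l\<in>{-int n..<0}. f (l + 1)) - (\<Sum>l\<in>{-int n..<0}. f l) = f 0 - f (- int n)" for n
  proof (induction n)
    case (Suc n)
    have "{-int (Suc n)..<0} = insert (-int (Suc n)) {-int n..<0}" by auto
    with Suc show ?case by simp
  qed simp
  then show ?thesis by (simp add: nonpos int_sum_def)
qed

lemma abs_int_sum_le:
  assumes "\<And>l. l \<in> {0..<k} \<union> {k..<0} \<Longrightarrow> \<bar>f l\<bar> \<le> g l"
  shows "\<bar>int_sum k f\<bar> \<le> sum g ({0..<k} \<union> {k..<0})"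
proof -
  have "\<bar>int_sum k f\<bar> \<le> \<bar>sum f {0..<k}\<bar> + \<bar>sum f {k..<0}\<bar>"
    unfolding int_sum_def by (rule abs_triangle_ineq4)
  also have "\<dots> \<le> sum g {0..<k} + sum g {k..<0}"
    using assms by (intro add_mono order_trans[OF sum_abs] sum_mono) auto
  also have "\<dots> = sum g ({0..<k} \<union> {k..<0})"
    by (rule sum.union_disjoint[symmetric]) auto
  finally show ?thesis .
qed

text \<open>If \<open>u'\<close> arises from \<open>u\<close> by a convolution in direction \<open>b\<close> whose adjoint is its inverse, then
  \<open>Re (cnj (u' x) * a k * u (x + k b))\<close> is the (signed) mass moving from \<open>x + k b\<close> to \<open>x\<close>; rerouting it
  through the intermediate lattice points yields a nearest-neighbour flux.\<close>

lemma discrete_flux: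
  fixes u u' :: "'a::euclidean_space \<Rightarrow> complex"
  assumes bd: "\<And>x. (cmod (u x))\<^sup>2 \<le> B" "\<And>x. (cmod (u' x))\<^sup>2 \<le> B"
    and a: "\<And>k. cmod (a k) \<le> K * (phi (of_int k))\<^sup>2"
    and fwd: "\<And>x. ((\<lambda>k::int. a k * u (x + of_int k *\<^sub>R b)) has_sum (u' x - u x)) UNIV"
    and bwd: "\<And>x. ((\<lambda>k::int. cnj (a k) * u' (x - of_int k *\<^sub>R b)) has_sum (u x - u' x)) UNIV"
  shows "\<exists>G. \<forall>x. (cmod (u' x))\<^sup>2 - (cmod (u x))\<^sup>2 = G x - G (x - b) \<and>
    \<bar>G x\<bar> \<le> K * phi_mass * (line_avg b (\<lambda>x. (cmod (u' x))\<^sup>2) x + line_avg b (\<lambda>x. (cmod (u x))\<^sup>2) x)"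
proof -
  define M M' where "M x = (cmod (u x))\<^sup>2" and "M' x = (cmod (u' x))\<^sup>2" for x
  have M0: "0 \<le> M x" "0 \<le> M' x" and MB: "\<bar>M x\<bar> \<le> B" "\<bar>M' x\<bar> \<le> B" for x
    using bd by (auto simp: M_def M'_def)
  have K0: "K \<ge> 0" using a[of 0] norm_ge_zero[of "a 0"] by (simp del: norm_ge_zero)
  define Q where "Q k x = Re (cnj (u' x) * (a k * u (x + of_int k *\<^sub>R b)))" for k :: int and x
  have norm_cnj: "Re (cnj z * z) = (cmod z)\<^sup>2" for z
    by (simp add: cmod_power2) (simp add: power2_eq_square)
  \<comment> \<open>The mass arriving at \<open>x\<close> and the mass leaving \<open>x\<close> fall
    short of the new and the old density by the same cross term
    \<open>Re (cnj (u' x) * u x)\<close>. It cancels in the difference, so the transfers account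
    exactly for the change of density.\<close>
  have Q1: "((\<lambda>k. Q k x) has_sum (M' x - Re (cnj (u' x) * u x))) UNIV" for x
    using has_sum_Re[OF has_sum_cmult_right[OF fwd[of x], of "cnj (u' x)"]]
    by (simp add: Q_def M'_def norm_cnj right_diff_distrib del: times_complex.simps complex_cnj_mult)
  have Q2: "((\<lambda>k. Q k (x - of_int k *\<^sub>R b)) has_sum (M x - Re (cnj (u' x) * u x))) UNIV" for x
  proof -
    have "((\<lambda>k. cnj (cnj (a k) * u' (x - of_int k *\<^sub>R b)) * u x) has_sum (cnj (u x - u' x) * u x)) UNIV"
      using bwd by (intro has_sum_cmult_left) (simp only: has_sum_cnj_iff)
    from has_sum_Re[OF this]
    have "((\<lambda>k. Q k (x - of_int k *\<^sub>R b)) has_sum Re (cnj (u x - u' x) * u x)) UNIV"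
      by (rule has_sum_cong[THEN iffD1, rotated]) (simp add: Q_def mult_ac)
    moreover have "cnj (u x - u' x) * u x = cnj (u x) * u x - cnj (u' x) * u x"
      by (simp add: left_diff_distrib)
    ultimately show ?thesis by (simp only: M_def minus_complex.sel norm_cnj)
  qed
  \<comment> \<open>The net mass of displacement \<open>k\<close> crossing the edge from
    \<open>x + b\<close> to \<open>x\<close>. For \<open>k > 0\<close> these are the transfers
    ending at \<open>x - l b\<close> with \<open>0 \<le> l < k\<close>; for \<open>k < 0\<close> the
    transfers cross in the other direction, whence the sign in \<open>int_sum\<close>.\<close>
  define G1 where "G1 k x = int_sum k (\<lambda>l. Q k (x - of_int l *\<^sub>R b))" for k x
  have G1_diff: "G1 k x - G1 k (x - b) = Q k x - Q k (x - of_int k *\<^sub>R b)" for k x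
    using int_sum_telescope[of k "\<lambda>l. Q k (x - of_int l *\<^sub>R b)"]
    by (simp add: G1_def algebra_simps)
  define L where "L x = line_avg b M' x + line_avg b M x" for x
  have Q_bound: "\<bar>Q k y\<bar> \<le> K * (phi (of_int k))\<^sup>2 * (M' y + M (y + of_int k *\<^sub>R b))" for k y
  proof -
    have "\<bar>Q k y\<bar> \<le> cmod (a k) * (cmod (u' y) * cmod (u (y + of_int k *\<^sub>R b)))"
      unfolding Q_def by (rule order_trans[OF abs_Re_le_cmod]) (simp add: norm_mult mult_ac)
    also have "\<dots> \<le> (K * (phi (of_int k))\<^sup>2) * (M' y + M (y + of_int k *\<^sub>R b))"
    proof (intro mult_mono a)
      show "cmod (u' y) * cmod (u (y + of_int k *\<^sub>R b)) \<le> M' y + M (y + of_int k *\<^sub>R b)"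
        using sum_squares_bound[of "cmod (u' y)" "cmod (u (y + of_int k *\<^sub>R b))"] M0
        mult_nonneg_nonneg[OF norm_ge_zero[of "u' y"] norm_ge_zero[of "u (y + of_int k *\<^sub>R b)"]]
        unfolding M_def M'_def by linarith
    qed (use K0 in auto)
    finally show ?thesis .
  qed
  have G1_bound: "\<bar>G1 k x\<bar> \<le> K * phi (of_int k) * L x" for k x
  proof -
    define I where "I = {0..<k} \<union> {k..<0}"
    have fin: "finite I" by (simp add: I_def)
    have "\<bar>G1 k x\<bar> \<le> (\<Sum>l\<in>I. K * phi (of_int k) *
        (phi (of_int (- l)) * M' (x + of_int (- l) *\<^sub>R b) + phi (of_int (k - l)) * M (x + of_int (k - l) *\<^sub>R b)))"
      unfolding G1_def I_def
    proof (rule abs_int_sum_le)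
      fix l assume l: "l \<in> {0..<k} \<union> {k..<0}"
      \<comment> \<open>Since \<open>l\<close> lies between 0 and \<open>k\<close>, both ends of the
        transfer are within \<open>\<bar>k\<bar>\<close> steps of \<open>x\<close>. One of the two
        factors \<open>phi k\<close> is traded for the weight at these distances, which builds the
        line averages; the other remains for summing over \<open>k\<close>.\<close>
      have p1: "phi (of_int k) \<le> phi (of_int (- l))" using l by (intro phi_mono) auto
      have p2: "phi (of_int k) \<le> phi (of_int (k - l))" using l by (intro phi_mono) auto
      have "\<bar>Q k (x - of_int l *\<^sub>R b)\<bar> \<le> K * (phi (of_int k))\<^sup>2 *
          (M' (x + of_int (- l) *\<^sub>R b) + M (x + of_int (k - l) *\<^sub>R b))"
        using Q_bound[of k "x - of_int l *\<^sub>R b"] by (simp add: algebra_simps)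
      also have "\<dots> = K * phi (of_int k) *
          (phi (of_int k) * M' (x + of_int (- l) *\<^sub>R b) + phi (of_int k) * M (x + of_int (k - l) *\<^sub>R b))"
        by (simp add: power2_eq_square distrib_left mult_ac)
      also have "\<dots> \<le> K * phi (of_int k) *
          (phi (of_int (- l)) * M' (x + of_int (- l) *\<^sub>R b) + phi (of_int (k - l)) * M (x + of_int (k - l) *\<^sub>R b))"
        using p1 p2 by (intro mult_left_mono add_mono mult_right_mono M0) (auto simp: K0 phi_nonneg)
      finally show "\<bar>Q k (x - of_int l *\<^sub>R b)\<bar> \<le> \<dots>" .
    qed
    also have "\<dots> = K * phi (of_int k) * ((\<Sum>l\<in>uminus ` I. phi (of_int l) * M' (x + of_int l *\<^sub>R b)) +
        (\<Sum>l\<in>(\<lambda>l. k - l) ` I. phi (of_int l) * M (x + of_int l *\<^sub>R b)))"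
      by (simp add: sum_distrib_left[symmetric] sum.distrib sum.reindex inj_on_def o_def)
    also have "\<dots> \<le> K * phi (of_int k) * L x"
      unfolding L_def line_avg_def using fin
      by (intro mult_left_mono add_mono finite_sum_le_infsum line_avg_summable[of M B]
          line_avg_summable[of M' B] MB) (auto simp: K0 phi_nonneg M0)
    finally show ?thesis .
  qed
  have G1_sum: "(\<lambda>k. G1 k x) summable_on UNIV" and G1_le: "\<bar>\<Sum>\<^sub>\<infinity>k. G1 k x\<bar> \<le> K * phi_mass * L x" for x
  proof -
    have s: "(\<lambda>k::int. K * phi (of_int k) * L x) summable_on UNIV"
      by (intro summable_on_cmult_left summable_on_cmult_right phi_summable)
    have s': "(\<lambda>k. norm (G1 k x)) summable_on UNIV"
      by (rule summable_on_comparison_test[OF s]) (use G1_bound in auto)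
    then show "(\<lambda>k. G1 k x) summable_on UNIV" by (rule abs_summable_summable)
    have "\<bar>\<Sum>\<^sub>\<infinity>k. G1 k x\<bar> \<le> (\<Sum>\<^sub>\<infinity>k. norm (G1 k x))"
      using norm_infsum_bound[OF s'] by simp
    also have "\<dots> \<le> (\<Sum>\<^sub>\<infinity>k::int. K * phi (of_int k) * L x)"
      by (intro infsum_mono s s') (use G1_bound in auto)
    also have "\<dots> = K * phi_mass * L x"
      by (simp add: infsum_cmult_left' infsum_cmult_right' phi_mass_def)
    finally show "\<bar>\<Sum>\<^sub>\<infinity>k. G1 k x\<bar> \<le> K * phi_mass * L x" .
  qed
  show ?thesis
  proof (intro exI[of _ "\<lambda>x. \<Sum>\<^sub>\<infinity>k. G1 k x"] allI conjI)
    fix x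
    have "((\<lambda>k. G1 k x + - G1 k (x - b)) has_sum ((\<Sum>\<^sub>\<infinity>k. G1 k x) + - (\<Sum>\<^sub>\<infinity>k. G1 k (x - b)))) UNIV"
      by (intro has_sum_add has_sum_uminusI has_sum_infsum G1_sum)
    moreover have "((\<lambda>k. Q k x + - Q k (x - of_int k *\<^sub>R b)) has_sum
        ((M' x - Re (cnj (u' x) * u x)) + - (M x - Re (cnj (u' x) * u x)))) UNIV"
      by (intro has_sum_add has_sum_uminusI Q1 Q2)
    ultimately have "(\<Sum>\<^sub>\<infinity>k. G1 k x) - (\<Sum>\<^sub>\<infinity>k. G1 k (x - b)) = M' x - M x"
      using G1_diff[of _ x] has_sum_unique by fastforce
    then show "(cmod (u' x))\<^sup>2 - (cmod (u x))\<^sup>2 = (\<Sum>\<^sub>\<infinity>k. G1 k x) - (\<Sum>\<^sub>\<infinity>k. G1 k (x - b))"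
      by (simp add: M_def M'_def)
    show "\<bar>\<Sum>\<^sub>\<infinity>k. G1 k x\<bar> \<le> K * phi_mass * (line_avg b (\<lambda>x. (cmod (u' x))\<^sup>2) x + line_avg b (\<lambda>x. (cmod (u x))\<^sup>2) x)"
      using G1_le[of x] by (simp add: L_def M_def[abs_def] M'_def[abs_def])
  qed
qed
section \<open>Transport of mass by the Schroedinger evolution\<close>

lemma phi_Cauchy_Schwarz:
  assumes "\<And>k. 0 \<le> v k" "\<And>k. v k \<le> B"
  shows "(\<Sum>\<^sub>\<infinity>k::int. phi (of_int k) * v k)\<^sup>2 \<le> phi_mass * (\<Sum>\<^sub>\<infinity>k::int. phi (of_int k) * (v k)\<^sup>2)"
    and "(\<lambda>k::int. phi (of_int k) * v k) summable_on UNIV"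
proof -
  have B0: "0 \<le> B" using assms[of 0] by linarith
  have v2: "(v k)\<^sup>2 \<le> B\<^sup>2" for k using assms by (intro power_mono) auto
  show s1: "(\<lambda>k::int. phi (of_int k) * v k) summable_on UNIV"
    by (rule summable_on_comparison_test[OF summable_on_cmult_left[OF phi_summable, of B]])
       (auto intro!: mult_left_mono mult_nonneg_nonneg assms phi_nonneg)
  have s2: "(\<lambda>k::int. phi (of_int k) * (v k)\<^sup>2) summable_on UNIV"
    by (rule summable_on_comparison_test[OF summable_on_cmult_left[OF phi_summable, of "B\<^sup>2"]])
       (auto intro!: mult_left_mono v2 simp: phi_nonneg)
  define T where "T = (\<Sum>\<^sub>\<infinity>k::int. phi (of_int k) * (v k)\<^sup>2)"
  have T0: "0 \<le> T" unfolding T_def by (intro infsum_nonneg) (simp add: phi_nonneg)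
  have "(\<Sum>\<^sub>\<infinity>k::int. phi (of_int k) * v k) \<le> sqrt (phi_mass * T)"
  proof (rule infsum_le_finite_sums[OF s1])
    fix F :: "int set" assume F: "finite F" "F \<subseteq> UNIV"
    have "(\<Sum>k\<in>F. phi (of_int k) * v k)\<^sup>2 = (\<Sum>k\<in>F. sqrt (phi (of_int k)) * (sqrt (phi (of_int k)) * v k))\<^sup>2"
      by (simp add: mult.assoc[symmetric] phi_nonneg)
    also have "\<dots> \<le> (\<Sum>k\<in>F. (sqrt (phi (of_int k)))\<^sup>2) * (\<Sum>k\<in>F. (sqrt (phi (of_int k)) * v k)\<^sup>2)"
      by (rule Cauchy_Schwarz_ineq_sum)
    also have "\<dots> = (\<Sum>k\<in>F. phi (of_int k)) * (\<Sum>k\<in>F. phi (of_int k) * (v k)\<^sup>2)"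
      by (simp add: power_mult_distrib phi_nonneg)
    also have "\<dots> \<le> phi_mass * T"
      unfolding phi_mass_def T_def using F
      by (intro mult_mono finite_sum_le_infsum phi_summable s2 sum_nonneg infsum_nonneg)
         (auto simp: phi_nonneg)
    finally show "(\<Sum>k\<in>F. phi (of_int k) * v k) \<le> sqrt (phi_mass * T)"
      by (rule real_le_rsqrt)
  qed
  moreover have "0 \<le> (\<Sum>\<^sub>\<infinity>k::int. phi (of_int k) * v k)"
    by (intro infsum_nonneg) (simp add: phi_nonneg assms)
  ultimately have "(\<Sum>\<^sub>\<infinity>k::int. phi (of_int k) * v k)\<^sup>2 \<le> (sqrt (phi_mass * T))\<^sup>2"
    by (rule power_mono)
  also have "\<dots> = phi_mass * T"
    using T0 phi_mass_ge_1 by simp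
  finally show "(\<Sum>\<^sub>\<infinity>k::int. phi (of_int k) * v k)\<^sup>2 \<le> phi_mass * (\<Sum>\<^sub>\<infinity>k::int. phi (of_int k) * (v k)\<^sup>2)"
    by (simp add: T_def)
qed

section \<open>Solutions with a separate time for each coordinate\<close>

locale schrodinger_datum =
  fixes g :: "'a::euclidean_space \<Rightarrow> complex"
  assumes g_measurable: "g \<in> borel_measurable lebesgue"
    and g_square_integrable: "integrable lebesgue (\<lambda>\<xi>. (cmod (g \<xi>))\<^sup>2)"
    and g_support: "\<And>\<xi>. 1 < norm \<xi> \<Longrightarrow> g \<xi> = 0"
begin

text \<open>It is convenient to let each coordinate direction have its own time, so that the evolution
  splits into one-dimensional ones.\<close>

definition wave_phase :: "'a \<Rightarrow> 'a \<Rightarrow> 'a \<Rightarrow> real" where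
  "wave_phase \<xi> x \<tau> = \<xi> \<bullet> x - (\<Sum>b\<in>Basis. (\<tau> \<bullet> b) * (\<xi> \<bullet> b)\<^sup>2)"

definition fourier_integral :: "('a \<Rightarrow> complex) \<Rightarrow> complex" where
  "fourier_integral f = complex_of_real (1 / (2 * pi) ^ DIM('a)) * integral\<^sup>L lebesgue (\<lambda>\<xi>. g \<xi> * f \<xi>)"

definition wave :: "'a \<Rightarrow> 'a \<Rightarrow> complex" where
  "wave x \<tau> = fourier_integral (\<lambda>\<xi>. cis (wave_phase \<xi> x \<tau>))"

definition wave_density :: "'a \<Rightarrow> 'a \<Rightarrow> real" where
  "wave_density \<tau> x = (cmod (wave x \<tau>))\<^sup>2"

definition rho :: "'a \<Rightarrow> 'a \<Rightarrow> real" where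
  "rho \<tau> = smooth (wave_density \<tau>)"

lemma schrod_sol_eq_wave: "schrod_sol g x t = wave x (t *\<^sub>R One)"
proof -
  have "(\<Sum>b\<in>Basis. ((t *\<^sub>R One) \<bullet> b) * (\<xi> \<bullet> b)\<^sup>2) = t * (norm \<xi>)\<^sup>2" for \<xi> :: 'a
  proof -
    have "(\<Sum>b\<in>Basis. ((t *\<^sub>R One) \<bullet> b) * (\<xi> \<bullet> b)\<^sup>2) = (\<Sum>b\<in>Basis. t * (\<xi> \<bullet> b)\<^sup>2)"
      by (intro sum.cong) auto
    also have "\<dots> = t * (\<xi> \<bullet> \<xi>)"
      by (subst euclidean_inner) (simp add: sum_distrib_left power2_eq_square)
    finally show ?thesis by (simp add: dot_square_norm)
  qed
  then show ?thesis
    by (simp add: schrod_sol_def wave_def fourier_integral_def wave_phase_def)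
qed

lemma g_supp_cube: "\<xi> \<notin> pi_cube \<Longrightarrow> g \<xi> = 0"
proof (rule g_support)
  assume "\<xi> \<notin> pi_cube"
  then obtain b where b: "b \<in> Basis" "\<xi> \<bullet> b \<notin> {-pi..pi}" by (auto simp: mem_pi_cube)
  then have "1 < \<bar>\<xi> \<bullet> b\<bar>" using pi_gt3 by auto
  also have "\<dots> \<le> norm \<xi>" by (rule Basis_le_norm[OF b(1)])
  finally show "1 < norm \<xi>" .
qed

lemma g_integrable: "integrable lebesgue g"
  by (rule integrable_of_square_integrable[OF g_measurable g_square_integrable, of pi_cube])
     (auto simp: g_supp_cube pi_cube_def)

lemma continuous_wave_phase: "continuous_on S (\<lambda>\<xi>. wave_phase \<xi> x \<tau>)"
  unfolding wave_phase_def by (intro continuous_intros)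

lemma wave_phase_measurable: "(\<lambda>\<xi>. cis (wave_phase \<xi> x \<tau>)) \<in> borel_measurable lebesgue"
proof -
  have "(\<lambda>\<xi>. cis (wave_phase \<xi> x \<tau>)) \<in> borel_measurable borel"
    by (intro borel_measurable_continuous_onI continuous_on_cis continuous_wave_phase)
  then show ?thesis by (simp add: measurable_completion)
qed

lemma wave_integrable: "integrable lebesgue (\<lambda>\<xi>. g \<xi> * cis (wave_phase \<xi> x \<tau>))"
  by (rule Bochner_Integration.integrable_bound[OF g_integrable])
     (use g_measurable wave_phase_measurable in \<open>auto simp: norm_mult\<close>)

lemma wave_phase_shift:
  assumes "b \<in> Basis"
  shows "wave_phase \<xi> (x + y *\<^sub>R b) (\<tau> + s *\<^sub>R b) = wave_phase \<xi> x \<tau> + (y * (\<xi> \<bullet> b) - s * (\<xi> \<bullet> b)\<^sup>2)"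
proof -
  have "(\<Sum>c\<in>Basis. ((\<tau> + s *\<^sub>R b) \<bullet> c) * (\<xi> \<bullet> c)\<^sup>2) =
      (\<Sum>c\<in>Basis. (\<tau> \<bullet> c) * (\<xi> \<bullet> c)\<^sup>2 + (if c = b then s * (\<xi> \<bullet> b)\<^sup>2 else 0))"
    using assms by (intro sum.cong) (auto simp: inner_add_left inner_Basis distrib_right)
  also have "\<dots> = (\<Sum>c\<in>Basis. (\<tau> \<bullet> c) * (\<xi> \<bullet> c)\<^sup>2) + s * (\<xi> \<bullet> b)\<^sup>2"
    using assms by (simp add: sum.distrib)
  finally show ?thesis by (simp add: wave_phase_def inner_add_right)
qed

lemma wave_bounded: "\<exists>B. \<forall>x \<tau>. cmod (wave x \<tau>) \<le> B"
proof (intro exI allI)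
  show "cmod (wave x \<tau>) \<le> 1 / (2 * pi) ^ DIM('a) * integral\<^sup>L lebesgue (\<lambda>\<xi>. cmod (g \<xi>))" for x \<tau>
    unfolding wave_def fourier_integral_def norm_mult
    by (intro mult_mono order_trans[OF integral_norm_bound]) (auto simp: norm_mult norm_divide norm_power)
qed

text \<open>Under the Fourier integral, the character \<open>cis (k * (\<xi> \<bullet> b))\<close>
  acts as translation by \<open>k b\<close>. The expansion of \<open>F\<close> is invoked only where
  \<open>\<bar>\<xi> \<bullet> b\<bar> \<le> 1\<close>, which contains the support of
  \<open>g\<close>. Enumerating the integers by \<open>int_decode\<close> allows sum and integral to
  be exchanged as for a series.\<close>

lemma wave_expansion:
  assumes b: "b \<in> Basis"
    and \<beta>: "\<And>k. cmod (\<beta> k) \<le> C * (phi (of_int k))\<^sup>2"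
    and F: "\<And>\<theta>. \<bar>\<theta>\<bar> \<le> 1 \<Longrightarrow> ((\<lambda>k. \<beta> k * cis (of_int k * \<theta>)) has_sum F \<theta>) UNIV"
  shows "((\<lambda>k::int. \<beta> k * wave (x + of_int k *\<^sub>R b) \<tau>) has_sum
    fourier_integral (\<lambda>\<xi>. F (\<xi> \<bullet> b) * cis (wave_phase \<xi> x \<tau>))) UNIV"
proof -
  have C0: "0 \<le> C" using \<beta>[of 0] norm_ge_zero[of "\<beta> 0"] by (simp del: norm_ge_zero)
  have \<beta>s: "(\<lambda>k. cmod (\<beta> k)) summable_on UNIV"
  proof (rule summable_on_comparison_test[OF summable_on_cmult_right[OF phi_summable, of C]])
    show "cmod (\<beta> k) \<le> C * phi (of_int k)" for k
      using C0 by (intro order_trans[OF \<beta> mult_left_mono[OF phi_square_le]]) simp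
  qed simp
  have bij: "bij_betw int_decode UNIV UNIV" by (rule bij_int_decode)
  have sm: "summable (\<lambda>i. cmod (\<beta> (int_decode i)))"
    using summable_on_reindex_bij_betw[OF bij, of "\<lambda>k. cmod (\<beta> k)"] \<beta>s
    by (intro summable_on_imp_summable) simp
  define f where "f i \<xi> = \<beta> (int_decode i) * (g \<xi> * cis (wave_phase \<xi> (x + of_int (int_decode i) *\<^sub>R b) \<tau>))" for i \<xi>
  have fi: "integrable lebesgue (f i)" for i
    unfolding f_def by (intro integrable_mult_right wave_integrable)
  have nf: "norm (f i \<xi>) = cmod (\<beta> (int_decode i)) * cmod (g \<xi>)" for i \<xi>
    by (simp add: f_def norm_mult)
  have f_sums: "(\<lambda>i. f i \<xi>) sums (g \<xi> * (F (\<xi> \<bullet> b) * cis (wave_phase \<xi> x \<tau>)))" for \<xi>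
  proof (cases "norm \<xi> \<le> 1")
    case True
    have "\<bar>\<xi> \<bullet> b\<bar> \<le> 1" using Basis_le_norm[OF b, of \<xi>] True by simp
    then have "((\<lambda>k. \<beta> k * cis (of_int k * (\<xi> \<bullet> b)) * (g \<xi> * cis (wave_phase \<xi> x \<tau>))) has_sum
       F (\<xi> \<bullet> b) * (g \<xi> * cis (wave_phase \<xi> x \<tau>))) UNIV"
      by (intro has_sum_cmult_left F)
    then have "((\<lambda>i. \<beta> (int_decode i) * cis (of_int (int_decode i) * (\<xi> \<bullet> b)) * (g \<xi> * cis (wave_phase \<xi> x \<tau>))) has_sum
       F (\<xi> \<bullet> b) * (g \<xi> * cis (wave_phase \<xi> x \<tau>))) UNIV"
      by (subst has_sum_reindex_bij_betw[OF bij])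
    moreover have "\<beta> (int_decode i) * cis (of_int (int_decode i) * (\<xi> \<bullet> b)) * (g \<xi> * cis (wave_phase \<xi> x \<tau>)) = f i \<xi>" for i
    proof -
      have "cis (wave_phase \<xi> (x + of_int (int_decode i) *\<^sub>R b) \<tau>) =
          cis (of_int (int_decode i) * (\<xi> \<bullet> b)) * cis (wave_phase \<xi> x \<tau>)"
        using wave_phase_shift[OF b, of \<xi> x "of_int (int_decode i)" \<tau> 0]
        by (simp add: cis_mult add.commute)
      then show ?thesis by (simp add: f_def mult_ac)
    qed
    ultimately show ?thesis by (auto dest!: has_sum_imp_sums simp: mult_ac)
  next
    case False
    then have "g \<xi> = 0" by (intro g_support) simp
    then show ?thesis by (simp add: f_def)
  qed
  have "(\<lambda>i. integral\<^sup>L lebesgue (f i)) sums (integral\<^sup>L lebesgue (\<lambda>\<xi>. \<Sum>i. f i \<xi>))"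
  proof (rule sums_integral[OF fi])
    show "AE \<xi> in lebesgue. summable (\<lambda>i. norm (f i \<xi>))"
      unfolding nf by (intro AE_I2 summable_mult2 sm)
    show "summable (\<lambda>i. integral\<^sup>L lebesgue (\<lambda>\<xi>. norm (f i \<xi>)))"
      unfolding nf by (simp add: g_integrable) (intro summable_mult2 sm)
  qed
  moreover have "(\<Sum>i. f i \<xi>) = g \<xi> * (F (\<xi> \<bullet> b) * cis (wave_phase \<xi> x \<tau>))" for \<xi>
    using f_sums[of \<xi>] by (simp add: sums_iff)
  moreover have "integral\<^sup>L lebesgue (f i) = \<beta> (int_decode i) * integral\<^sup>L lebesgue (\<lambda>\<xi>. g \<xi> * cis (wave_phase \<xi> (x + of_int (int_decode i) *\<^sub>R b) \<tau>))" for i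
    unfolding f_def by simp
  ultimately have "(\<lambda>i. \<beta> (int_decode i) * integral\<^sup>L lebesgue (\<lambda>\<xi>. g \<xi> * cis (wave_phase \<xi> (x + of_int (int_decode i) *\<^sub>R b) \<tau>)))
     sums integral\<^sup>L lebesgue (\<lambda>\<xi>. g \<xi> * (F (\<xi> \<bullet> b) * cis (wave_phase \<xi> x \<tau>)))"
    by simp
  from sums_mult[OF this, of "complex_of_real (1 / (2 * pi) ^ DIM('a))"]
  have sums: "(\<lambda>i. \<beta> (int_decode i) * wave (x + of_int (int_decode i) *\<^sub>R b) \<tau>)
     sums fourier_integral (\<lambda>\<xi>. F (\<xi> \<bullet> b) * cis (wave_phase \<xi> x \<tau>))"
    unfolding wave_def fourier_integral_def by (simp add: mult_ac)
  obtain W where W: "\<And>x \<tau>. cmod (wave x \<tau>) \<le> W" using wave_bounded by blast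
  have "summable (\<lambda>i. norm (\<beta> (int_decode i) * wave (x + of_int (int_decode i) *\<^sub>R b) \<tau>))"
  proof (rule summable_comparison_test'[OF summable_mult2[OF sm, of W], of 0])
    show "norm (norm (\<beta> (int_decode i) * wave (x + of_int (int_decode i) *\<^sub>R b) \<tau>)) \<le> cmod (\<beta> (int_decode i)) * W" for i
      by (simp add: norm_mult W mult_left_mono)
  qed
  from norm_summable_imp_has_sum[OF this sums]
  show ?thesis
    using has_sum_reindex_bij_betw[OF bij, of "\<lambda>k. \<beta> k * wave (x + of_int k *\<^sub>R b) \<tau>"] by simp
qed

section \<open>Bounds for the density, its average and its flux\<close>

lemma wave_density_nonneg: "0 \<le> wave_density \<tau> x"
  by (simp add: wave_density_def)

lemma wave_density_bounded: "\<exists>B. \<forall>x \<tau>. \<bar>wave_density \<tau> x\<bar> \<le> B"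
proof -
  obtain B where "\<And>x \<tau>. cmod (wave x \<tau>) \<le> B" using wave_bounded by blast
  then have "\<bar>wave_density \<tau> x\<bar> \<le> B\<^sup>2" for x \<tau>
    by (simp add: wave_density_def power_mono)
  then show ?thesis by blast
qed

text \<open>The samples of the wave on \<open>x + lattice\<close> are, up to the factor
  \<open>1 / L\<close>, Fourier coefficients on the cube of a function with the modulus of
  \<open>g\<close>. Bessel's inequality therefore bounds them uniformly in \<open>x\<close> and
  \<open>\<tau>\<close>.\<close>

lemma wave_density_lattice_sum_le:
  assumes "finite F" "F \<subseteq> lattice"
  shows "(\<Sum>n\<in>F. wave_density \<tau> (x + n)) \<le> integral\<^sup>L lebesgue (\<lambda>\<xi>. (cmod (g \<xi>))\<^sup>2) / (2 * pi) ^ DIM('a)"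
proof -
  define L :: real where "L = (2 * pi) ^ DIM('a)"
  have L: "L > 0" by (simp add: L_def)
  define h where "h \<xi> = g \<xi> * cis (wave_phase \<xi> x \<tau>)" for \<xi>
  have nh: "cmod (h \<xi>) = cmod (g \<xi>)" for \<xi> by (simp add: h_def norm_mult)
  have eq: "wave_density \<tau> (x + n) = (cmod (integral\<^sup>L lebesgue (\<lambda>\<xi>. h \<xi> * cis (\<xi> \<bullet> n))))\<^sup>2 / L\<^sup>2" for n
  proof -
    have "cis (wave_phase \<xi> (x + n) \<tau>) = cis (wave_phase \<xi> x \<tau>) * cis (\<xi> \<bullet> n)" for \<xi>
      by (simp add: wave_phase_def inner_add_right cis_mult algebra_simps)
    then have "wave (x + n) \<tau> = integral\<^sup>L lebesgue (\<lambda>\<xi>. h \<xi> * cis (\<xi> \<bullet> n)) / of_real L"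
      by (simp add: wave_def fourier_integral_def h_def L_def mult.assoc)
    then show ?thesis using L by (simp add: wave_density_def norm_divide power_divide)
  qed
  have "(\<Sum>n\<in>F. (cmod (integral\<^sup>L lebesgue (\<lambda>\<xi>. h \<xi> * cis (\<xi> \<bullet> n))))\<^sup>2) \<le> L * integral\<^sup>L lebesgue (\<lambda>\<xi>. (cmod (h \<xi>))\<^sup>2)"
    unfolding L_def
    by (rule bessel_inequality)
       (use g_measurable wave_phase_measurable g_square_integrable g_supp_cube assms in \<open>auto simp: nh\<close>,
        auto simp: h_def)
  then have "(\<Sum>n\<in>F. wave_density \<tau> (x + n)) \<le> L * integral\<^sup>L lebesgue (\<lambda>\<xi>. (cmod (g \<xi>))\<^sup>2) / L\<^sup>2"
    unfolding eq sum_divide_distrib[symmetric] nh by (intro divide_right_mono) auto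
  also have "\<dots> = integral\<^sup>L lebesgue (\<lambda>\<xi>. (cmod (g \<xi>))\<^sup>2) / L" using L by (simp add: power2_eq_square)
  finally show ?thesis by (simp add: L_def)
qed

text \<open>The wave at the shifted point is a convolution along \<open>b\<close> with a kernel
  dominated by \<open>phi\<close>; Cauchy-Schwarz with weight \<open>phi\<close> passes to squares.
  A line average on the right is unavoidable, since the density at the point itself may
  vanish.\<close>

lemma wave_density_shift_le:
  "\<exists>A>0. \<forall>b\<in>Basis. \<forall>y s x \<tau>. \<bar>y\<bar> \<le> 1 \<longrightarrow> \<bar>s\<bar> \<le> 1 \<longrightarrow>
     wave_density (\<tau> + s *\<^sub>R b) (x + y *\<^sub>R b) \<le> A * line_avg b (wave_density \<tau>) x"
proof -
  obtain C where C: "C > 0" and ex: "\<And>y s. \<bar>y\<bar> \<le> 1 \<Longrightarrow> \<bar>s\<bar> \<le> 1 \<Longrightarrow>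
     (\<exists>\<beta>. (\<forall>k. cmod (\<beta> k) \<le> C * (phi (of_int k))\<^sup>2) \<and>
       (\<forall>\<theta>. \<bar>\<theta>\<bar> \<le> 1 \<longrightarrow> ((\<lambda>k. \<beta> k * cis (of_int k * \<theta>)) has_sum cis (y * \<theta> - s * \<theta>\<^sup>2)) UNIV))"
    using phase_expansion by blast
  obtain B where B: "\<And>x \<tau>. cmod (wave x \<tau>) \<le> B" using wave_bounded by blast
  show ?thesis
  proof (intro exI[of _ "C\<^sup>2 * phi_mass"] conjI ballI allI impI)
    show "0 < C\<^sup>2 * phi_mass" using C phi_mass_ge_1 by simp
    fix b y s x \<tau> assume b: "b \<in> (Basis :: 'a set)" and y: "\<bar>y\<bar> \<le> (1::real)" and s: "\<bar>s\<bar> \<le> (1::real)"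
    from ex[OF y s] obtain \<beta> where \<beta>: "\<And>k. cmod (\<beta> k) \<le> C * (phi (of_int k))\<^sup>2"
      and F: "\<And>\<theta>. \<bar>\<theta>\<bar> \<le> 1 \<Longrightarrow> ((\<lambda>k. \<beta> k * cis (of_int k * \<theta>)) has_sum cis (y * \<theta> - s * \<theta>\<^sup>2)) UNIV"
      by blast
    have hs: "((\<lambda>k::int. \<beta> k * wave (x + of_int k *\<^sub>R b) \<tau>) has_sum wave (x + y *\<^sub>R b) (\<tau> + s *\<^sub>R b)) UNIV"
      using wave_expansion[OF b \<beta> F, of x \<tau>]
      by (simp add: wave_def wave_phase_shift[OF b] cis_mult add.commute)
    define v where "v k = cmod (wave (x + of_int k *\<^sub>R b) \<tau>)" for k :: int
    have v: "0 \<le> v k" "v k \<le> B" for k by (auto simp: v_def B)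
    note CS = phi_Cauchy_Schwarz[OF v]
    have "cmod (wave (x + y *\<^sub>R b) (\<tau> + s *\<^sub>R b)) \<le> C * (\<Sum>\<^sub>\<infinity>k::int. phi (of_int k) * v k)"
    proof (rule norm_infsum_le[OF hs])
      show "((\<lambda>k::int. C * (phi (of_int k) * v k)) has_sum C * (\<Sum>\<^sub>\<infinity>k::int. phi (of_int k) * v k)) UNIV"
        by (intro has_sum_cmult_right has_sum_infsum CS)
      fix k :: int
      have "cmod (\<beta> k) \<le> C * phi (of_int k)"
        using C by (intro order_trans[OF \<beta> mult_left_mono[OF phi_square_le]]) simp
      then show "norm (\<beta> k * wave (x + of_int k *\<^sub>R b) \<tau>) \<le> C * (phi (of_int k) * v k)"
        by (simp add: norm_mult v_def mult.assoc[symmetric] mult_right_mono)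
    qed
    then have "wave_density (\<tau> + s *\<^sub>R b) (x + y *\<^sub>R b) \<le> (C * (\<Sum>\<^sub>\<infinity>k::int. phi (of_int k) * v k))\<^sup>2"
      unfolding wave_density_def by (intro power_mono) auto
    also have "\<dots> \<le> C\<^sup>2 * (phi_mass * (\<Sum>\<^sub>\<infinity>k::int. phi (of_int k) * (v k)\<^sup>2))"
      unfolding power_mult_distrib by (intro mult_left_mono CS) auto
    also have "(\<Sum>\<^sub>\<infinity>k::int. phi (of_int k) * (v k)\<^sup>2) = line_avg b (wave_density \<tau>) x"
      by (simp add: line_avg_def wave_density_def v_def)
    finally show "wave_density (\<tau> + s *\<^sub>R b) (x + y *\<^sub>R b) \<le> C\<^sup>2 * phi_mass * line_avg b (wave_density \<tau>) x"
      by (simp add: mult.assoc)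
  qed
qed

lemma rho_nonneg: "0 \<le> rho \<tau> x"
  unfolding rho_def by (intro smooth_nonneg wave_density_nonneg)

lemma wave_density_le_rho: "wave_density \<tau> x \<le> rho \<tau> x"
proof -
  obtain B where "\<And>x \<tau>. \<bar>wave_density \<tau> x\<bar> \<le> B" using wave_density_bounded by blast
  then show ?thesis unfolding rho_def by (intro le_smooth wave_density_nonneg)
qed

lemma line_avg_wave_density_bounded: "\<exists>B. \<forall>\<tau> b x. \<bar>line_avg b (wave_density \<tau>) x\<bar> \<le> B"
proof -
  obtain B where B: "\<And>x \<tau>. \<bar>wave_density \<tau> x\<bar> \<le> B" using wave_density_bounded by blast
  have "\<bar>line_avg b (wave_density \<tau>) x\<bar> \<le> phi_mass * B" for \<tau> b x
    using line_avg_le[of "wave_density \<tau>" B b x] line_avg_nonneg[of "wave_density \<tau>" b x] B wave_density_nonneg by simp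
  then show ?thesis by blast
qed

lemma smooth_line_avg_wave_density:
  assumes "b \<in> Basis"
  shows "smooth (line_avg b (wave_density \<tau>)) x \<le> 4 * phi_mass * rho \<tau> x"
proof -
  obtain B where B: "\<And>x \<tau>. \<bar>wave_density \<tau> x\<bar> \<le> B" using wave_density_bounded by blast
  show ?thesis unfolding rho_def by (rule smooth_line_avg_le[OF wave_density_nonneg B assms])
qed

text \<open>The Harnack inequality that justifies averaging: smoothing the pointwise bound produces
  a smoothed line average, which \<open>rho\<close> absorbs. The shifts may have either sign, so the
  bound can be used in both directions. Taking \<open>H\<close> at least 1 makes it safe to weaken
  bounds by a factor \<open>H\<close>.\<close>

lemma rho_shift_le:
  "\<exists>H\<ge>1. \<forall>b\<in>Basis. \<forall>y s x \<tau>. \<bar>y\<bar> \<le> 1 \<longrightarrow> \<bar>s\<bar> \<le> 1 \<longrightarrow>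
     rho (\<tau> + s *\<^sub>R b) (x + y *\<^sub>R b) \<le> H * rho \<tau> x"
proof -
  obtain A where A: "A > 0" "\<And>b y s x \<tau>. b \<in> Basis \<Longrightarrow> \<bar>y\<bar> \<le> 1 \<Longrightarrow> \<bar>s\<bar> \<le> 1 \<Longrightarrow>
     wave_density (\<tau> + s *\<^sub>R b) (x + y *\<^sub>R b) \<le> A * line_avg b (wave_density \<tau>) x"
    using wave_density_shift_le by blast
  obtain B where B: "\<And>x \<tau>. \<bar>wave_density \<tau> x\<bar> \<le> B" using wave_density_bounded by blast
  obtain B' where B': "\<And>\<tau> b x. \<bar>line_avg b (wave_density \<tau>) x\<bar> \<le> B'" using line_avg_wave_density_bounded by blast
  show ?thesis
  proof (intro exI[of _ "max 1 (4 * phi_mass * A)"] conjI ballI allI impI)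
    fix b y s x \<tau> assume b: "b \<in> (Basis :: 'a set)" and y: "\<bar>y\<bar> \<le> (1::real)" and s: "\<bar>s\<bar> \<le> (1::real)"
    have "rho (\<tau> + s *\<^sub>R b) (x + y *\<^sub>R b) = smooth (\<lambda>x. wave_density (\<tau> + s *\<^sub>R b) (x + y *\<^sub>R b)) x"
      by (simp add: rho_def smooth_shift)
    also have "\<dots> \<le> smooth (\<lambda>x. A * line_avg b (wave_density \<tau>) x) x"
      by (rule smooth_mono[where B = B and B' = "A * B'"])
         (use A B B' b y s in \<open>auto simp: abs_mult\<close>)
    also have "\<dots> \<le> A * (4 * phi_mass * rho \<tau> x)"
      unfolding smooth_cmult using A by (intro mult_left_mono smooth_line_avg_wave_density b) auto
    also have "\<dots> \<le> max 1 (4 * phi_mass * A) * rho \<tau> x"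
      using mult_right_mono[OF max.cobounded2[of "4 * phi_mass * A" 1] rho_nonneg[of \<tau> x]]
      by (simp add: mult_ac)
    finally show "rho (\<tau> + s *\<^sub>R b) (x + y *\<^sub>R b) \<le> max 1 (4 * phi_mass * A) * rho \<tau> x" .
  qed simp
qed

text \<open>The symbol of the step back in time is the conjugate of the symbol of the step forward,
  so its coefficients are \<open>cnj (a (- k))\<close>. This is the adjointness that
  \<open>discrete_flux\<close> requires, and the factor \<open>h\<close> in its bound comes from the
  coefficients \<open>a\<close>.\<close>

lemma wave_density_flux:
  "\<exists>K>0. \<forall>h b \<tau>. 0 \<le> h \<longrightarrow> h \<le> 1 \<longrightarrow> b \<in> Basis \<longrightarrow>
    (\<exists>G. \<forall>x. wave_density (\<tau> + h *\<^sub>R b) x - wave_density \<tau> x = G x - G (x - b) \<and>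
      \<bar>G x\<bar> \<le> K * h * (line_avg b (wave_density (\<tau> + h *\<^sub>R b)) x + line_avg b (wave_density \<tau>) x))"
proof -
  obtain C where C: "C > 0" and ex: "\<And>s. \<bar>s\<bar> \<le> 1 \<Longrightarrow>
     (\<exists>\<beta>. (\<forall>k. cmod (\<beta> k) \<le> C * \<bar>s\<bar> * (phi (of_int k))\<^sup>2) \<and>
       (\<forall>\<theta>. \<bar>\<theta>\<bar> \<le> 1 \<longrightarrow> ((\<lambda>k. \<beta> k * cis (of_int k * \<theta>)) has_sum cis (- s * \<theta>\<^sup>2) - 1) UNIV))"
    using phase_increment_expansion by blast
  obtain B where B: "\<And>x \<tau>. \<bar>wave_density \<tau> x\<bar> \<le> B" using wave_density_bounded by blast
  have diff: "fourier_integral (\<lambda>\<xi>. (cis (- s * (\<xi> \<bullet> b)\<^sup>2) - 1) * cis (wave_phase \<xi> x \<tau>)) =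
      wave x (\<tau> + s *\<^sub>R b) - wave x \<tau>" if "b \<in> Basis" for s b x \<tau>
  proof -
    have "g \<xi> * ((cis (- s * (\<xi> \<bullet> b)\<^sup>2) - 1) * cis (wave_phase \<xi> x \<tau>)) =
       g \<xi> * cis (wave_phase \<xi> x (\<tau> + s *\<^sub>R b)) - g \<xi> * cis (wave_phase \<xi> x \<tau>)" for \<xi>
    proof -
      have "cis (wave_phase \<xi> x (\<tau> + s *\<^sub>R b)) = cis (- s * (\<xi> \<bullet> b)\<^sup>2) * cis (wave_phase \<xi> x \<tau>)"
        using wave_phase_shift[OF that, of \<xi> x 0 \<tau> s] by (simp add: cis_mult)
      then show ?thesis by (simp only: left_diff_distrib right_diff_distrib mult_1)
    qed
    then show ?thesis
      by (simp add: fourier_integral_def wave_def wave_integrable right_diff_distrib)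
  qed
  show ?thesis
  proof (intro exI[of _ "C * phi_mass"] conjI allI impI)
    show "0 < C * phi_mass" using C phi_mass_ge_1 by simp
    fix h :: real and b \<tau> :: 'a assume h: "0 \<le> h" "h \<le> 1" and b: "b \<in> Basis"
    have h': "\<bar>h\<bar> \<le> 1" using h by simp
    from ex[OF h'] obtain a where a: "\<And>k. cmod (a k) \<le> C * h * (phi (of_int k))\<^sup>2"
      and F: "\<And>\<theta>. \<bar>\<theta>\<bar> \<le> 1 \<Longrightarrow> ((\<lambda>k. a k * cis (of_int k * \<theta>)) has_sum cis (- h * \<theta>\<^sup>2) - 1) UNIV"
      using h by auto
    have fwd: "((\<lambda>k::int. a k * wave (x + of_int k *\<^sub>R b) \<tau>) has_sum (wave x (\<tau> + h *\<^sub>R b) - wave x \<tau>)) UNIV" for x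
      using wave_expansion[OF b a F, of x \<tau>] unfolding diff[OF b] .
    have bij: "bij_betw (uminus :: int \<Rightarrow> int) UNIV UNIV"
      by (rule bij_betw_byWitness[where f' = uminus]) auto
    have a': "cmod (cnj (a (- k))) \<le> C * h * (phi (of_int k))\<^sup>2" for k
      using a[of "- k"] by simp
    have F': "((\<lambda>k. cnj (a (- k)) * cis (of_int k * \<theta>)) has_sum cis (- (- h) * \<theta>\<^sup>2) - 1) UNIV" if "\<bar>\<theta>\<bar> \<le> 1" for \<theta>
    proof -
      have "((\<lambda>k. cnj (a k * cis (of_int k * \<theta>))) has_sum cnj (cis (- h * \<theta>\<^sup>2) - 1)) UNIV"
        using F[OF that] by (simp only: has_sum_cnj_iff)
      then have "((\<lambda>k. cnj (a k) * cis (- of_int k * \<theta>)) has_sum cis (- (- h) * \<theta>\<^sup>2) - 1) UNIV"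
        by (simp add: cis_cnj)
      then show ?thesis
        using has_sum_reindex_bij_betw[OF bij, of "\<lambda>k. cnj (a k) * cis (- of_int k * \<theta>)"] by simp
    qed
    have bwd: "((\<lambda>k::int. cnj (a k) * wave (x - of_int k *\<^sub>R b) (\<tau> + h *\<^sub>R b)) has_sum (wave x \<tau> - wave x (\<tau> + h *\<^sub>R b))) UNIV" for x
    proof -
      have "((\<lambda>k::int. cnj (a (- k)) * wave (x + of_int k *\<^sub>R b) (\<tau> + h *\<^sub>R b)) has_sum (wave x \<tau> - wave x (\<tau> + h *\<^sub>R b))) UNIV"
        using wave_expansion[OF b a' F', of x "\<tau> + h *\<^sub>R b"] unfolding diff[OF b] by simp
      then show ?thesis
        using has_sum_reindex_bij_betw[OF bij, of "\<lambda>k. cnj (a (- k)) * wave (x + of_int k *\<^sub>R b) (\<tau> + h *\<^sub>R b)"] by simp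
    qed
    have bd: "(cmod (wave x \<tau>))\<^sup>2 \<le> B" for x \<tau>
      using B[of \<tau> x] by (simp add: wave_density_def)
    show "\<exists>G. \<forall>x. wave_density (\<tau> + h *\<^sub>R b) x - wave_density \<tau> x = G x - G (x - b) \<and>
      \<bar>G x\<bar> \<le> C * phi_mass * h * (line_avg b (wave_density (\<tau> + h *\<^sub>R b)) x + line_avg b (wave_density \<tau>) x)"
      using discrete_flux[OF bd bd a fwd bwd]
      by (simp add: wave_density_def[abs_def] mult_ac)
  qed
qed

text \<open>Smoothing commutes with the shift by \<open>b\<close>, so the smoothed flux has the
  right divergence. Its bound by smoothed line averages becomes a bound by \<open>rho\<close> at
  both times, and \<open>rho_shift_le\<close> brings the later time back to the earlier one.\<close>

lemma rho_flux:
  "\<exists>K>0. \<forall>h b \<tau>. 0 \<le> h \<longrightarrow> h \<le> 1 \<longrightarrow> b \<in> Basis \<longrightarrow>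
    (\<exists>G. \<forall>x. rho (\<tau> + h *\<^sub>R b) x - rho \<tau> x = G x - G (x - b) \<and> \<bar>G x\<bar> \<le> K * h * rho \<tau> x)"
proof -
  obtain K where K: "K > 0" and flux: "\<And>h b \<tau>. 0 \<le> h \<Longrightarrow> h \<le> 1 \<Longrightarrow> b \<in> Basis \<Longrightarrow>
    (\<exists>G. \<forall>x. wave_density (\<tau> + h *\<^sub>R b) x - wave_density \<tau> x = G x - G (x - b) \<and>
      \<bar>G x\<bar> \<le> K * h * (line_avg b (wave_density (\<tau> + h *\<^sub>R b)) x + line_avg b (wave_density \<tau>) x))"
    using wave_density_flux by blast
  obtain H where H: "H \<ge> 1" "\<And>b y s x \<tau>. b \<in> Basis \<Longrightarrow> \<bar>y\<bar> \<le> 1 \<Longrightarrow> \<bar>s\<bar> \<le> 1 \<Longrightarrow>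
     rho (\<tau> + s *\<^sub>R b) (x + y *\<^sub>R b) \<le> H * rho \<tau> x"
    using rho_shift_le by blast
  obtain B where B: "\<And>x \<tau>. \<bar>wave_density \<tau> x\<bar> \<le> B" using wave_density_bounded by blast
  obtain B' where B': "\<And>\<tau> b x. \<bar>line_avg b (wave_density \<tau>) x\<bar> \<le> B'" using line_avg_wave_density_bounded by blast
  show ?thesis
  proof (intro exI[of _ "K * (4 * phi_mass * (H + 1))"] conjI allI impI)
    show "0 < K * (4 * phi_mass * (H + 1))" using K H phi_mass_ge_1 by simp
    fix h :: real and b \<tau> :: 'a assume h: "0 \<le> h" "h \<le> 1" and b: "b \<in> Basis"
    from flux[OF h b] obtain G where G: "\<And>x. wave_density (\<tau> + h *\<^sub>R b) x - wave_density \<tau> x = G x - G (x - b)"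
      and G_le: "\<And>x. \<bar>G x\<bar> \<le> K * h * (line_avg b (wave_density (\<tau> + h *\<^sub>R b)) x + line_avg b (wave_density \<tau>) x)"
      by blast
    have Kh: "0 \<le> K * h" using K h by simp
    define L where "L x = line_avg b (wave_density (\<tau> + h *\<^sub>R b)) x + line_avg b (wave_density \<tau>) x" for x
    have LB: "\<bar>L x\<bar> \<le> 2 * B'" for x using B'[of b "\<tau> + h *\<^sub>R b" x] B'[of b \<tau> x] by (simp add: L_def)
    have KLB: "\<bar>K * h * L x\<bar> \<le> K * h * (2 * B')" for x
      using LB[of x] Kh by (simp only: abs_mult[of "K * h"] abs_of_nonneg mult_left_mono)
    have GB: "\<bar>G x\<bar> \<le> K * h * (2 * B')" for x
      using G_le[of x] KLB[of x] by (simp add: L_def)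
    show "\<exists>G. \<forall>x. rho (\<tau> + h *\<^sub>R b) x - rho \<tau> x = G x - G (x - b) \<and>
        \<bar>G x\<bar> \<le> K * (4 * phi_mass * (H + 1)) * h * rho \<tau> x"
    proof (intro exI[of _ "smooth G"] allI conjI)
      fix x
      have "rho (\<tau> + h *\<^sub>R b) x - rho \<tau> x = smooth (\<lambda>x. wave_density (\<tau> + h *\<^sub>R b) x - wave_density \<tau> x) x"
        unfolding rho_def by (rule smooth_diff[symmetric]) (rule B)+
      also have "\<dots> = smooth (\<lambda>x. G x - G (x + (- b))) x" by (simp add: G)
      also have "\<dots> = smooth G x - smooth (\<lambda>x. G (x + (- b))) x"
        by (rule smooth_diff) (rule GB)+
      finally show "rho (\<tau> + h *\<^sub>R b) x - rho \<tau> x = smooth G x - smooth G (x - b)"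
        by (simp only: smooth_shift) simp
      have "\<bar>smooth G x\<bar> \<le> smooth (\<lambda>x. K * h * L x) x"
        by (rule abs_smooth_le[OF _ KLB]) (use G_le in \<open>simp add: L_def\<close>)
      also have "\<dots> = K * h * (smooth (line_avg b (wave_density (\<tau> + h *\<^sub>R b))) x + smooth (line_avg b (wave_density \<tau>)) x)"
        unfolding smooth_cmult L_def[abs_def] by (subst smooth_add[OF B' B']) simp
      also have "\<dots> \<le> K * h * (4 * phi_mass * (H * rho \<tau> x) + 4 * phi_mass * rho \<tau> x)"
      proof (intro mult_left_mono add_mono smooth_line_avg_wave_density b Kh)
        have "smooth (line_avg b (wave_density (\<tau> + h *\<^sub>R b))) x \<le> 4 * phi_mass * rho (\<tau> + h *\<^sub>R b) x"
          by (rule smooth_line_avg_wave_density[OF b])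
        also have "\<dots> \<le> 4 * phi_mass * (H * rho \<tau> x)"
          using H(2)[OF b, of 0 h \<tau> x] h phi_mass_ge_1 by (intro mult_left_mono) auto
        finally show "smooth (line_avg b (wave_density (\<tau> + h *\<^sub>R b))) x \<le> 4 * phi_mass * (H * rho \<tau> x)" .
      qed
      also have "\<dots> = K * (4 * phi_mass * (H + 1)) * h * rho \<tau> x"
        by (simp add: algebra_simps)
      finally show "\<bar>smooth G x\<bar> \<le> K * (4 * phi_mass * (H + 1)) * h * rho \<tau> x" .
    qed
  qed
qed

end

section \<open>Couplings, paths and lattice cells\<close>

text \<open>The normalisation \<open>m\<close> is a parameter and not computed from
  \<open>f\<close>: requiring the same \<open>m\<close> at all times expresses conservation of the
  total mass of \<open>f\<close> on the lattice.\<close>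

definition lattice_law :: "real \<Rightarrow> ('a::euclidean_space \<Rightarrow> real) \<Rightarrow> 'a pmf \<Rightarrow> bool" where
  "lattice_law m f \<mu> \<longleftrightarrow> (\<forall>x. pmf \<mu> x = (if x \<in> lattice then f x / m else 0))"

lemma lattice_law_exists:
  fixes f :: "'a::euclidean_space \<Rightarrow> real"
  assumes f: "\<And>x. 0 \<le> f x" "f summable_on lattice" and m: "infsum f lattice > 0"
  shows "\<exists>\<mu>. lattice_law (infsum f lattice) f \<mu>"
proof -
  define m where "m = infsum f lattice"
  define q where "q x = (if x \<in> lattice then f x / m else 0)" for x
  have q0: "0 \<le> q x" for x using f m by (simp add: q_def m_def)
  have qs: "(\<lambda>x. f x / m) summable_on lattice"
    using summable_on_cmult_left[OF f(2), of "1 / m"] by simp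
  have "norm (f x / m) = f x / m" for x using f m by (simp add: m_def)
  then have "(\<lambda>x. norm (f x / m)) summable_on lattice" using qs by (simp only:)
  then have abs: "Infinite_Set_Sum.abs_summable_on (\<lambda>x. f x / m) lattice"
    by (rule abs_summable_equivalent[THEN iffD1])
  have "infsum (\<lambda>x. f x / m) lattice = 1"
    using infsum_cmult_left'[of f "1 / m" lattice] m by (simp add: m_def)
  then have int1: "infsetsum (\<lambda>x. f x / m) lattice = 1"
    by (simp add: infsetsum_infsum[OF abs])
  have "(\<integral>\<^sup>+x. ennreal (q x) \<partial>count_space UNIV) = (\<integral>\<^sup>+x. ennreal (f x / m) \<partial>count_space lattice)"
    by (subst (2) nn_integral_count_space_indicator)
       (auto intro!: nn_integral_cong simp: q_def indicator_def)
  also have "\<dots> = ennreal (infsetsum (\<lambda>x. f x / m) lattice)"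
    unfolding infsetsum_def
    by (rule nn_integral_eq_integral) (use abs f m in \<open>auto simp: abs_summable_on_def m_def\<close>)
  also have "\<dots> = 1" by (simp add: int1)
  finally have "pmf (embed_pmf q) x = q x" for x
    by (intro pmf_embed_pmf q0)
  then show ?thesis by (intro exI[of _ "embed_pmf q"]) (simp add: lattice_law_def q_def m_def)
qed

text \<open>Summability of \<open>f\<close> is inherited from the probabilities, whose total is 1.
  The lemma transfers a mass bound from one time to the common normalisation \<open>m\<close>, which
  was defined at another time.\<close>

lemma lattice_law_mass_le:
  fixes f :: "'a::euclidean_space \<Rightarrow> real"
  assumes "lattice_law m f \<mu>" "m > 0" "\<And>F. finite F \<Longrightarrow> F \<subseteq> lattice \<Longrightarrow> sum f F \<le> Z"
  shows "m \<le> Z"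
proof -
  have supp: "set_pmf \<mu> \<subseteq> lattice"
  proof
    fix x assume "x \<in> set_pmf \<mu>"
    then have "pmf \<mu> x \<noteq> 0" by (simp add: set_pmf_iff)
    then show "x \<in> lattice" using assms(1) unfolding lattice_law_def by metis
  qed
  have "1 = infsetsum (pmf \<mu>) lattice" using infsetsum_pmf_eq_1[OF supp] by simp
  also have "\<dots> = infsum (pmf \<mu>) lattice"
    by (intro infsetsum_infsum pmf_abs_summable)
  also have "\<dots> \<le> Z / m"
  proof (rule infsum_le_finite_sums)
    show "pmf \<mu> summable_on lattice"
      by (rule abs_summable_summable[OF abs_summable_equivalent[THEN iffD2, OF pmf_abs_summable]])
    fix F :: "'a set" assume F: "finite F" "F \<subseteq> lattice"
    then have "sum (pmf \<mu>) F = sum f F / m"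
      unfolding sum_divide_distrib using assms(1) by (intro sum.cong) (auto simp: lattice_law_def)
    also have "\<dots> \<le> Z / m" using assms(2,3) F by (intro divide_right_mono) auto
    finally show "sum (pmf \<mu>) F \<le> Z / m" .
  qed
  finally show ?thesis using assms(2) by (simp add: field_simps)
qed

text \<open>Positive \<open>G x\<close> means mass going from \<open>x + b\<close> to
  \<open>x\<close>, negative \<open>G x\<close> the reverse. So \<open>x\<close> gives the fraction
  \<open>p x\<close> to \<open>x - b\<close> and \<open>q x\<close> to \<open>x + b\<close>. As
  either end of an edge may be the donor, the flux has to be at most half the density at both ends;
  then \<open>1 - p x - q x\<close> is nonnegative.\<close>

lemma lattice_law_flux_step:
  fixes f f' G :: "'a::euclidean_space \<Rightarrow> real"
  assumes \<mu>: "lattice_law m f \<mu>" and m: "m > 0" and b: "b \<in> Basis"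
    and diff: "\<And>x. f' x - f x = G x - G (x - b)"
    and G1: "\<And>x. \<bar>G x\<bar> \<le> f x / 2" and G2: "\<And>x. \<bar>G x\<bar> \<le> f (x + b) / 2"
  shows "\<exists>\<mu>'. lattice_law m f' \<mu>' \<and> rel_pmf (\<lambda>x y. norm (x - y) \<le> 1) \<mu> \<mu>'"
proof -
  \<comment> \<open>Where \<open>f x = 0\<close> the bounds force the adjacent fluxes to vanish, so
    division by zero, with value 0, gives the correct fractions.\<close>
  define p where "p x = max 0 (G (x - b)) / f x" for x
  define q where "q x = max 0 (- G x) / f x" for x
  have f0: "0 \<le> f x" for x using G1[of x] by linarith
  have pf: "p x * f x = max 0 (G (x - b))" for x
    using G2[of "x - b"] f0[of x] by (cases "f x = 0") (auto simp: p_def)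
  have qf: "q x * f x = max 0 (- G x)" for x
    using G1[of x] f0[of x] by (cases "f x = 0") (auto simp: q_def)
  have p0: "0 \<le> p x" "0 \<le> q x" for x using f0 by (auto simp: p_def q_def)
  have p1: "p x \<le> 1 / 2" "q x \<le> 1 / 2" for x
    using G1[of x] G2[of "x - b"] f0[of x] by (auto simp: p_def q_def divide_simps)
  define W where "W x = [(x - b, p x), (x + b, q x), (x, 1 - p x - q x)]" for x
  have wf: "pmf_of_list_wf (W x)" for x
    using p0[of x] p1[of x] by (auto simp: pmf_of_list_wf_def W_def)
  define \<kappa> where "\<kappa> x = pmf_of_list (W x)" for x
  have \<kappa>: "pmf (\<kappa> x) y = (if x - b = y then p x else 0) + (if x + b = y then q x else 0)
      + (if x = y then 1 - p x - q x else 0)" for x y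
    unfolding \<kappa>_def by (subst pmf_pmf_of_list[OF wf]) (auto simp: W_def)
  have set_\<kappa>: "set_pmf (\<kappa> x) \<subseteq> {x - b, x + b, x}" for x
    using set_pmf_of_list[OF wf, of x] by (simp add: \<kappa>_def W_def)
  have b0: "b \<noteq> 0" using b by auto
  have bb: "b + b \<noteq> 0" using b0 by (simp flip: scaleR_2)
  have norm_b: "norm b = 1" using b by simp
  have bl: "y + b \<in> lattice \<longleftrightarrow> y \<in> lattice" "y - b \<in> lattice \<longleftrightarrow> y \<in> lattice" for y
    using lattice_add[OF _ lattice_Basis[OF b]] lattice_diff[OF _ lattice_Basis[OF b]]
    by (metis add_diff_cancel diff_add_cancel)+
  show ?thesis
  proof (intro exI[of _ "bind_pmf \<mu> \<kappa>"] conjI)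
    have "pmf (bind_pmf \<mu> \<kappa>) y = (if y \<in> lattice then f' y / m else 0)" for y
    proof -
      have distinct: "y + b \<noteq> y" "y - b \<noteq> y" "y + b \<noteq> y - b"
      proof -
        show "y + b \<noteq> y - b"
        proof
          assume "y + b = y - b"
          then have "b + b = 0" by (metis add_diff_cancel_left' add_left_cancel diff_add_cancel diff_conv_add_uminus minus_unique)
          with bb show False ..
        qed
      qed (use b0 in auto)
      have "pmf (bind_pmf \<mu> \<kappa>) y = (\<Sum>x\<in>{y + b, y - b, y}. pmf \<mu> x *\<^sub>R pmf (\<kappa> x) y)"
        unfolding pmf_bind
        by (rule integral_measure_pmf) (auto simp: \<kappa> split: if_splits)
      also have "\<dots> = pmf \<mu> (y + b) * p (y + b) + pmf \<mu> (y - b) * q (y - b) + pmf \<mu> y * (1 - p y - q y)"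
        using distinct bb by (simp add: \<kappa> eq_commute[of _ y])
      also have "\<dots> = (if y \<in> lattice then f' y / m else 0)"
      proof (cases "y \<in> lattice")
        case True
        have "pmf \<mu> (y + b) * p (y + b) + pmf \<mu> (y - b) * q (y - b) + pmf \<mu> y * (1 - p y - q y) =
           (p (y + b) * f (y + b) + q (y - b) * f (y - b) + (f y - p y * f y - q y * f y)) / m"
          using True \<mu> by (simp add: lattice_law_def bl add_divide_distrib diff_divide_distrib right_diff_distrib mult.commute)
        also have "\<dots> = f' y / m"
          using diff[of y] unfolding pf qf by (simp add: max_def)
        finally show ?thesis using True by simp
      qed (use \<mu> in \<open>simp add: lattice_law_def bl\<close>)
      finally show ?thesis .
    qed
    then show "lattice_law m f' (bind_pmf \<mu> \<kappa>)" by (simp add: lattice_law_def)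
    have "rel_pmf (\<lambda>x y. norm (x - y) \<le> 1) (bind_pmf \<mu> return_pmf) (bind_pmf \<mu> \<kappa>)"
    proof (rule rel_pmf_bindI[where R = "(=)"])
      show "rel_pmf (=) \<mu> \<mu>" by (simp add: pmf.rel_eq)
      fix x y :: 'a assume "x = y"
      then show "rel_pmf (\<lambda>x y. norm (x - y) \<le> 1) (return_pmf x) (\<kappa> y)"
        using set_\<kappa>[of x] norm_b by (auto simp: rel_pmf_return_pmf1)
    qed
    then show "rel_pmf (\<lambda>x y. norm (x - y) \<le> 1) \<mu> (bind_pmf \<mu> \<kappa>)"
      by (simp add: bind_return_pmf')
  qed
qed

lemma rel_pmf_trans:
  assumes "rel_pmf R p q" "rel_pmf S q r"
  shows "rel_pmf (R OO S) p r"
  using assms by (auto simp: pmf.rel_compp)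

text \<open>Couplings are glued without conditional distributions: a relation between the
  \<open>N\<close>-th marginal of \<open>D\<close> and the next law is also a relation between
  \<open>D\<close> itself and the next law. Its witness attaches a next position to a whole path,
  which is written at index \<open>Suc N\<close> and leaves the earlier marginals unchanged.\<close>

lemma coupling_chain:
  fixes \<mu> :: "nat \<Rightarrow> 'a pmf"
  assumes "\<And>k. k < N \<Longrightarrow> rel_pmf R (\<mu> k) (\<mu> (Suc k))"
  shows "\<exists>D :: (nat \<Rightarrow> 'a) pmf. (\<forall>k\<le>N. map_pmf (\<lambda>p. p k) D = \<mu> k) \<and>
    (\<forall>p\<in>set_pmf D. \<forall>k<N. R (p k) (p (Suc k)))"
  using assms
proof (induction N)
  case 0
  show ?case
    by (intro exI[of _ "map_pmf (\<lambda>x _. x) (\<mu> 0)"]) (simp add: pmf.map_comp o_def)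
next
  case (Suc N)
  then obtain D where D: "\<And>k. k \<le> N \<Longrightarrow> map_pmf (\<lambda>p. p k) D = \<mu> k"
    "\<And>p k. p \<in> set_pmf D \<Longrightarrow> k < N \<Longrightarrow> R (p k) (p (Suc k))"
    by (metis less_SucI)
  have "rel_pmf R (map_pmf (\<lambda>p. p N) D) (\<mu> (Suc N))"
    using D(1)[of N] Suc.prems[of N] by simp
  then have "rel_pmf (\<lambda>p y. R (p N) y) D (\<mu> (Suc N))"
    by (simp add: pmf.rel_map)
  then obtain pq where pq: "\<And>p y. (p, y) \<in> set_pmf pq \<Longrightarrow> R (p N) y"
    "map_pmf fst pq = D" "map_pmf snd pq = \<mu> (Suc N)"
    by (auto elim: rel_pmf.cases)
  show ?case
  proof (intro exI[of _ "map_pmf (\<lambda>(p, y). p(Suc N := y)) pq"] conjI allI impI ballI)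
    fix k assume k: "k \<le> Suc N"
    show "map_pmf (\<lambda>p. p k) (map_pmf (\<lambda>(p, y). p(Suc N := y)) pq) = \<mu> k"
    proof (cases "k = Suc N")
      case True
      then show ?thesis using pq(3) by (simp add: pmf.map_comp o_def case_prod_unfold)
    next
      case False
      have "map_pmf (\<lambda>p. p k) (map_pmf (\<lambda>(p, y). p(Suc N := y)) pq) = map_pmf (\<lambda>p. p k) (map_pmf fst pq)"
        using False by (simp add: pmf.map_comp o_def case_prod_unfold)
      then show ?thesis using D(1)[of k] False k by (simp add: pq(2))
    qed
  next
    fix p' k assume "p' \<in> set_pmf (map_pmf (\<lambda>(p, y). p(Suc N := y)) pq)" and k: "k < Suc N"
    then obtain p y where p: "(p, y) \<in> set_pmf pq" "p' = p(Suc N := y)" by auto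
    then have "p \<in> set_pmf D" using pq(2) by force
    then show "R (p' k) (p' (Suc k))"
      using p pq(1)[OF p(1)] D(2)[of p k] k by (cases "k = N") auto
  qed
qed

section \<open>Differentiable interpolation of lattice paths\<close>

lemma smoothstep_0_1_bounded: "\<exists>B>0. \<forall>x. \<bar>smoothstep 0 x\<bar> \<le> B \<and> \<bar>smoothstep 1 x\<bar> \<le> B"
proof -
  have "continuous_on {-3..-1} (smoothstep j)" for j
    unfolding smoothstep_def[abs_def] tpow_def by (intro continuous_intros)
  then have "bounded (smoothstep j ` {-3..-1})" for j
    by (intro compact_imp_bounded compact_continuous_image compact_Icc)
  then have "\<exists>B>0. \<forall>x\<in>{-3..-1}. \<bar>smoothstep j x\<bar> \<le> B" for j
    unfolding bounded_pos by auto
  then obtain B0 B1 where B: "B0 > 0" "\<And>x. x \<in> {-3..-1} \<Longrightarrow> \<bar>smoothstep 0 x\<bar> \<le> B0"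
      "B1 > 0" "\<And>x. x \<in> {-3..-1} \<Longrightarrow> \<bar>smoothstep 1 x\<bar> \<le> B1"
    by metis
  show ?thesis
  proof (intro exI[of _ "max 1 (max B0 B1)"] conjI allI)
    fix x :: real
    consider "x \<le> -3" | "x \<in> {-3..-1}" | "x \<ge> -1" by force
    then show "\<bar>smoothstep 0 x\<bar> \<le> max 1 (max B0 B1)" "\<bar>smoothstep 1 x\<bar> \<le> max 1 (max B0 B1)"
      by (cases; use B(2,4)[of x] in \<open>auto simp: smoothstep_left smoothstep_right\<close>)+
  qed simp
qed

text \<open>The map \<open>a k\<close> carries the \<open>k\<close>-th time interval onto
  \<open>[-3, -1]\<close>, where \<open>smoothstep 0\<close> passes from 0 to 1. At each time at
  most one increment is active, so the speed is that of a single summand with chain rule factor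
  \<open>2 / h\<close>, whatever \<open>N\<close> is. Unlike a polygon, the path is differentiable
  at the grid times too.\<close>

lemma smooth_interpolation:
  assumes B: "\<And>x. \<bar>smoothstep 0 x\<bar> \<le> B" "\<And>x. \<bar>smoothstep 1 x\<bar> \<le> B"
    and h: "h > 0" and d: "\<And>k. k < N \<Longrightarrow> norm (p (Suc k) - p k) \<le> d" and d0: "0 \<le> d"
  shows "\<exists>\<gamma> :: real \<Rightarrow> 'a::euclidean_space.
    (\<forall>s. \<exists>v. (\<gamma> has_vector_derivative v) (at s) \<and> norm v \<le> 2 / h * B * d) \<and>
    (\<forall>k<N. \<forall>t\<in>{t0 + real k * h..t0 + real (Suc k) * h}. norm (\<gamma> t - p k) \<le> B * d)"
proof -
  have B0: "0 \<le> B" using B(1)[of 0] by linarith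
  define a where "a k t = 2 * (t - t0 - real k * h) / h - 3" for k t
  define \<gamma> where "\<gamma> t = p 0 + (\<Sum>k<N. smoothstep 0 (a k t) *\<^sub>R (p (Suc k) - p k))" for t
  have da: "((\<lambda>t. smoothstep 0 (a k t)) has_real_derivative smoothstep 1 (a k t) * (2 / h)) (at t)" for k t
  proof -
    have "(a k has_real_derivative 2 / h) (at t)"
      unfolding a_def using h by (auto intro!: derivative_eq_intros simp: field_simps)
    from DERIV_chain2[OF smoothstep_has_derivative[of 0] this] show ?thesis by simp
  qed
  have d\<gamma>: "(\<gamma> has_vector_derivative (\<Sum>k<N. (smoothstep 1 (a k t) * (2 / h)) *\<^sub>R (p (Suc k) - p k))) (at t)" for t
  proof -
    have "((\<lambda>t. p 0 + (\<Sum>k<N. smoothstep 0 (a k t) *\<^sub>R (p (Suc k) - p k))) has_vector_derivative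
        0 + (\<Sum>k<N. smoothstep 0 (a k t) *\<^sub>R 0 + (smoothstep 1 (a k t) * (2 / h)) *\<^sub>R (p (Suc k) - p k))) (at t)"
      by (intro has_vector_derivative_add has_vector_derivative_const has_vector_derivative_sum
          has_vector_derivative_scaleR da)
    then show ?thesis by (simp add: \<gamma>_def[abs_def])
  qed
  have left: "a j t \<le> -3" if "t \<le> t0 + real j * h" for j t
    using that h by (simp add: a_def field_simps)
  have right: "a j t \<ge> -1" if "t \<ge> t0 + real (Suc j) * h" for j t
    using that h by (simp add: a_def field_simps)
  have mono: "real i * h \<le> real j * h" if "i \<le> j" for i j
    using that h by simp
  show ?thesis
  proof (intro exI[of _ \<gamma>] conjI allI impI ballI)
    fix s
    define v where "v = (\<Sum>k<N. (smoothstep 1 (a k s) * (2 / h)) *\<^sub>R (p (Suc k) - p k))"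
    have "norm v \<le> 2 / h * B * d"
    proof (cases "\<exists>k<N. t0 + real k * h < s \<and> s < t0 + real (Suc k) * h")
      case True
      then obtain k where k: "k < N" "t0 + real k * h < s" "s < t0 + real (Suc k) * h" by blast
      have "smoothstep 1 (a j s) = 0" if "j \<noteq> k" for j
      proof (cases "j < k")
        case True
        then show ?thesis using right[of j s] mono[of "Suc j" k] k by (intro trans[OF smoothstep_right]) auto
      next
        case False
        then show ?thesis using left[of s j] mono[of "Suc k" j] k that by (intro smoothstep_left) auto
      qed
      then have "v = (smoothstep 1 (a k s) * (2 / h)) *\<^sub>R (p (Suc k) - p k)"
        unfolding v_def using k(1) by (subst sum.remove[of _ k]) auto
      then have "norm v = \<bar>smoothstep 1 (a k s)\<bar> * (2 / h) * norm (p (Suc k) - p k)"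
        using h by (simp add: abs_mult)
      also have "\<dots> \<le> B * (2 / h) * d"
        using h d[OF k(1)] B B0 by (intro mult_mono) auto
      finally show ?thesis by (simp add: mult_ac)
    next
      case False
      have "smoothstep 1 (a k s) = 0" if "k < N" for k
      proof (cases "s \<le> t0 + real k * h")
        case True
        then show ?thesis using left by (intro smoothstep_left) auto
      next
        case F: False
        then have "t0 + real k * h < s" by simp
        then have "\<not> s < t0 + real (Suc k) * h" using False that by blast
        then have "s \<ge> t0 + real (Suc k) * h" by simp
        then show ?thesis using right[of k s] smoothstep_right[of "a k s" 1] by simp
      qed
      then have "v = 0" unfolding v_def by (intro sum.neutral) simp
      then show ?thesis using h B0 d0 by simp
    qed
    then show "\<exists>v. (\<gamma> has_vector_derivative v) (at s) \<and> norm v \<le> 2 / h * B * d"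
      using d\<gamma>[of s] by (auto simp: v_def)
  next
    fix k t assume k: "k < N" and t: "t \<in> {t0 + real k * h..t0 + real (Suc k) * h}"
    have "smoothstep 0 (a j t) = (if j < k then 1 else 0)" if "j \<noteq> k" for j
    proof (cases "j < k")
      case True
      then show ?thesis using right[of j t] mono[of "Suc j" k] t smoothstep_right[of "a j t" 0] by auto
    next
      case False
      then show ?thesis using left[of t j] mono[of "Suc k" j] t that smoothstep_left[of 0 "a j t"] by auto
    qed
    then have "(\<Sum>j\<in>{..<N} - {k}. smoothstep 0 (a j t) *\<^sub>R (p (Suc j) - p j)) =
        (\<Sum>j\<in>{..<N} - {k}. if j < k then p (Suc j) - p j else 0)"
      by (intro sum.cong) auto
    also have "\<dots> = (\<Sum>j<k. p (Suc j) - p j)"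
      using k by (intro sum.mono_neutral_cong_right) auto
    also have "\<dots> = p k - p 0" by (rule sum_lessThan_telescope)
    finally have "\<gamma> t - p k = smoothstep 0 (a k t) *\<^sub>R (p (Suc k) - p k)"
      unfolding \<gamma>_def using k by (subst sum.remove[of _ k]) auto
    then have "norm (\<gamma> t - p k) = \<bar>smoothstep 0 (a k t)\<bar> * norm (p (Suc k) - p k)" by simp
    also have "\<dots> \<le> B * d" using d[OF k] B B0 by (intro mult_mono) auto
    finally show "norm (\<gamma> t - p k) \<le> B * d" .
  qed
qed

section \<open>Tiling of space by unit cells\<close>

lemma lattice_countable: "countable (lattice :: 'a::euclidean_space set)"
proof (rule countable_subset)
  show "lattice \<subseteq> (\<lambda>h :: 'a \<Rightarrow> int. \<Sum>b\<in>Basis. of_int (h b) *\<^sub>R b) ` PiE Basis (\<lambda>_. UNIV)"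
  proof
    fix z :: 'a assume z: "z \<in> lattice"
    define e where "e = restrict (\<lambda>b. \<lfloor>z \<bullet> b\<rfloor>) Basis"
    have "of_int (e b) = z \<bullet> b" if "b \<in> Basis" for b
      using z that by (auto simp: e_def lattice_def elim!: Ints_cases)
    then have "z = (\<Sum>b\<in>Basis. of_int (e b) *\<^sub>R b)"
      by (simp add: euclidean_representation)
    moreover have "e \<in> PiE Basis (\<lambda>_. UNIV)" by (auto simp: e_def)
    ultimately show "z \<in> (\<lambda>h. \<Sum>b\<in>Basis. of_int (h b) *\<^sub>R b) ` PiE Basis (\<lambda>_. UNIV)" by blast
  qed
  show "countable ((\<lambda>h :: 'a \<Rightarrow> int. \<Sum>b\<in>Basis. of_int (h b) *\<^sub>R b) ` PiE Basis (\<lambda>_. UNIV))"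
    by (intro countable_image countable_PiE) auto
qed

lemma lattice_infinite: "infinite (lattice :: 'a::euclidean_space set)"
proof
  assume fin: "finite (lattice :: 'a set)"
  obtain b :: 'a where b: "b \<in> Basis" using nonempty_Basis by blast
  have "inj (\<lambda>k::int. of_int k *\<^sub>R b)" using b nonzero_Basis by (auto simp: inj_on_def)
  moreover have "range (\<lambda>k::int. of_int k *\<^sub>R b) \<subseteq> lattice" using lattice_scaleR_Basis[OF b] by auto
  ultimately have "finite (UNIV :: int set)" using fin by (meson finite_subset inj_on_finite finite_imageD)
  then show False by simp
qed

definition lattice_floor :: "'a::euclidean_space \<Rightarrow> 'a" where
  "lattice_floor x = (\<Sum>b\<in>Basis. of_int \<lfloor>x \<bullet> b\<rfloor> *\<^sub>R b)"

lemma lattice_floor_inner: "b \<in> Basis \<Longrightarrow> lattice_floor x \<bullet> b = of_int \<lfloor>x \<bullet> b\<rfloor>"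
  by (simp add: lattice_floor_def)

lemma lattice_floor_in: "lattice_floor x \<in> lattice"
  by (simp add: lattice_def lattice_floor_inner)

definition unit_cell :: "'a::euclidean_space set" where
  "unit_cell = {x. \<forall>b\<in>Basis. 0 \<le> x \<bullet> b \<and> x \<bullet> b < 1}"

lemma mem_unit_cell_shift:
  assumes "n \<in> lattice"
  shows "x - n \<in> unit_cell \<longleftrightarrow> n = lattice_floor x"
proof
  assume c: "x - n \<in> unit_cell"
  show "n = lattice_floor x"
  proof (rule euclidean_eqI)
    fix b :: 'a assume b: "b \<in> Basis"
    then obtain k where k: "n \<bullet> b = of_int k" using assms by (auto simp: lattice_def elim: Ints_cases)
    have "0 \<le> x \<bullet> b - of_int k" "x \<bullet> b - of_int k < 1"
      using c b k by (auto simp: unit_cell_def inner_diff_left)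
    then have "\<lfloor>x \<bullet> b\<rfloor> = k" by linarith
    then show "n \<bullet> b = lattice_floor x \<bullet> b" using b k by (simp add: lattice_floor_inner)
  qed
next
  assume "n = lattice_floor x"
  then show "x - n \<in> unit_cell"
    by (auto simp: unit_cell_def inner_diff_left lattice_floor_inner) linarith
qed

lemma unit_cell_measurable: "unit_cell \<in> sets borel"
  unfolding unit_cell_def by measurable

lemma emeasure_unit_cell: "emeasure lborel (unit_cell :: 'a::euclidean_space set) = 1"
proof (rule antisym)
  have "emeasure lborel (unit_cell :: 'a set) \<le> emeasure lborel (cbox 0 One :: 'a set)"
    by (rule emeasure_mono) (auto simp: unit_cell_def mem_box less_imp_le)
  also have "\<dots> = 1" by (subst emeasure_lborel_cbox) auto
  finally show "emeasure lborel (unit_cell :: 'a set) \<le> 1" .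
  have "1 = emeasure lborel (box 0 One :: 'a set)" by (subst emeasure_lborel_box) auto
  also have "\<dots> \<le> emeasure lborel (unit_cell :: 'a set)"
    by (rule emeasure_mono) (auto simp: unit_cell_def mem_box less_imp_le unit_cell_measurable[unfolded unit_cell_def])
  finally show "1 \<le> emeasure lborel (unit_cell :: 'a set)" .
qed

text \<open>Each point lies in exactly one translate of the half-open cell; translating the pieces
  back to the cell collects them into a lattice sum. This is the bridge from lattice sums to
  integrals over space.\<close>

lemma nn_integral_tiling:
  fixes f :: "'a::euclidean_space \<Rightarrow> ennreal"
  assumes [measurable]: "f \<in> borel_measurable borel"
    and e: "bij_betw e (UNIV :: nat set) (lattice :: 'a set)"
  shows "(\<integral>\<^sup>+x. f x \<partial>lborel) = (\<integral>\<^sup>+y. indicator unit_cell y * (\<Sum>i. f (e i + y)) \<partial>lborel)"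
proof -
  have [measurable]: "unit_cell \<in> sets (borel :: 'a measure)" by (rule unit_cell_measurable)
  have "f x = (\<Sum>i. indicator unit_cell (x - e i) * f x)" for x
  proof -
    obtain j where j: "e j = lattice_floor x"
      using e lattice_floor_in[of x] unfolding bij_betw_def by (metis imageE)
    have "indicator unit_cell (x - e i) * f x = (if i = j then f x else 0)" for i
    proof -
      have "e i \<in> lattice" using e by (auto simp: bij_betw_def)
      moreover have "e i = e j \<longleftrightarrow> i = j" using e by (auto simp: bij_betw_def inj_eq)
      ultimately show ?thesis using mem_unit_cell_shift[of "e i" x] j by (auto simp: indicator_def)
    qed
    then show ?thesis using sums_single[of j "\<lambda>_. f x"] by (simp add: sums_iff)
  qed
  then have "(\<integral>\<^sup>+x. f x \<partial>lborel) = (\<integral>\<^sup>+x. (\<Sum>i. indicator unit_cell (x - e i) * f x) \<partial>lborel)"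
    by simp
  also have "\<dots> = (\<Sum>i. \<integral>\<^sup>+x. indicator unit_cell (x - e i) * f x \<partial>lborel)"
    by (rule nn_integral_suminf) measurable
  also have "\<dots> = (\<Sum>i. \<integral>\<^sup>+y. indicator unit_cell y * f (e i + y) \<partial>lborel)"
  proof (rule suminf_cong)
    fix i
    have "(\<integral>\<^sup>+x. indicator unit_cell (x - e i) * f x \<partial>lborel) =
        (\<integral>\<^sup>+x. indicator unit_cell (x - e i) * f x \<partial>distr lborel borel ((+) (e i)))"
      by (simp add: lborel_distr_plus)
    also have "\<dots> = (\<integral>\<^sup>+y. indicator unit_cell y * f (e i + y) \<partial>lborel)"
      by (subst nn_integral_distr) auto
    finally show "(\<integral>\<^sup>+x. indicator unit_cell (x - e i) * f x \<partial>lborel) =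
        (\<integral>\<^sup>+y. indicator unit_cell y * f (e i + y) \<partial>lborel)" .
  qed
  also have "\<dots> = (\<integral>\<^sup>+y. (\<Sum>i. indicator unit_cell y * f (e i + y)) \<partial>lborel)"
    by (rule nn_integral_suminf[symmetric]) measurable
  also have "\<dots> = (\<integral>\<^sup>+y. indicator unit_cell y * (\<Sum>i. f (e i + y)) \<partial>lborel)"
    by simp
  finally show ?thesis .
qed
section \<open>Domination by tubes\<close>

lemma pmf_nat_sums:
  fixes E :: "nat pmf"
  shows "(\<lambda>i. pmf E i * indicator X i) sums measure_pmf.prob E X"
proof -
  have "(\<lambda>i. measure_pmf.prob E ({i} \<inter> X)) sums measure_pmf.prob E (\<Union>i. {i} \<inter> X)"
    by (rule measure_pmf.finite_measure_UNION) (auto simp: disjoint_family_on_def)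
  moreover have "measure_pmf.prob E ({i} \<inter> X) = pmf E i * indicator X i" for i
    by (cases "i \<in> X") (auto simp: measure_pmf_single)
  moreover have "(\<Union>i. {i} \<inter> X) = X" by auto
  ultimately show ?thesis by simp
qed

lemma cmod_cis_diff_le: "cmod (cis a - cis b) \<le> \<bar>a - b\<bar>"
proof -
  have "cis a - cis b = cis b * (cis (a - b) - 1)" by (simp add: right_diff_distrib cis_mult)
  then have "cmod (cis a - cis b) = cmod (cis (a - b) - 1)" by (simp add: norm_mult)
  then show ?thesis using cmod_cis_minus_1_le by simp
qed

lemma norm_diff_lattice_floor_le: "norm (x - lattice_floor (x :: 'a::euclidean_space)) \<le> DIM('a)"
proof -
  have "norm (x - lattice_floor x) \<le> (\<Sum>b\<in>Basis. \<bar>(x - lattice_floor x) \<bullet> b\<bar>)" by (rule norm_le_l1)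
  also have "\<dots> \<le> (\<Sum>b\<in>(Basis :: 'a set). 1)"
    by (intro sum_mono) (auto simp: inner_diff_left lattice_floor_inner abs_le_iff, linarith+)
  finally show ?thesis by simp
qed

context schrodinger_datum
begin

text \<open>The shift is carried out one coordinate direction at a time, in space and in the time
  belonging to that direction, at the price of one factor \<open>H\<close> each.\<close>

lemma rho_multi_shift_le:
  "\<exists>H\<ge>1. \<forall>y s x \<tau>. (\<forall>b\<in>Basis. \<bar>y \<bullet> b\<bar> \<le> 1) \<longrightarrow> \<bar>s\<bar> \<le> 1 \<longrightarrow>
     rho (\<tau> + s *\<^sub>R One) (x + y) \<le> H * rho \<tau> x"
proof -
  obtain H where H: "H \<ge> 1" "\<And>b y s x \<tau>. b \<in> Basis \<Longrightarrow> \<bar>y\<bar> \<le> 1 \<Longrightarrow> \<bar>s\<bar> \<le> 1 \<Longrightarrow>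
     rho (\<tau> + s *\<^sub>R b) (x + y *\<^sub>R b) \<le> H * rho \<tau> x"
    using rho_shift_le by blast
  show ?thesis
  proof (intro exI[of _ "H ^ DIM('a)"] conjI allI impI)
    show "1 \<le> H ^ DIM('a)" using H by simp
    fix y x \<tau> :: 'a and s :: real assume y: "\<forall>b\<in>Basis. \<bar>y \<bullet> b\<bar> \<le> 1" and s: "\<bar>s\<bar> \<le> 1"
    have "rho (\<tau> + (\<Sum>b\<in>A. s *\<^sub>R b)) (x + (\<Sum>b\<in>A. (y \<bullet> b) *\<^sub>R b)) \<le> H ^ card A * rho \<tau> x"
      if "finite A" "A \<subseteq> Basis" for A
      using that
    proof (induction A)
      case (insert a A)
      have "rho (\<tau> + (\<Sum>b\<in>insert a A. s *\<^sub>R b)) (x + (\<Sum>b\<in>insert a A. (y \<bullet> b) *\<^sub>R b)) =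
         rho (\<tau> + (\<Sum>b\<in>A. s *\<^sub>R b) + s *\<^sub>R a) (x + (\<Sum>b\<in>A. (y \<bullet> b) *\<^sub>R b) + (y \<bullet> a) *\<^sub>R a)"
        using insert by (simp add: algebra_simps)
      also have "\<dots> \<le> H * rho (\<tau> + (\<Sum>b\<in>A. s *\<^sub>R b)) (x + (\<Sum>b\<in>A. (y \<bullet> b) *\<^sub>R b))"
        using insert y s by (intro H) auto
      also have "\<dots> \<le> H * (H ^ card A * rho \<tau> x)"
        using insert H by (intro mult_left_mono) auto
      finally show ?case using insert by (simp add: mult.assoc)
    qed simp
    from this[of Basis] show "rho (\<tau> + s *\<^sub>R One) (x + y) \<le> H ^ DIM('a) * rho \<tau> x"
      by (simp add: euclidean_representation scaleR_sum_right)
  qed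
qed

text \<open>One flux step for each coordinate direction, each moving mass by at most 1, adds up to a
  displacement of at most the dimension. The step \<open>h\<close> serves all times and laws, which
  is why the speed limit does not depend on the time horizon.\<close>

lemma lattice_law_step:
  "\<exists>h>0. h \<le> 1 \<and> (\<forall>m \<tau> \<mu>. m > 0 \<longrightarrow> lattice_law m (rho \<tau>) \<mu> \<longrightarrow>
     (\<exists>\<mu>'. lattice_law m (rho (\<tau> + h *\<^sub>R One)) \<mu>' \<and> rel_pmf (\<lambda>x y. norm (x - y) \<le> DIM('a)) \<mu> \<mu>'))"
proof -
  obtain H where H: "H \<ge> 1" "\<And>b y s x \<tau>. b \<in> Basis \<Longrightarrow> \<bar>y\<bar> \<le> 1 \<Longrightarrow> \<bar>s\<bar> \<le> 1 \<Longrightarrow>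
     rho (\<tau> + s *\<^sub>R b) (x + y *\<^sub>R b) \<le> H * rho \<tau> x"
    using rho_shift_le by blast
  obtain K where K: "K > 0" "\<And>h b \<tau>. 0 \<le> h \<Longrightarrow> h \<le> 1 \<Longrightarrow> b \<in> Basis \<Longrightarrow>
    (\<exists>G. \<forall>x. rho (\<tau> + h *\<^sub>R b) x - rho \<tau> x = G x - G (x - b) \<and> \<bar>G x\<bar> \<le> K * h * rho \<tau> x)"
    using rho_flux by blast
  \<comment> \<open>This makes \<open>K * h * H \<le> 1 / 2\<close>: the flux is at most half the
    density at \<open>x\<close>, and still so after the Harnack factor \<open>H\<close> for passing
    to \<open>x + b\<close>.\<close>
  define h where "h = min 1 (1 / (2 * K * H))"
  have h: "h > 0" "h \<le> 1" using K H by (auto simp: h_def)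
  have "h \<le> 1 / (2 * K * H)" by (simp add: h_def)
  then have KhH: "K * h * H \<le> 1 / 2" using K H by (simp add: field_simps)
  have Kh: "K * h \<le> 1 / 2"
  proof -
    have "K * h * 1 \<le> K * h * H" using K(1) h H(1) by (intro mult_left_mono) auto
    with KhH show ?thesis by simp
  qed
  have axis: "\<exists>\<mu>'. lattice_law m (rho (\<tau> + h *\<^sub>R b)) \<mu>' \<and> rel_pmf (\<lambda>x y. norm (x - y) \<le> 1) \<mu> \<mu>'"
    if m: "m > 0" and \<mu>: "lattice_law m (rho \<tau>) \<mu>" and b: "b \<in> Basis" for m \<tau> \<mu> b
  proof -
    obtain G where G: "\<And>x. rho (\<tau> + h *\<^sub>R b) x - rho \<tau> x = G x - G (x - b)"
      "\<And>x. \<bar>G x\<bar> \<le> K * h * rho \<tau> x"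
      using K(2)[of h b \<tau>] h b by auto
    show ?thesis
    proof (rule lattice_law_flux_step[OF \<mu> m b G(1)])
      fix x
      have "K * h * rho \<tau> x \<le> 1 / 2 * rho \<tau> x"
        by (intro mult_right_mono Kh rho_nonneg)
      then show "\<bar>G x\<bar> \<le> rho \<tau> x / 2" using G(2)[of x] by simp
      have "K * h * rho \<tau> x \<le> K * h * (H * rho \<tau> (x + b))"
        using H(2)[OF b, of "-1" 0 \<tau> "x + b"] K h by (intro mult_left_mono) auto
      also have "\<dots> = K * h * H * rho \<tau> (x + b)" by simp
      also have "\<dots> \<le> 1 / 2 * rho \<tau> (x + b)" by (intro mult_right_mono KhH rho_nonneg)
      finally show "\<bar>G x\<bar> \<le> rho \<tau> (x + b) / 2" using G(2)[of x] by simp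
    qed
  qed
  have all: "\<exists>\<mu>'. lattice_law m (rho (\<tau> + (\<Sum>b\<in>A. h *\<^sub>R b))) \<mu>' \<and> rel_pmf (\<lambda>x y. norm (x - y) \<le> real (card A)) \<mu> \<mu>'"
    if m: "m > 0" and \<mu>: "lattice_law m (rho \<tau>) \<mu>" and "finite A" "A \<subseteq> Basis" for m \<tau> \<mu> A
    using that(3,4)
  proof (induction A)
    case empty
    show ?case using \<mu> by (auto intro!: exI[of _ \<mu>] rel_pmf_reflI)
  next
    case (insert a A)
    then obtain \<mu>1 where \<mu>1: "lattice_law m (rho (\<tau> + (\<Sum>b\<in>A. h *\<^sub>R b))) \<mu>1"
      "rel_pmf (\<lambda>x y. norm (x - y) \<le> real (card A)) \<mu> \<mu>1" by auto
    obtain \<mu>2 where \<mu>2: "lattice_law m (rho (\<tau> + (\<Sum>b\<in>A. h *\<^sub>R b) + h *\<^sub>R a)) \<mu>2"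
      "rel_pmf (\<lambda>x y. norm (x - y) \<le> 1) \<mu>1 \<mu>2"
      using axis[OF m \<mu>1(1), of a] insert by auto
    have "rel_pmf (\<lambda>x y. norm (x - y) \<le> real (card (insert a A))) \<mu> \<mu>2"
    proof (rule pmf.rel_mono_strong[OF rel_pmf_trans[OF \<mu>1(2) \<mu>2(2)]])
      fix x z assume "((\<lambda>x y. norm (x - y) \<le> real (card A)) OO (\<lambda>x y. norm (x - y) \<le> 1)) x z"
      then obtain y where "norm (x - y) \<le> real (card A)" "norm (y - z) \<le> 1" by auto
      then show "norm (x - z) \<le> real (card (insert a A))"
        using insert norm_triangle_ineq[of "x - y" "y - z"] by simp
    qed
    moreover have eq: "\<tau> + (\<Sum>b\<in>insert a A. h *\<^sub>R b) = \<tau> + (\<Sum>b\<in>A. h *\<^sub>R b) + h *\<^sub>R a"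
      using insert by (simp add: algebra_simps)
    ultimately show ?case using \<mu>2(1) unfolding eq by blast
  qed
  show ?thesis
  proof (intro exI[of _ h] conjI allI impI h)
    fix m \<tau> \<mu> assume "(m::real) > 0" "lattice_law m (rho \<tau>) \<mu>"
    from all[OF this, of Basis]
    show "\<exists>\<mu>'. lattice_law m (rho (\<tau> + h *\<^sub>R One)) \<mu>' \<and> rel_pmf (\<lambda>x y. norm (x - y) \<le> DIM('a)) \<mu> \<mu>'"
      by (simp add: scaleR_sum_right)
  qed
qed

section \<open>Comparison of lattice sums with the integral over space\<close>

lemma wave_density_summable: "(\<lambda>n. wave_density \<tau> (y + n)) summable_on lattice"
  by (rule nonneg_bdd_above_summable_on)
     (auto intro!: bdd_aboveI2 wave_density_lattice_sum_le wave_density_nonneg)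

text \<open>After exchanging the finite sum with the average, the inner sum for each
  \<open>z\<close> runs over points of the coset \<open>y + lattice\<close>, so it is at most the
  full coset sum whatever \<open>z\<close> is.\<close>

lemma rho_lattice_sum_le:
  assumes F: "finite F" "F \<subseteq> lattice"
  shows "(\<Sum>n\<in>F. rho \<tau> (n + y)) \<le> Phi_mass TYPE('a) * (\<Sum>\<^sub>\<infinity>n\<in>lattice. wave_density \<tau> (y + n))"
proof -
  obtain B where B: "\<And>x \<tau>. \<bar>wave_density \<tau> x\<bar> \<le> B" using wave_density_bounded by blast
  define S where "S = (\<Sum>\<^sub>\<infinity>n\<in>lattice. wave_density \<tau> (y + n))"
  have s: "(\<lambda>z. Phi z * wave_density \<tau> (x + z)) summable_on lattice" for x
    by (rule smooth_summable) (rule B)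
  have s2: "(\<lambda>z. Phi z * S) summable_on (lattice :: 'a set)"
    by (intro summable_on_cmult_left Phi_summable)
  have eq: "(\<Sum>n\<in>F. Phi z * wave_density \<tau> (n + y + z)) = Phi z * (\<Sum>n\<in>F. wave_density \<tau> (n + y + z))" for z
    by (simp add: sum_distrib_left)
  have "((\<lambda>z. \<Sum>n\<in>F. Phi z * wave_density \<tau> (n + y + z)) has_sum (\<Sum>n\<in>F. rho \<tau> (n + y))) lattice"
    unfolding rho_def smooth_def
  proof (use F(1) in \<open>induction F\<close>)
    case (insert a F)
    then show ?case by (simp, intro has_sum_add has_sum_infsum s)
  qed simp
  then have "(\<Sum>n\<in>F. rho \<tau> (n + y)) \<le> (\<Sum>\<^sub>\<infinity>z\<in>(lattice :: 'a set). Phi z * S)"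
  proof (rule has_sum_mono[OF _ has_sum_infsum[OF s2]])
    fix z :: 'a assume z: "z \<in> lattice"
    have "(\<Sum>n\<in>F. wave_density \<tau> (n + y + z)) = (\<Sum>n\<in>(\<lambda>n. n + z) ` F. wave_density \<tau> (y + n))"
      by (subst sum.reindex) (auto simp: inj_on_def algebra_simps)
    also have "\<dots> \<le> S"
      unfolding S_def using F z
      by (intro finite_sum_le_infsum wave_density_summable) (auto intro: lattice_add wave_density_nonneg)
    finally show "(\<Sum>n\<in>F. Phi z * wave_density \<tau> (n + y + z)) \<le> Phi z * S"
      unfolding eq by (intro mult_left_mono Phi_nonneg)
  qed
  also have "\<dots> = Phi_mass TYPE('a) * S" by (simp add: infsum_cmult_left' Phi_mass_def)
  finally show ?thesis by (simp add: S_def)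
qed

lemma rho_summable: "rho \<tau> summable_on lattice"
proof (rule nonneg_bdd_above_summable_on)
  show "bdd_above (sum (rho \<tau>) ` {F. F \<subseteq> lattice \<and> finite F})"
    using rho_lattice_sum_le[of _ \<tau> 0] by (intro bdd_aboveI2) auto
qed (rule rho_nonneg)

text \<open>The wave is Lipschitz in space because the frequencies have norm at most 1 and
  \<open>g\<close> is integrable. This supplies the Borel measurability for integrating over the
  unit cell.\<close>

lemma continuous_wave_density: "continuous_on UNIV (wave_density \<tau>)"
proof -
  define c where "c = 1 / (2 * pi) ^ DIM('a)"
  define I where "I = integral\<^sup>L lebesgue (\<lambda>\<xi>. cmod (g \<xi>))"
  have c: "c \<ge> 0" by (simp add: c_def)
  have lip: "cmod (wave x \<tau> - wave y \<tau>) \<le> c * (norm (x - y) * I)" for x y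
  proof -
    have "wave x \<tau> - wave y \<tau> = of_real c *
        integral\<^sup>L lebesgue (\<lambda>\<xi>. g \<xi> * (cis (wave_phase \<xi> x \<tau>) - cis (wave_phase \<xi> y \<tau>)))"
      by (simp add: wave_def fourier_integral_def c_def wave_integrable right_diff_distrib)
    also have "cmod \<dots> \<le> c * integral\<^sup>L lebesgue (\<lambda>\<xi>. norm (x - y) * cmod (g \<xi>))"
      unfolding norm_mult
    proof (intro mult_mono)
      have int: "integrable lebesgue (\<lambda>\<xi>. g \<xi> * (cis (wave_phase \<xi> x \<tau>) - cis (wave_phase \<xi> y \<tau>)))"
        by (simp add: right_diff_distrib wave_integrable)
      have "cmod (integral\<^sup>L lebesgue (\<lambda>\<xi>. g \<xi> * (cis (wave_phase \<xi> x \<tau>) - cis (wave_phase \<xi> y \<tau>))))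
         \<le> integral\<^sup>L lebesgue (\<lambda>\<xi>. cmod (g \<xi> * (cis (wave_phase \<xi> x \<tau>) - cis (wave_phase \<xi> y \<tau>))))"
        by (rule integral_norm_bound)
      also have "\<dots> \<le> integral\<^sup>L lebesgue (\<lambda>\<xi>. norm (x - y) * cmod (g \<xi>))"
      proof (rule integral_mono)
        show "integrable lebesgue (\<lambda>\<xi>. cmod (g \<xi> * (cis (wave_phase \<xi> x \<tau>) - cis (wave_phase \<xi> y \<tau>))))"
          using int by (rule integrable_norm)
        show "integrable lebesgue (\<lambda>\<xi>. norm (x - y) * cmod (g \<xi>))"
          using g_integrable by simp
        fix \<xi>
        show "cmod (g \<xi> * (cis (wave_phase \<xi> x \<tau>) - cis (wave_phase \<xi> y \<tau>))) \<le> norm (x - y) * cmod (g \<xi>)"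
        proof (cases "norm \<xi> \<le> 1")
          case True
          have "cmod (cis (wave_phase \<xi> x \<tau>) - cis (wave_phase \<xi> y \<tau>)) \<le> \<bar>\<xi> \<bullet> (x - y)\<bar>"
            by (rule order_trans[OF cmod_cis_diff_le]) (simp add: wave_phase_def inner_diff_right)
          also have "\<dots> \<le> norm \<xi> * norm (x - y)" by (rule Cauchy_Schwarz_ineq2)
          also have "\<dots> \<le> 1 * norm (x - y)" using True by (intro mult_right_mono) auto
          finally have "cmod (cis (wave_phase \<xi> x \<tau>) - cis (wave_phase \<xi> y \<tau>)) \<le> norm (x - y)" by simp
          then show ?thesis by (simp add: norm_mult mult.commute[of _ "cmod (g \<xi>)"] mult_left_mono)
        next
          case False
          then have "g \<xi> = 0" by (intro g_support) simp
          then show ?thesis by simp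
        qed
      qed
      finally show "cmod (integral\<^sup>L lebesgue (\<lambda>\<xi>. g \<xi> * (cis (wave_phase \<xi> x \<tau>) - cis (wave_phase \<xi> y \<tau>))))
         \<le> integral\<^sup>L lebesgue (\<lambda>\<xi>. norm (x - y) * cmod (g \<xi>))" .
    qed (use c in auto)
    also have "\<dots> = c * (norm (x - y) * I)" by (simp add: I_def)
    finally show ?thesis .
  qed
  have "(c * I)-lipschitz_on UNIV (\<lambda>x. wave x \<tau>)"
  proof (rule lipschitz_onI)
    show "0 \<le> c * I" using c by (auto simp: I_def)
    show "dist (wave x \<tau>) (wave y \<tau>) \<le> c * I * dist x y" for x y
      using lip[of x y] by (simp add: dist_norm mult_ac)
  qed
  from lipschitz_on_continuous_on[OF this] have "continuous_on UNIV (\<lambda>x. wave x \<tau>)" .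
  then show ?thesis unfolding wave_density_def[abs_def] by (intro continuous_intros)
qed

text \<open>The Harnack inequality replaces each lattice point \<open>n\<close> by
  \<open>n + y\<close> for an arbitrary \<open>y\<close> in the unit cell, which bounds the sum by a
  multiple of the coset sum \<open>S y\<close>. Integrating over the cell, of volume 1, and tiling
  turn \<open>S\<close> into the integral of the density. The summand 1 in \<open>P\<close>
  guarantees positivity.\<close>

lemma rho_mass_le:
  "\<exists>C>0. \<forall>F. finite F \<longrightarrow> F \<subseteq> lattice \<longrightarrow>
     sum (rho \<tau>) F \<le> C * integral\<^sup>L lebesgue (wave_density \<tau>)"
proof -
  obtain H where H: "H \<ge> 1" "\<And>y s x \<tau>. (\<forall>b\<in>Basis. \<bar>y \<bullet> b\<bar> \<le> 1) \<Longrightarrow> \<bar>s\<bar> \<le> 1 \<Longrightarrow>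
     rho (\<tau> + s *\<^sub>R One) (x + y) \<le> H * rho \<tau> x"
    using rho_multi_shift_le by blast
  define P where "P = H * (Phi_mass TYPE('a) + 1)"
  have P: "P > 0" using H Phi_mass_nonneg[where 'a='a] by (simp add: P_def)
  define e where "e = from_nat_into (lattice :: 'a set)"
  have e: "bij_betw e UNIV lattice"
    unfolding e_def by (rule bij_betw_from_nat_into[OF lattice_countable lattice_infinite])
  define S where "S y = (\<Sum>\<^sub>\<infinity>n\<in>lattice. wave_density \<tau> (y + n))" for y
  define B where "B = integral\<^sup>L lebesgue (\<lambda>\<xi>. (cmod (g \<xi>))\<^sup>2) / (2 * pi) ^ DIM('a)"
  have S0: "0 \<le> S y" for y unfolding S_def by (intro infsum_nonneg wave_density_nonneg)
  have SB: "S y \<le> B" for y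
    unfolding S_def B_def
    by (rule infsum_le_finite_sums[OF wave_density_summable]) (rule wave_density_lattice_sum_le)
  have S_eq: "(\<Sum>i. ennreal (wave_density \<tau> (e i + y))) = ennreal (S y)" for y
  proof -
    have "((\<lambda>n. wave_density \<tau> (y + n)) has_sum S y) lattice"
      unfolding S_def by (rule has_sum_infsum[OF wave_density_summable])
    then have "((\<lambda>i. wave_density \<tau> (y + e i)) has_sum S y) UNIV"
      using has_sum_reindex_bij_betw[OF e, of "\<lambda>n. wave_density \<tau> (y + n)"] by simp
    then have "(\<lambda>i. wave_density \<tau> (e i + y)) sums S y"
      by (auto dest!: has_sum_imp_sums simp: add.commute)
    then have sm: "summable (\<lambda>i. wave_density \<tau> (e i + y))" and eq: "(\<Sum>i. wave_density \<tau> (e i + y)) = S y"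
      by (simp_all only: sums_iff)
    show ?thesis
      using suminf_ennreal2[OF wave_density_nonneg sm] unfolding eq .
  qed
  have [measurable]: "wave_density \<tau> \<in> borel_measurable borel"
    by (rule borel_measurable_continuous_onI[OF continuous_wave_density])
  define I where "I = (\<integral>\<^sup>+x. ennreal (wave_density \<tau> x) \<partial>lborel)"
  have I_eq: "I = (\<integral>\<^sup>+y. indicator unit_cell y * ennreal (S y) \<partial>lborel)"
    unfolding I_def by (subst nn_integral_tiling[OF _ e]) (simp_all add: S_eq)
  have cell: "(\<integral>\<^sup>+y. indicator unit_cell y * ennreal c \<partial>(lborel :: 'a measure)) = ennreal c" for c
    using unit_cell_measurable[where 'a='a]
    by (subst nn_integral_multc) (auto simp: emeasure_unit_cell)
  \<comment> \<open>Finiteness matters: without it the Bochner integral would take its default value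
    0 and could not equal \<open>I\<close>. The Bessel bound for \<open>S\<close> over a cell of
    volume 1 provides it.\<close>
  have "I \<le> (\<integral>\<^sup>+y. indicator unit_cell y * ennreal B \<partial>(lborel :: 'a measure))"
    unfolding I_eq by (intro nn_integral_mono mult_left_mono ennreal_leI SB) simp
  then have I_fin: "I < \<infinity>" unfolding cell by (simp add: order.strict_trans1[OF _ ennreal_less_top])
  have int: "integrable lborel (wave_density \<tau>)"
    using I_fin wave_density_nonneg unfolding I_def by (intro integrableI_nonneg) auto
  have I_int: "I = ennreal (integral\<^sup>L lebesgue (wave_density \<tau>))"
  proof -
    have "I = ennreal (integral\<^sup>L lborel (wave_density \<tau>))"
      unfolding I_def by (rule nn_integral_eq_integral[OF int]) (simp add: wave_density_nonneg)
    then show ?thesis by (simp add: integral_completion)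
  qed
  show ?thesis
  proof (intro exI[of _ P] conjI allI impI P)
    fix F :: "'a set" assume F: "finite F" "F \<subseteq> lattice"
    have le: "sum (rho \<tau>) F \<le> P * S y" if y: "y \<in> unit_cell" for y
    proof -
      have "rho \<tau> n \<le> H * rho \<tau> (n + y)" for n
        using H(2)[of "- y" 0 \<tau> "n + y"] y by (auto simp: unit_cell_def less_imp_le)
      then have "sum (rho \<tau>) F \<le> (\<Sum>n\<in>F. H * rho \<tau> (n + y))" by (intro sum_mono)
      also have "\<dots> = H * (\<Sum>n\<in>F. rho \<tau> (n + y))" by (simp add: sum_distrib_left)
      also have "\<dots> \<le> H * (Phi_mass TYPE('a) * S y)"
        unfolding S_def using H by (intro mult_left_mono rho_lattice_sum_le F) auto
      also have "\<dots> \<le> P * S y"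
        unfolding P_def mult.assoc using H S0 by (intro mult_left_mono mult_right_mono) auto
      finally show ?thesis .
    qed
    have "ennreal (sum (rho \<tau>) F) = (\<integral>\<^sup>+y. indicator unit_cell y * ennreal (sum (rho \<tau>) F) \<partial>(lborel :: 'a measure))"
      by (rule cell[symmetric])
    also have "\<dots> \<le> (\<integral>\<^sup>+y. ennreal P * (indicator unit_cell y * ennreal (S y)) \<partial>lborel)"
    proof (rule nn_integral_mono)
      fix y :: 'a
      show "indicator unit_cell y * ennreal (sum (rho \<tau>) F) \<le> ennreal P * (indicator unit_cell y * ennreal (S y))"
        using le[of y] P S0[of y] by (cases "y \<in> unit_cell") (auto simp: ennreal_mult'[symmetric] intro: ennreal_leI)
    qed
    also have "\<dots> = ennreal P * I"
    proof -
      \<comment> \<open>Rewriting \<open>S\<close> as a series over the enumerated lattice gives its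
        measurability.\<close>
      have "S = (\<lambda>y. enn2real (\<Sum>i. ennreal (wave_density \<tau> (e i + y))))"
        by (simp add: S_eq S0)
      then have "S \<in> borel_measurable borel" by simp
      then show ?thesis
        unfolding I_eq using unit_cell_measurable[where 'a='a] by (subst nn_integral_cmult) auto
    qed
    also have "\<dots> = ennreal (P * integral\<^sup>L lebesgue (wave_density \<tau>))"
      unfolding I_int using P by (simp add: ennreal_mult')
    finally show "sum (rho \<tau>) F \<le> P * integral\<^sup>L lebesgue (wave_density \<tau>)"
      using P by (subst (asm) ennreal_le_iff) (auto intro!: mult_nonneg_nonneg Bochner_Integration.integral_nonneg wave_density_nonneg)
  qed
qed

text \<open>Serves the degenerate case of total mass 0, where no probability law can be formed: the
  Harnack inequality propagates the vanishing from one time step to the next.\<close>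

lemma zero_rho_persists:
  assumes z: "\<And>x. x \<in> lattice \<Longrightarrow> rho \<tau> x = 0" and s: "\<bar>s\<bar> \<le> 1" and y: "\<And>b. b \<in> Basis \<Longrightarrow> \<bar>y \<bullet> b\<bar> \<le> 1"
    and x: "x \<in> lattice"
  shows "rho (\<tau> + s *\<^sub>R One) (x + y) = 0"
proof -
  obtain H where H: "\<And>y s x \<tau>. (\<forall>b\<in>Basis. \<bar>y \<bullet> b\<bar> \<le> 1) \<Longrightarrow> \<bar>s\<bar> \<le> 1 \<Longrightarrow>
     rho (\<tau> + s *\<^sub>R One) (x + y) \<le> H * rho \<tau> x"
    using rho_multi_shift_le by blast
  have "rho (\<tau> + s *\<^sub>R One) (x + y) \<le> H * rho \<tau> x" using H y s by blast
  then show ?thesis using z[OF x] rho_nonneg[of "\<tau> + s *\<^sub>R One" "x + y"] by simp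
qed

section \<open>Assembly of the tubes\<close>

theorem tube_domination:
  "\<exists>r V C. r > 0 \<and> V > 0 \<and> C > 0 \<and>
    (\<forall>R>0. \<exists>(\<gamma> :: nat \<Rightarrow> real \<Rightarrow> 'a) (w :: nat \<Rightarrow> real).
       (\<forall>i s. \<exists>v. (\<gamma> i has_vector_derivative v) (at s) \<and> norm v \<le> V) \<and>
       (\<forall>i. w i \<ge> 0) \<and> summable w \<and>
       (\<forall>x t. t \<in> {-R..R} \<longrightarrow>
          wave_density (t *\<^sub>R One) x \<le> (\<Sum>i. w i * indicator (tube (\<gamma> i) r) (x, t))) \<and>
       (\<Sum>i. r ^ DIM('a) * w i) \<le> C * integral\<^sup>L lebesgue (wave_density 0))"
proof -
  obtain H where H: "H \<ge> 1" "\<And>y s x \<tau>. (\<forall>b\<in>Basis. \<bar>y \<bullet> b\<bar> \<le> 1) \<Longrightarrow> \<bar>s\<bar> \<le> 1 \<Longrightarrow>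
     rho (\<tau> + s *\<^sub>R One) (x + y) \<le> H * rho \<tau> x"
    using rho_multi_shift_le by blast
  obtain h where h: "h > 0" "h \<le> 1" and step: "\<And>m \<tau> \<mu>. m > 0 \<Longrightarrow> lattice_law m (rho \<tau>) \<mu> \<Longrightarrow>
     (\<exists>\<mu>'. lattice_law m (rho (\<tau> + h *\<^sub>R One)) \<mu>' \<and> rel_pmf (\<lambda>x y. norm (x - y) \<le> DIM('a)) \<mu> \<mu>')"
    using lattice_law_step by blast
  obtain B where B: "B > 0" "\<And>x. \<bar>smoothstep 0 x\<bar> \<le> B" "\<And>x. \<bar>smoothstep 1 x\<bar> \<le> B"
    using smoothstep_0_1_bounded by blast
  obtain Cm where Cm: "Cm > 0" "\<And>F. finite F \<Longrightarrow> F \<subseteq> lattice \<Longrightarrow>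
     sum (rho 0) F \<le> Cm * integral\<^sup>L lebesgue (wave_density 0)"
    using rho_mass_le by blast
  define d where "d = real DIM('a)"
  have d: "d > 0" by (simp add: d_def)
  \<comment> \<open>The radius adds the distance \<open>d\<close> from a point to its lattice corner
    and the distance \<open>B * d\<close> from the interpolated path to its lattice position.
    \<open>V\<close> is the speed from \<open>smooth_interpolation\<close>. In \<open>C\<close>,
    \<open>H\<close> accounts for passing to points and times off the grid, \<open>Cm\<close> for
    comparing the lattice mass with the integral.\<close>
  define r V C where "r = (B + 1) * d" and "V = 2 / h * B * d" and "C = r ^ DIM('a) * H * Cm"
  have r: "r > 0" and V: "V > 0" and C: "C > 0"
    using B d h H Cm by (auto simp: r_def V_def C_def)
  have int0: "0 \<le> integral\<^sup>L lebesgue (wave_density 0)" by (intro Bochner_Integration.integral_nonneg wave_density_nonneg)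
  have near: "\<forall>b\<in>Basis. \<bar>(x - lattice_floor x) \<bullet> b\<bar> \<le> 1" for x :: 'a
    by (auto simp: inner_diff_left lattice_floor_inner abs_le_iff) linarith+
  show ?thesis
  proof (rule exI[of _ r], rule exI[of _ V], rule exI[of _ C], intro conjI allI impI r V C)
    fix R :: real assume R: "R > 0"
    \<comment> \<open>The extra step makes \<open>R < N * h\<close> strict, so that even
      \<open>t = R\<close> falls into an interval with index below \<open>2 * N\<close>. Starting at
      \<open>- (N * h)\<close> makes time 0 a grid time, with index \<open>N\<close>.\<close>
    define N where "N = nat \<lceil>R / h\<rceil> + 1"
    have N: "R < real N * h"
    proof -
      have "R / h \<le> real (nat \<lceil>R / h\<rceil>)" by (rule real_nat_ceiling_ge)
      then have "R / h < real N" by (simp add: N_def)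
      then show ?thesis using h by (simp add: field_simps)
    qed
    define t0 where "t0 = - (real N * h)"
    define T where "T k = (t0 + real k * h) *\<^sub>R (One :: 'a)" for k
    have T_Suc: "T (Suc k) = T k + h *\<^sub>R One" for k by (simp add: T_def algebra_simps)
    have T_N: "T N = 0" by (simp add: T_def t0_def)
    have locate: "\<exists>k<2 * N. t \<in> {t0 + real k * h..t0 + real (Suc k) * h}" if "t \<in> {-R..R}" for t
    proof (intro exI conjI)
      define k where "k = nat \<lfloor>(t - t0) / h\<rfloor>"
      have pos: "0 \<le> (t - t0) / h" using that N h by (simp add: t0_def)
      have k: "real k \<le> (t - t0) / h" "(t - t0) / h < real k + 1"
        using pos by (auto simp: k_def of_nat_nat)
      then show "t \<in> {t0 + real k * h..t0 + real (Suc k) * h}" using h by (auto simp: field_simps)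
      have "real k * h \<le> t - t0" using k h by (simp add: field_simps)
      also have "\<dots> < 2 * (real N * h)" using that N unfolding t0_def atLeastAtMost_iff by linarith
      also have "\<dots> = real (2 * N) * h" by simp
      finally show "k < 2 * N" using h by simp
    qed
    have dens: "wave_density (t *\<^sub>R One) x \<le> H * rho (T k) (lattice_floor x)"
      if "t \<in> {t0 + real k * h..t0 + real (Suc k) * h}" for t x k
    proof -
      define s where "s = t - (t0 + real k * h)"
      have s: "\<bar>s\<bar> \<le> 1" using that h by (auto simp: s_def algebra_simps)
      have "wave_density (t *\<^sub>R One) x \<le> rho (T k + s *\<^sub>R One) (lattice_floor x + (x - lattice_floor x))"
        using wave_density_le_rho[of "t *\<^sub>R One" x] by (simp add: T_def s_def algebra_simps)
      also have "\<dots> \<le> H * rho (T k) (lattice_floor x)" by (rule H(2)[OF near s])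
      finally show ?thesis .
    qed
    define m where "m = infsum (rho (T 0)) lattice"
    have "m \<ge> 0" unfolding m_def by (intro infsum_nonneg rho_nonneg)
    then consider "m = 0" | "m > 0" by linarith
    then show "\<exists>(\<gamma> :: nat \<Rightarrow> real \<Rightarrow> 'a) (w :: nat \<Rightarrow> real).
       (\<forall>i s. \<exists>v. (\<gamma> i has_vector_derivative v) (at s) \<and> norm v \<le> V) \<and>
       (\<forall>i. w i \<ge> 0) \<and> summable w \<and>
       (\<forall>x t. t \<in> {-R..R} \<longrightarrow>
          wave_density (t *\<^sub>R One) x \<le> (\<Sum>i. w i * indicator (tube (\<gamma> i) r) (x, t))) \<and>
       (\<Sum>i. r ^ DIM('a) * w i) \<le> C * integral\<^sup>L lebesgue (wave_density 0)"
    proof cases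
      case 1
      have zero: "rho (T k) x = 0" if "x \<in> lattice" for k x
        using that
      proof (induction k arbitrary: x)
        case 0
        show ?case
          by (rule nonneg_infsum_le_0D[OF _ rho_summable rho_nonneg 0]) (use 1 in \<open>simp add: m_def\<close>)
      next
        case (Suc k)
        show ?case using zero_rho_persists[OF Suc.IH, of h 0 x] h Suc.prems by (simp add: T_Suc)
      qed
      have "wave_density (t *\<^sub>R One) x \<le> 0" if "t \<in> {-R..R}" for t x
      proof -
        obtain k where "t \<in> {t0 + real k * h..t0 + real (Suc k) * h}" using locate[OF \<open>t \<in> {-R..R}\<close>] by blast
        from dens[OF this, of x] show ?thesis by (simp add: zero[OF lattice_floor_in])
      qed
      then show ?thesis
        using V C int0
        by (intro exI[of _ "\<lambda>_ _. 0"]) (auto intro!: exI[of _ 0] has_vector_derivative_const)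
    next
      case 2
      obtain \<mu>0 where \<mu>0: "lattice_law m (rho (T 0)) \<mu>0"
        using lattice_law_exists[of "rho (T 0)"] rho_nonneg rho_summable 2 unfolding m_def by blast
      have "\<exists>\<mu>. \<forall>k. lattice_law m (rho (T k)) (\<mu> k) \<and> rel_pmf (\<lambda>x y. norm (x - y) \<le> d) (\<mu> k) (\<mu> (Suc k))"
      proof (rule dependent_nat_choice)
        show "\<exists>\<mu>. lattice_law m (rho (T 0)) \<mu>" using \<mu>0 by blast
        show "\<exists>\<mu>'. lattice_law m (rho (T (Suc k))) \<mu>' \<and> rel_pmf (\<lambda>x y. norm (x - y) \<le> d) \<mu> \<mu>'"
          if "lattice_law m (rho (T k)) \<mu>" for \<mu> k
          using step[OF 2 that] by (simp add: T_Suc d_def)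
      qed
      then obtain \<mu> where \<mu>: "\<And>k. lattice_law m (rho (T k)) (\<mu> k)"
        "\<And>k. rel_pmf (\<lambda>x y. norm (x - y) \<le> d) (\<mu> k) (\<mu> (Suc k))" by blast
      obtain D :: "(nat \<Rightarrow> 'a) pmf" where D: "\<And>k. k \<le> 2 * N \<Longrightarrow> map_pmf (\<lambda>p. p k) D = \<mu> k"
        "\<And>p k. p \<in> set_pmf D \<Longrightarrow> k < 2 * N \<Longrightarrow> norm (p k - p (Suc k)) \<le> d"
        using coupling_chain[of "2 * N" "\<lambda>x y. norm (x - y) \<le> d" \<mu>] \<mu>(2) by blast
      \<comment> \<open>The path law has countable support, which is enumerated so that the tubes
        are indexed by naturals. If the support is finite, \<open>from_nat_into\<close> still
        returns some path for the surplus indices, but \<open>E\<close> gives them probability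
        0.\<close>
      define S where "S = set_pmf D"
      define P where "P = from_nat_into S"
      define E where "E = map_pmf (to_nat_on S) D"
      have P_in: "P i \<in> S" for i unfolding P_def S_def by (intro from_nat_into set_pmf_not_empty)
      have marg: "map_pmf (\<lambda>i. P i k) E = \<mu> k" if "k \<le> 2 * N" for k
      proof -
        have "map_pmf (\<lambda>i. P i k) E = map_pmf (\<lambda>p. p k) D"
          unfolding E_def pmf.map_comp o_def
          by (intro map_pmf_cong refl) (simp add: P_def S_def)
        then show ?thesis using D(1)[OF that] by simp
      qed
      have "\<exists>\<gamma> :: real \<Rightarrow> 'a. (\<forall>s. \<exists>v. (\<gamma> has_vector_derivative v) (at s) \<and> norm v \<le> V) \<and>
        (\<forall>k<2 * N. \<forall>t\<in>{t0 + real k * h..t0 + real (Suc k) * h}. norm (\<gamma> t - P i k) \<le> B * d)" for i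
        unfolding V_def
      proof (rule smooth_interpolation[OF B(2,3) h(1)])
        show "norm (P i (Suc k) - P i k) \<le> d" if "k < 2 * N" for k
          using D(2)[OF P_in[unfolded S_def, of i] that] by (simp add: norm_minus_commute)
      qed (use d in simp)
      then obtain \<gamma> :: "nat \<Rightarrow> real \<Rightarrow> 'a" where
        \<gamma>: "\<And>i s. \<exists>v. (\<gamma> i has_vector_derivative v) (at s) \<and> norm v \<le> V"
        and \<gamma>_near: "\<And>i k t. k < 2 * N \<Longrightarrow> t \<in> {t0 + real k * h..t0 + real (Suc k) * h} \<Longrightarrow> norm (\<gamma> i t - P i k) \<le> B * d"
        by metis
      \<comment> \<open>The factor \<open>m\<close> undoes the normalisation of the laws, and
        \<open>H\<close> pays for replacing a point and a time by the lattice corner and the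
        preceding grid time.\<close>
      define w where "w i = H * m * pmf E i" for i
      have Hm: "H * m \<ge> 0" using H 2 by simp
      have w_sums: "w sums (H * m)"
        using sums_mult[OF pmf_nat_sums[of E UNIV], of "H * m"] by (simp add: w_def[abs_def])
      have w0: "w i \<ge> 0" for i using Hm by (simp add: w_def)
      show ?thesis
      proof (intro exI[of _ \<gamma>] exI[of _ w] conjI allI impI \<gamma> w0)
        show "summable w" using w_sums by (simp add: sums_iff)
        \<comment> \<open>The law with index \<open>N\<close> belongs to time 0 and has the same
          normalisation, so \<open>m\<close>, defined at the initial time, is bounded by the mass at
          time 0.\<close>
        have "m \<le> Cm * integral\<^sup>L lebesgue (wave_density 0)"
          using lattice_law_mass_le[OF \<mu>(1)[of N] 2] Cm(2) by (simp add: T_N)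
        then have "r ^ DIM('a) * (H * m) \<le> r ^ DIM('a) * (H * (Cm * integral\<^sup>L lebesgue (wave_density 0)))"
          using r H by (intro mult_left_mono) auto
        moreover have "(\<Sum>i. r ^ DIM('a) * w i) = r ^ DIM('a) * (H * m)"
          using sums_mult[OF w_sums, of "r ^ DIM('a)"] by (simp add: sums_iff)
        ultimately show "(\<Sum>i. r ^ DIM('a) * w i) \<le> C * integral\<^sup>L lebesgue (wave_density 0)"
          by (simp add: C_def mult.assoc)
        fix x :: 'a and t :: real assume "t \<in> {-R..R}"
        from locate[OF this] obtain k where k: "k < 2 * N" "t \<in> {t0 + real k * h..t0 + real (Suc k) * h}" by blast
        define n where "n = lattice_floor x"
        define X where "X = {i. P i k = n}"
        have "wave_density (t *\<^sub>R One) x \<le> H * rho (T k) n" unfolding n_def by (rule dens[OF k(2)])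
        also have "rho (T k) n = m * pmf (\<mu> k) n"
          using \<mu>(1)[of k] 2 lattice_floor_in[of x] by (simp add: lattice_law_def n_def)
        also have "pmf (\<mu> k) n = measure_pmf.prob E X"
          unfolding marg[OF less_imp_le[OF k(1)], symmetric] by (simp add: pmf_map X_def vimage_def)
        also have "H * (m * measure_pmf.prob E X) = (\<Sum>i. w i * indicator X i)"
          using sums_mult[OF pmf_nat_sums[of E X], of "H * m"] by (simp add: sums_iff w_def mult.assoc)
        also have "\<dots> \<le> (\<Sum>i. w i * indicator (tube (\<gamma> i) r) (x, t))"
        proof (rule suminf_le)
          have sw: "summable w" using w_sums by (simp add: sums_iff)
          show "summable (\<lambda>i. w i * indicator X i)" "summable (\<lambda>i. w i * indicator (tube (\<gamma> i) r) (x, t))"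
            by (rule summable_comparison_test'[OF sw, of 0]; use w0 in \<open>auto simp: indicator_def\<close>)+
          fix i
          have "(x, t) \<in> tube (\<gamma> i) r" if "i \<in> X"
          proof -
            have "norm (x - \<gamma> i t) \<le> norm (x - n) + norm (\<gamma> i t - P i k)"
              using that norm_triangle_ineq[of "x - n" "n - \<gamma> i t"] by (simp add: X_def norm_minus_commute)
            also have "\<dots> \<le> d + B * d"
              unfolding n_def using norm_diff_lattice_floor_le[of x] \<gamma>_near[OF k] by (intro add_mono) (auto simp: d_def)
            finally show ?thesis by (simp add: tube_def r_def algebra_simps)
          qed
          then show "w i * indicator X i \<le> w i * indicator (tube (\<gamma> i) r) (x, t)"
            using w0[of i] by (auto simp: indicator_def)
        qed
        finally show "wave_density (t *\<^sub>R One) x \<le> (\<Sum>i. w i * indicator (tube (\<gamma> i) r) (x, t))" .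
      qed
    qed
  qed
qed

end

theorem theorem0p1:
  fixes u :: "'a::euclidean_space \<Rightarrow> real \<Rightarrow> complex"
  assumes "schrod_freq_loc u"
  shows "\<exists>r V C. r > 0 \<and> V > 0 \<and> C > 0 \<and>
    (\<forall>R>0. \<exists>(\<gamma> :: nat \<Rightarrow> real \<Rightarrow> 'a) (w :: nat \<Rightarrow> real).
       (\<forall>i s. \<exists>v. (\<gamma> i has_vector_derivative v) (at s) \<and> norm v \<le> V) \<and>
       (\<forall>i. w i \<ge> 0) \<and> summable w \<and>
       (\<forall>x t. t \<in> {-R..R} \<longrightarrow>
          (cmod (u x t))\<^sup>2 \<le> (\<Sum>i. w i * indicator (tube (\<gamma> i) r) (x, t))) \<and>
       (\<Sum>i. r ^ DIM('a) * w i) \<le> C * integral\<^sup>L lebesgue (\<lambda>x. (cmod (u x 0))\<^sup>2))"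
proof -
  from assms obtain g :: "'a \<Rightarrow> complex" where
    g: "g \<in> borel_measurable lebesgue" "integrable lebesgue (\<lambda>\<xi>. (cmod (g \<xi>))\<^sup>2)"
      "\<forall>\<xi>. 1 < norm \<xi> \<longrightarrow> g \<xi> = 0" and u: "u = schrod_sol g"
    unfolding schrod_freq_loc_def by blast
  interpret schrodinger_datum g by unfold_locales (use g in auto)
  have "(cmod (u x t))\<^sup>2 = wave_density (t *\<^sub>R One) x" for x t
    by (simp add: u schrod_sol_eq_wave wave_density_def)
  then show ?thesis using tube_domination by (simp add: wave_density_def[abs_def])
qed

end
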